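(* Let $Q$ be a type $A$ quiver with vertex set $\{1,\dots,n\}$, $n>1$, such that every arrow of $Q$ lies in an oriented $3$-cycle of $Q$. Let $\mathbf{a}=(a_1,\dots,a_n)\in\mathbb{Z}_{\ge0}^n$ be the $\mathbf{d}$-vector of a cluster monomial $x[\mathbf{a}]$ of $\mathcal{A}(Q)$. For each arrow $i\to j$ of $Q$, let $\mathcal{D}^{(i,j)}=\mathcal{D}^{a_i\times a_j}$ with corner-first index. Denote its horizontal edges by $u^{(i,j)}_1,\dots,u^{(i,j)}_{a_i}$ (forming the set $\mathcal{D}^{(i,j)}_1$) and its vertical edges by $v^{(i,j)}_1,\dots,v^{(i,j)}_{a_j}$ (forming the set $\mathcal{D}^{(i,j)}_2$). A collection $\{S^{(i,j)}_\ell\subseteq\mathcal{D}^{(i,j)}_\ell : i\to j\text{ an arrow},\ \ell\in\{1,2\}\}$ is a globally compatible collection (GCC) if for every pair of arrows $k\to i\to j$ of $Q$: - if $j\to k$ is also an arrow of $Q$, then $S^{(i,j)}_1$ and $S^{(i,j)}_2$ are $\sigma_{ijk}$-compatible, and $v^{(k,i)}_r\in S^{(k,i)}_2\iff u^{(i,j)}_{a_i+1-r}\notin S^{(i,j)}_1$ for all $r\in[1,a_i]$; - otherwise, $v^{(k,i)}_r\in S^{(k,i)}_2\iff u^{(i,j)}_{r}\notin S^{(i,j)}_1$ for all $r\in[1,a_i]$. Then $$x[\mathbf{a}]=\Big(\prod_{l=1}^n x_l^{-a_l}\Big)\sum\Big(\prod_{i\to j}x_i^{|S^{(i,j)}_2|}x_j^{|S^{(i,j)}_1|}\Big)\cdot\prod_{i\to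 j\to k\to i}x_i^{-\sigma_{jki}},$$ where the sum is over all GCCs, the first product is over all arrows of $Q$, and the last product is over all $3$-cycles $i\to j\to k\to i$ of $Q$ with each $3$-cycle contributing one factor for each of its three cyclic rotations.
   Context: A quiver is a finite directed graph without loops and without oriented $2$-cycles. For a quiver $R$ on $\{1,\dots,N\}$, the coefficient-free cluster algebra $\mathcal{A}(R)\subset\mathbb{Q}(x_1,\dots,x_N)$ is generated by cluster variables. These are obtained from the initial seed $((x_1,\dots,x_N),R)$ by iterated mutations. Mutation at $k$ replaces the quiver by $\mu_k$ of it (add $i\to j$ for each path $i\to k\to j$, reverse arrows at $k$, delete $2$-cycles). It replaces $u_k$ by $(\prod_{j\to k}u_j+\prod_{k\to j}u_j)/u_k$. A cluster monomial is a product of nonnegative powers of cluster variables from a single cluster. A type $A$ quiver is one mutation-equivalent to $1\to\cdots\to N$. It arises from a triangulation of a convex $(N+3)$-gon by non-crossing diagonals $T_1,\dots,T_N$: there is an arrow $i\to j$ iff $T_i,T_j$ are sides of a common triangle and $T_j$ is obtained from $T_i$ by counterclockwise rotation (by less than $180^\circ$) about their common endpoint. Cluster variables correspond to diagonals, with $x_i\leftrightarrow T_i$. Cluster monomials correspond to collections $\{(D_j,d_j)\}$ of distinct pairwise non-crossing diagonals with positive multiplicities. For diagonals $D,E$, set $i(D,E)=1$ if they cross in the interior, $-1$ if equal, and $0$ otherwise. The $\mathbf{d}$-vector is $a_i=\sum_j d_j\,i(D_j,T_i)$. $[x]_+=\max(x,0)$; $\sigma(x,y,z)=\tfrac12([x+y-z]_+-[x-y-z]_+-[y-x-z]_+)$;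 $\sigma_{ijk}=\sigma(a_i,a_j,a_k)$. For nonnegative integers $a_1,a_2$, the maximal Dyck path $\mathcal{D}^{a_1\times a_2}$ is the lattice path of unit east and north steps from $(0,0)$ to $(a_1,a_2)$. It never goes above the segment joining these points and is as close as possible to it. A corner is a horizontal edge immediately followed by a vertical edge. Let $c=\min(a_1,a_2)$. In the corner-first index, the horizontal edges are labelled $u_1,\dots,u_{a_1}$: $u_i$ is the horizontal edge of the $i$-th corner for $i\le c$, and $u_{c+i}$ is the $i$-th of the remaining horizontal edges. Vertical edges are labelled $v_1,\dots,v_{a_2}$ similarly. Corners are counted from bottom-left to top-right, horizontal edges from left to right, and vertical edges from bottom to top. For $s\in\mathbb{Z}_{\ge0}$, subsets $S_1$ of horizontal edges and $S_2$ of vertical edges are $s$-compatible if for every $1\le r\le s$, $u_r\notin S_1$ or $v_r\notin S_2$. *)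

theory Defs
  imports
    Complex_Main
    "HOL-Library.Poly_Mapping"
    "HOL-Library.FuncSet"
    "HOL-Computational_Algebra.Fraction_Field"
begin

section \<open>Rational functions\<close>

text \<open>
  The field of rational functions over the rationals in countably many variables
  \<open>x\<^sub>0, x\<^sub>1, x\<^sub>2, \<dots>\<close>.  The field \<open>\<rat>(x\<^sub>1, \<dots>, x\<^sub>N)\<close> is the subfield generated by
  \<open>x\<^sub>1, \<dots>, x\<^sub>N\<close>; all seeds and all formulas on vertex set \<open>{1..N}\<close> live in that subfield.
\<close>

type_synonym ratfun = "((nat \<Rightarrow>\<^sub>0 nat) \<Rightarrow>\<^sub>0 rat) fract"

definition xvar :: "nat \<Rightarrow> ratfun" where
  "xvar i = Fract (Poly_Mapping.single (Poly_Mapping.single i 1) 1) 1"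


section \<open>Quivers, mutation, cluster monomials\<close>

text \<open>\<open>R i j\<close> is the number of arrows \<open>i \<rightarrow> j\<close>.\<close>

type_synonym quiver = "nat \<Rightarrow> nat \<Rightarrow> nat"

definition is_quiver :: "nat \<Rightarrow> quiver \<Rightarrow> bool" where
  "is_quiver N R \<longleftrightarrow>
     (\<forall>i j. R i j > 0 \<longrightarrow> i \<in> {1..N} \<and> j \<in> {1..N}) \<and>
     (\<forall>i. R i i = 0) \<and>
     (\<forall>i j. R i j > 0 \<longrightarrow> R j i = 0)"

text \<open>
  For \<open>i, j \<noteq> k\<close>, after adding an arrow for each path through \<open>k\<close>, the truncated subtraction
  on the natural numbers deletes a maximal collection of disjoint oriented 2-cycles.
\<close>

definition mutate_quiver :: "nat \<Rightarrow> quiver \<Rightarrow> quiver" where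
  "mutate_quiver k R = (\<lambda>i j.
     if i = k \<or> j = k then R j i
     else (R i j + R i k * R k j) - (R j i + R j k * R k i))"

definition mutate_cluster :: "nat \<Rightarrow> nat \<Rightarrow> quiver \<Rightarrow> (nat \<Rightarrow> ratfun) \<Rightarrow> (nat \<Rightarrow> ratfun)" where
  "mutate_cluster N k R u =
     u(k := ((\<Prod>j\<in>{1..N}. u j ^ R j k) + (\<Prod>j\<in>{1..N}. u j ^ R k j)) / u k)"

inductive mutation_equivalent :: "nat \<Rightarrow> quiver \<Rightarrow> quiver \<Rightarrow> bool" for N :: nat and R :: quiver where
  refl: "mutation_equivalent N R R"
| step: "mutation_equivalent N R R' \<Longrightarrow> k \<in> {1..N} \<Longrightarrow>
         mutation_equivalent N R (mutate_quiver k R')"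

definition linear_quiver :: "nat \<Rightarrow> quiver" where
  "linear_quiver N = (\<lambda>i j. if 1 \<le> i \<and> j = i + 1 \<and> j \<le> N then 1 else 0)"

definition type_A_quiver :: "nat \<Rightarrow> quiver \<Rightarrow> bool" where
  "type_A_quiver N R \<longleftrightarrow> is_quiver N R \<and> mutation_equivalent N (linear_quiver N) R"

text \<open>\<open>seed N R u R'\<close>: the pair \<open>(u, R')\<close> is obtained from the initial seed \<open>(x, R)\<close> by
  iterated mutations.\<close>

inductive seed :: "nat \<Rightarrow> quiver \<Rightarrow> (nat \<Rightarrow> ratfun) \<Rightarrow> quiver \<Rightarrow> bool" for N :: nat and R :: quiver where
  init: "seed N R xvar R"
| step: "seed N R u R' \<Longrightarrow> k \<in> {1..N} \<Longrightarrow>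
         seed N R (mutate_cluster N k R' u) (mutate_quiver k R')"

definition cluster_monomial :: "nat \<Rightarrow> quiver \<Rightarrow> ratfun \<Rightarrow> bool" where
  "cluster_monomial N R X \<longleftrightarrow>
     (\<exists>u R' m. seed N R u R' \<and> X = (\<Prod>j\<in>{1..N}. u j ^ (m j :: nat)))"

definition arrows :: "quiver \<Rightarrow> (nat \<times> nat) set" where
  "arrows R = {(i, j). R i j > 0}"

text \<open>Each oriented 3-cycle occurs here as three triples, one for each cyclic rotation.\<close>

definition three_cycles :: "quiver \<Rightarrow> (nat \<times> nat \<times> nat) set" where
  "three_cycles R = {(i, j, k). (i, j) \<in> arrows R \<and> (j, k) \<in> arrows R \<and> (k, i) \<in> arrows R}"


section \<open>Triangulations of a convex polygon\<close>

text \<open>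
  The vertices of the convex \<open>(N+3)\<close>-gon are \<open>0, \<dots>, N+2\<close> in counterclockwise order, and a
  segment between two vertices is the two-element set of its endpoints.
\<close>

definition polygon_side :: "nat \<Rightarrow> nat set \<Rightarrow> bool" where
  "polygon_side N E \<longleftrightarrow> (\<exists>p < N + 3. E = {p, (p + 1) mod (N + 3)})"

definition diagonal :: "nat \<Rightarrow> nat set \<Rightarrow> bool" where
  "diagonal N D \<longleftrightarrow> D \<subseteq> {..<N + 3} \<and> card D = 2 \<and> \<not> polygon_side N D"

definition crosses :: "nat set \<Rightarrow> nat set \<Rightarrow> bool" where
  "crosses D E \<longleftrightarrow>
     (\<exists>p q r s. p < q \<and> q < r \<and> r < s \<and>
        (D = {p, r} \<and> E = {q, s} \<or> D = {q, s} \<and> E = {p, r}))"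

definition crossing_number :: "nat set \<Rightarrow> nat set \<Rightarrow> int" where
  "crossing_number D E = (if crosses D E then 1 else if D = E then -1 else 0)"

definition triangulation :: "nat \<Rightarrow> (nat \<Rightarrow> nat set) \<Rightarrow> bool" where
  "triangulation N T \<longleftrightarrow>
     (\<forall>i\<in>{1..N}. diagonal N (T i)) \<and> inj_on T {1..N} \<and>
     (\<forall>i\<in>{1..N}. \<forall>j\<in>{1..N}. \<not> crosses (T i) (T j))"

text \<open>
  Three distinct vertices \<open>p, q, r\<close> span a triangle of the triangulation iff each of the three
  segments between them is a side of the polygon or one of the \<open>T\<^sub>m\<close>.  Seen from \<open>p\<close>, the rays
  to the other vertices occur counterclockwise in the order \<open>p+1, p+2, \<dots>\<close> (modulo \<open>N+3\<close>),
  within an angle less than \<open>180\<close> degrees.  So \<open>{p, r}\<close> is obtained from \<open>{p, q}\<close> by such a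
  counterclockwise rotation about \<open>p\<close> iff \<open>q\<close> comes before \<open>r\<close> in that order.
\<close>

definition quiver_of_triangulation :: "nat \<Rightarrow> (nat \<Rightarrow> nat set) \<Rightarrow> quiver" where
  "quiver_of_triangulation N T = (\<lambda>i j.
     if i \<in> {1..N} \<and> j \<in> {1..N} \<and>
        (\<exists>p q r. p < N + 3 \<and> q < N + 3 \<and> r < N + 3 \<and> p \<noteq> q \<and> p \<noteq> r \<and> q \<noteq> r \<and>
           T i = {p, q} \<and> T j = {p, r} \<and>
           (polygon_side N {q, r} \<or> {q, r} \<in> T ` {1..N}) \<and>
           (q + (N + 3) - p) mod (N + 3) < (r + (N + 3) - p) mod (N + 3))
     then 1 else 0)"

text \<open>
  The correspondence between diagonals and cluster variables: \<open>T\<^sub>i\<close> corresponds to \<open>x\<^sub>i\<close>, and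
  mutation at \<open>k\<close> corresponds to the flip of the \<open>k\<close>-th diagonal, i.e. its replacement by the
  other diagonal that completes the remaining ones to a triangulation.
\<close>

inductive flip_seed ::
  "nat \<Rightarrow> (nat \<Rightarrow> nat set) \<Rightarrow> (nat \<Rightarrow> nat set) \<Rightarrow> (nat \<Rightarrow> ratfun) \<Rightarrow> quiver \<Rightarrow> bool"
  for N :: nat and T :: "nat \<Rightarrow> nat set"
where
  init: "flip_seed N T T xvar (quiver_of_triangulation N T)"
| step: "flip_seed N T T' u R' \<Longrightarrow> k \<in> {1..N} \<Longrightarrow> D \<noteq> T' k \<Longrightarrow> triangulation N (T'(k := D)) \<Longrightarrow>
         flip_seed N T (T'(k := D)) (mutate_cluster N k R' u) (mutate_quiver k R')"

definition variable_of_diagonal :: "nat \<Rightarrow> (nat \<Rightarrow> nat set) \<Rightarrow> nat set \<Rightarrow> ratfun \<Rightarrow> bool" where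
  "variable_of_diagonal N T D z \<longleftrightarrow>
     (\<exists>T' u R' j. flip_seed N T T' u R' \<and> j \<in> {1..N} \<and> T' j = D \<and> u j = z)"

definition monomial_of_collection ::
  "nat \<Rightarrow> (nat \<Rightarrow> nat set) \<Rightarrow> nat set set \<Rightarrow> (nat set \<Rightarrow> nat) \<Rightarrow> ratfun \<Rightarrow> bool" where
  "monomial_of_collection N T C d X \<longleftrightarrow>
     finite C \<and> (\<forall>D\<in>C. diagonal N D \<and> d D > 0) \<and> (\<forall>D\<in>C. \<forall>E\<in>C. \<not> crosses D E) \<and>
     (\<exists>z. (\<forall>D\<in>C. variable_of_diagonal N T D (z D)) \<and> X = (\<Prod>D\<in>C. z D ^ d D))"

text \<open>\<open>has_d_vector N T X a\<close>: with respect to the initial triangulation \<open>T\<close>, the element \<open>X\<close> is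
  the cluster monomial of a collection of diagonals whose \<open>d\<close>-vector is \<open>(a\<^sub>1, \<dots>, a\<^sub>N)\<close>.\<close>

definition has_d_vector :: "nat \<Rightarrow> (nat \<Rightarrow> nat set) \<Rightarrow> ratfun \<Rightarrow> (nat \<Rightarrow> int) \<Rightarrow> bool" where
  "has_d_vector N T X a \<longleftrightarrow>
     (\<exists>C d. monomial_of_collection N T C d X \<and>
        (\<forall>i\<in>{1..N}. a i = (\<Sum>D\<in>C. int (d D) * crossing_number D (T i))))"


section \<open>The function sigma\<close>

definition pos_part :: "int \<Rightarrow> int" where
  "pos_part x = max x 0"

text \<open>
  On the \<open>d\<close>-vector entries along a 3-cycle this rational number is a nonnegative integer, and
  \<open>sigma_nat\<close> is that integer.
\<close>

definition sigma :: "int \<Rightarrow> int \<Rightarrow> int \<Rightarrow> rat" where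
  "sigma x y z =
     1 / 2 * of_int (pos_part (x + y - z) - pos_part (x - y - z) - pos_part (y - x - z))"

definition sigma_nat :: "nat \<Rightarrow> nat \<Rightarrow> nat \<Rightarrow> nat" where
  "sigma_nat x y z = nat \<lfloor>sigma (int x) (int y) (int z)\<rfloor>"


section \<open>Maximal Dyck paths\<close>

datatype step = East | North

text \<open>
  A lattice path starting at \<open>(0,0)\<close> is the list of its steps; its point after \<open>t\<close> steps is
  \<open>(count_list (take t w) East, count_list (take t w) North)\<close>.  The point \<open>(x, y)\<close> is not above
  the segment from \<open>(0,0)\<close> to \<open>(a\<^sub>1, a\<^sub>2)\<close> iff \<open>a\<^sub>1 y \<le> a\<^sub>2 x\<close>.
\<close>

definition dyck_path :: "nat \<Rightarrow> nat \<Rightarrow> step list \<Rightarrow> bool" where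
  "dyck_path a1 a2 w \<longleftrightarrow>
     count_list w East = a1 \<and> count_list w North = a2 \<and>
     (\<forall>t \<le> length w. a1 * count_list (take t w) North \<le> a2 * count_list (take t w) East)"

text \<open>
  Closest to the segment: weakly above every other such path.  After the same number of steps,
  the points of two paths lie on a common antidiagonal, so the heights can be compared.
\<close>

definition maximal_dyck_path :: "nat \<Rightarrow> nat \<Rightarrow> step list" where
  "maximal_dyck_path a1 a2 =
     (THE w. dyck_path a1 a2 w \<and>
        (\<forall>w'. dyck_path a1 a2 w' \<longrightarrow>
           (\<forall>t \<le> a1 + a2. count_list (take t w') North \<le> count_list (take t w) North)))"

text \<open>Edges of a path are identified with their positions in the list of steps.\<close>

definition horizontal_edges :: "step list \<Rightarrow> nat list" where
  "horizontal_edges w = filter (\<lambda>p. w ! p = East) [0..<length w]"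

definition vertical_edges :: "step list \<Rightarrow> nat list" where
  "vertical_edges w = filter (\<lambda>p. w ! p = North) [0..<length w]"

text \<open>\<open>corner w p\<close>: the edges \<open>p\<close> and \<open>p + 1\<close> form a corner.\<close>

definition corner :: "step list \<Rightarrow> nat \<Rightarrow> bool" where
  "corner w p \<longleftrightarrow> p + 1 < length w \<and> w ! p = East \<and> w ! (p + 1) = North"

text \<open>
  The corner-first index: with \<open>c = min a\<^sub>1 a\<^sub>2\<close>, labels \<open>1, \<dots>, c\<close> go to the edges at the corners
  (the path has exactly \<open>c\<close> corners) and the labels after \<open>c\<close> to the remaining edges.
\<close>

definition u_edge :: "nat \<Rightarrow> nat \<Rightarrow> nat \<Rightarrow> nat" where
  "u_edge a1 a2 r =
     (let w = maximal_dyck_path a1 a2; c = min a1 a2 in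
      if r \<le> c then filter (corner w) (horizontal_edges w) ! (r - 1)
      else filter (\<lambda>p. \<not> corner w p) (horizontal_edges w) ! (r - c - 1))"

definition v_edge :: "nat \<Rightarrow> nat \<Rightarrow> nat \<Rightarrow> nat" where
  "v_edge a1 a2 r =
     (let w = maximal_dyck_path a1 a2; c = min a1 a2;
          at_corner = (\<lambda>p. p > 0 \<and> corner w (p - 1)) in
      if r \<le> c then filter at_corner (vertical_edges w) ! (r - 1)
      else filter (\<lambda>p. \<not> at_corner p) (vertical_edges w) ! (r - c - 1))"

definition H_edges :: "nat \<Rightarrow> nat \<Rightarrow> nat set" where
  "H_edges a1 a2 = set (horizontal_edges (maximal_dyck_path a1 a2))"

definition V_edges :: "nat \<Rightarrow> nat \<Rightarrow> nat set" where
  "V_edges a1 a2 = set (vertical_edges (maximal_dyck_path a1 a2))"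

definition s_compatible :: "nat \<Rightarrow> nat \<Rightarrow> nat \<Rightarrow> nat set \<Rightarrow> nat set \<Rightarrow> bool" where
  "s_compatible a1 a2 s S1 S2 \<longleftrightarrow>
     (\<forall>r\<in>{1..s}. u_edge a1 a2 r \<notin> S1 \<or> v_edge a1 a2 r \<notin> S2)"


section \<open>Globally compatible collections\<close>

text \<open>
  A collection assigns to each arrow the pair \<open>(S\<^sub>1, S\<^sub>2)\<close>; it is \<open>undefined\<close> off the arrows, so
  that distinct functions are distinct collections.
\<close>

type_synonym edge_collection = "nat \<times> nat \<Rightarrow> nat set \<times> nat set"

definition GCC :: "quiver \<Rightarrow> (nat \<Rightarrow> nat) \<Rightarrow> edge_collection set" where
  "GCC R a =
     {S \<in> (\<Pi>\<^sub>E (i, j)\<in>arrows R. Pow (H_edges (a i) (a j)) \<times> Pow (V_edges (a i) (a j))).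
        \<forall>k i j. (k, i) \<in> arrows R \<and> (i, j) \<in> arrows R \<longrightarrow>
          (if (j, k) \<in> arrows R then
             s_compatible (a i) (a j) (sigma_nat (a i) (a j) (a k)) (fst (S (i, j))) (snd (S (i, j))) \<and>
             (\<forall>r\<in>{1..a i}. v_edge (a k) (a i) r \<in> snd (S (k, i)) \<longleftrightarrow>
                            u_edge (a i) (a j) (a i + 1 - r) \<notin> fst (S (i, j)))
           else
             (\<forall>r\<in>{1..a i}. v_edge (a k) (a i) r \<in> snd (S (k, i)) \<longleftrightarrow>
                            u_edge (a i) (a j) r \<notin> fst (S (i, j))))}"

end

theory Submission
  imports Defs
begin

text \<open>
  Assign to each polygon vertex a vector in the plane over the rational functions so that the
  determinants of the endpoints of all sides are \<open>1\<close> and those of the \<open>T\<^sub>i\<close> are \<open>x\<^sub>i\<close>.  All these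
  determinants satisfy the Ptolemy relations, and flips of triangulations correspond to
  mutations, so that they are the cluster variables.

  A Ptolemy recursion from triangle to triangle writes the variable of a diagonal \<open>D\<close> as a sum over
  the sets \<open>\<theta>\<close> of crossed \<open>T\<^sub>i\<close> that are closed under the arrows between crossed \<open>T\<^sub>i\<close>.  Finally,
  the labels \<open>1, \<dots>, a\<^sub>i\<close> of the edges of a Dyck path are identified with the crossings of the
  collection with \<open>T\<^sub>i\<close> in their order along \<open>T\<^sub>i\<close>.  Then \<open>\<sigma>\<^sub>i\<^sub>j\<^sub>k\<close> counts the arcs that cut off the
  corner between \<open>T\<^sub>i\<close> and \<open>T\<^sub>j\<close>, and a globally compatible collection is a choice of such a
  set \<open>\<theta>\<close> for each arc, because compatibility only relates crossings of the same arc.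
\<close>

section \<open>Maximal Dyck paths\<close>

text \<open>The shape of a Dyck path enters only through its number of corners: it makes the
  corner-first labels bijections onto the edges, and then all conditions and weights can be read off
  the labels. The factors with exponent \<open>- \<sigma>\<close> come from third sides: in the
  expansion of one diagonal, each arrow between two crossed \<open>T\<^sub>i\<close>,
  \<open>T\<^sub>j\<close> puts the variable of the third side of their triangle into the
  denominator. Over all arcs, that variable collects as exponent the number of arcs crossing both,
  which is \<open>\<sigma>\<close>. The 3-cycle hypothesis gives every arrow a predecessor and a
  successor, so the gluing rules tie together all labels of one crossing, and it makes the
  compatibility condition available at every arrow. \<open>n > 1\<close> excludes a diagonal without
  arrows, whose crossings would appear on no path. The determinants must be nonzero before an
  exchange relation can be solved for the new variable; their construction does not show this, but
  Ptolemy relations can be solved without subtraction, so positivity propagates from the given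
  edges.\<close>

lemma count_list_steps: "count_list w East + count_list w North = length w"
proof (induction w)
  case (Cons x w)
  then show ?case by (cases x) auto
qed simp

text \<open>On the antidiagonal \<open>x + y = t\<close> the condition
  \<open>a1 * y \<le> a2 * x\<close> reads \<open>y * (a1 + a2) \<le> a2 * t\<close>, so the floor
  is the greatest height allowed after \<open>t\<close> steps. For \<open>a1 = a2 = 0\<close> the
  quotient is 0 by convention.\<close>

definition dyck_height :: "nat \<Rightarrow> nat \<Rightarrow> nat \<Rightarrow> nat" where
  "dyck_height a1 a2 t = a2 * t div (a1 + a2)"

definition floor_path :: "nat \<Rightarrow> nat \<Rightarrow> step list" where
  "floor_path a1 a2 =
     map (\<lambda>t. if dyck_height a1 a2 (Suc t) = dyck_height a1 a2 t then East else North) [0..<a1 + a2]"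

lemma length_floor_path [simp]: "length (floor_path a1 a2) = a1 + a2"
  by (simp add: floor_path_def)

lemma nth_floor_path:
  "t < a1 + a2 \<Longrightarrow>
     floor_path a1 a2 ! t = (if dyck_height a1 a2 (Suc t) = dyck_height a1 a2 t then East else North)"
  by (simp add: floor_path_def)

lemma le_dyck_height_iff: "0 < a1 + a2 \<Longrightarrow> y \<le> dyck_height a1 a2 t \<longleftrightarrow> y * (a1 + a2) \<le> a2 * t"
  by (simp add: dyck_height_def less_eq_div_iff_mult_less_eq)

lemma dyck_height_Suc: "dyck_height a1 a2 (Suc t) = dyck_height a1 a2 t \<or>
    dyck_height a1 a2 (Suc t) = Suc (dyck_height a1 a2 t)"
proof (cases "a1 + a2 = 0")
  case False
  have "dyck_height a1 a2 t \<le> dyck_height a1 a2 (Suc t)"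
    by (simp add: dyck_height_def div_le_mono)
  moreover have "a2 * Suc t div (a1 + a2) \<le> (a2 * t + (a1 + a2)) div (a1 + a2)"
    by (rule div_le_mono) simp
  ultimately show ?thesis using False unfolding dyck_height_def by (auto simp: le_Suc_eq)
qed (simp add: dyck_height_def)

lemma count_take_floor_path:
  "t \<le> a1 + a2 \<Longrightarrow> count_list (take t (floor_path a1 a2)) North = dyck_height a1 a2 t"
proof (induction t)
  case 0
  then show ?case by (simp add: dyck_height_def)
next
  case (Suc t)
  then show ?case using dyck_height_Suc[of a1 a2 t]
    by (auto simp: take_Suc_conv_app_nth nth_floor_path)
qed

lemma count_take_le_dyck_height:
  assumes "dyck_path a1 a2 w" "t \<le> a1 + a2"
  shows "count_list (take t w) North \<le> dyck_height a1 a2 t"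
proof (cases "a1 + a2 = 0")
  case True
  then show ?thesis using assms by (simp add: dyck_height_def)
next
  case False
  have len: "length w = a1 + a2"
    using assms count_list_steps[of w] by (simp add: dyck_path_def)
  have "count_list (take t w) East + count_list (take t w) North = t"
    using count_list_steps[of "take t w"] assms len by simp
  then have t: "t = count_list (take t w) East + count_list (take t w) North" ..
  have "a1 * count_list (take t w) North \<le> a2 * count_list (take t w) East"
    using assms len by (simp add: dyck_path_def)
  then have "count_list (take t w) North * (a1 + a2) \<le> a2 * t"
    by (subst t) (simp add: algebra_simps)
  then show ?thesis using False by (simp add: le_dyck_height_iff)
qed

lemma dyck_path_floor_path: "dyck_path a1 a2 (floor_path a1 a2)"
proof (cases "a1 + a2 = 0")
  case True
  then show ?thesis by (simp add: dyck_path_def floor_path_def)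
next
  case False
  have N: "count_list (floor_path a1 a2) North = a2"
    using count_take_floor_path[of "a1 + a2" a1 a2] False by (simp add: dyck_height_def)
  moreover have "count_list (floor_path a1 a2) East = a1"
    using count_list_steps[of "floor_path a1 a2"] N by simp
  moreover have "a1 * count_list (take t (floor_path a1 a2)) North
      \<le> a2 * count_list (take t (floor_path a1 a2)) East" if "t \<le> a1 + a2" for t
  proof -
    have t: "t = count_list (take t (floor_path a1 a2)) East + count_list (take t (floor_path a1 a2)) North"
      using count_list_steps[of "take t (floor_path a1 a2)"] that by simp
    have "count_list (take t (floor_path a1 a2)) North * (a1 + a2) \<le> a2 * t"
      using le_dyck_height_iff[of a1 a2 "count_list (take t (floor_path a1 a2)) North" t]
        count_take_floor_path[OF that] False by simp
    then show ?thesis by (subst (asm) (2) t) (simp add: algebra_simps)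
  qed
  ultimately show ?thesis by (simp add: dyck_path_def)
qed

lemma step_list_eqI:
  assumes "length w = length w'"
    "\<And>t. t \<le> length w \<Longrightarrow> count_list (take t w) North = count_list (take t w') North"
  shows "w = w'"
proof (rule nth_equalityI)
  fix t assume t: "t < length w"
  have "count_list (take (Suc t) w) North = count_list (take (Suc t) w') North"
    "count_list (take t w) North = count_list (take t w') North"
    using assms(2)[of "Suc t"] assms(2)[of t] t by auto
  then show "w ! t = w' ! t"
    using t assms(1) by (cases "w ! t"; cases "w' ! t") (auto simp: take_Suc_conv_app_nth)
qed (use assms in simp)

text \<open>\<open>floor_path\<close> attains the upper bound of all heights simultaneously, hence
  is closest to the segment. Another closest path has the same heights throughout, and the heights
  determine the steps.\<close>

lemma maximal_dyck_path_eq: "maximal_dyck_path a1 a2 = floor_path a1 a2"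
  unfolding maximal_dyck_path_def
proof (rule the_equality)
  show "dyck_path a1 a2 (floor_path a1 a2) \<and> (\<forall>w'. dyck_path a1 a2 w' \<longrightarrow>
      (\<forall>t \<le> a1 + a2. count_list (take t w') North \<le> count_list (take t (floor_path a1 a2)) North))"
    by (simp add: dyck_path_floor_path count_take_floor_path count_take_le_dyck_height)
next
  fix w
  assume w: "dyck_path a1 a2 w \<and> (\<forall>w'. dyck_path a1 a2 w' \<longrightarrow>
      (\<forall>t \<le> a1 + a2. count_list (take t w') North \<le> count_list (take t w) North))"
  have len: "length w = a1 + a2"
    using w count_list_steps[of w] by (simp add: dyck_path_def)
  show "w = floor_path a1 a2"
  proof (rule step_list_eqI)
    fix t assume t: "t \<le> length w"
    have "count_list (take t (floor_path a1 a2)) North \<le> count_list (take t w) North"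
      using w dyck_path_floor_path t len by simp
    moreover have "count_list (take t w) North \<le> count_list (take t (floor_path a1 a2)) North"
      using count_take_le_dyck_height[of a1 a2 w t] w t len by (simp add: count_take_floor_path)
    ultimately show "count_list (take t w) North = count_list (take t (floor_path a1 a2)) North"
      by simp
  qed (simp add: len)
qed

lemma set_horizontal_edges: "set (horizontal_edges w) = {p. p < length w \<and> w ! p = East}"
  and set_vertical_edges: "set (vertical_edges w) = {p. p < length w \<and> w ! p = North}"
  by (auto simp: horizontal_edges_def vertical_edges_def)

lemma length_filter_nth:
  "length (filter (\<lambda>p. w ! p = x) [0..<length w]) = count_list w x"
proof -
  have "filter ((=) x) w = map ((!) w) (filter ((=) x \<circ> (!) w) [0..<length w])"
    by (metis filter_map map_nth)
  moreover have "(=) x \<circ> (!) w = (\<lambda>p. w ! p = x)" by auto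
  ultimately show ?thesis by (metis count_list_eq_length_filter length_map)
qed

text \<open>If \<open>a1 \<le> a2\<close>, two steps raise the height by at least 1, so every East
  step is followed by North and corners correspond to East steps. Otherwise two steps raise it by at
  most 1, so every North step is preceded by East and corners correspond to North steps.\<close>

lemma card_corner_floor_path: "card {p. corner (floor_path a1 a2) p} = min a1 a2"
proof (cases "a1 \<le> a2")
  case True
  let ?w = "floor_path a1 a2" and ?h = "dyck_height a1 a2"
  have "?w ! Suc p = North \<and> Suc p < a1 + a2" if p: "p < a1 + a2" "?w ! p = East" for p
  proof -
    have n: "a1 + a2 > 0" and E: "?h (Suc p) = ?h p"
      using p by (auto simp: nth_floor_path split: if_splits)
    have "?h p + 1 \<le> ?h (Suc (Suc p))"
    proof -
      have "?h p * (a1 + a2) \<le> a2 * p"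
        using le_dyck_height_iff[OF n, of "?h p" p] by simp
      then have "(?h p + 1) * (a1 + a2) \<le> a2 * Suc (Suc p)"
        using True by (simp add: algebra_simps)
      then show ?thesis using le_dyck_height_iff[OF n] by blast
    qed
    \<comment> \<open>The last step cannot be East: the height \<open>a2\<close> would already be
      reached one step early, which the bound forbids because \<open>a2 > 0\<close>.\<close>
    moreover have "Suc p \<noteq> a1 + a2"
    proof
      assume eq: "Suc p = a1 + a2"
      have "?h (Suc p) = a2" using n by (simp add: eq dyck_height_def)
      then have "a2 * (a1 + a2) \<le> a2 * p"
        using le_dyck_height_iff[OF n, of a2 p] E by simp
      moreover have "a2 > 0" using n True by linarith
      ultimately show False using eq by simp
    qed
    ultimately show ?thesis using E p by (auto simp: nth_floor_path)
  qed
  then have "{p. corner ?w p} = {p. p < length ?w \<and> ?w ! p = East}"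
    by (auto simp: corner_def)
  also have "\<dots> = set (filter (\<lambda>p. ?w ! p = East) [0..<length ?w])" by auto
  also have "card \<dots> = count_list ?w East"
    by (subst distinct_card) (simp_all only: distinct_filter distinct_upt length_filter_nth)
  finally show ?thesis using True dyck_path_floor_path[of a1 a2] by (simp add: dyck_path_def)
next
  case False
  let ?w = "floor_path a1 a2" and ?h = "dyck_height a1 a2"
  have pred: "p > 0 \<and> ?w ! (p - 1) = East" if p: "p < a1 + a2" "?w ! p = North" for p
  proof -
    have n: "a1 + a2 > 0" and E: "?h (Suc p) = Suc (?h p)"
      using p dyck_height_Suc[of a1 a2 p] by (auto simp: nth_floor_path split: if_splits)
    have "p > 0"
    proof (rule ccontr)
      assume "\<not> p > 0"
      then have "?h (Suc p) = 0" "?h p = 0" using False by (auto simp: dyck_height_def)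
      then show False using E by simp
    qed
    then obtain m where m: "p = Suc m" by (cases p) auto
    have "?h (Suc (Suc m)) \<le> ?h m + 1"
    proof -
      have "a2 * Suc (Suc m) div (a1 + a2) \<le> (a2 * m + (a1 + a2)) div (a1 + a2)"
        using False by (intro div_le_mono) simp
      then show ?thesis using n by (simp add: dyck_height_def)
    qed
    then have "?h (Suc m) = ?h m" using E m dyck_height_Suc[of a1 a2 m] by auto
    then show ?thesis using m p by (simp add: nth_floor_path)
  qed
  have "Suc ` {p. corner ?w p} = {p. p < length ?w \<and> ?w ! p = North}"
  proof (intro equalityI subsetI)
    fix p assume "p \<in> {p. p < length ?w \<and> ?w ! p = North}"
    then show "p \<in> Suc ` {p. corner ?w p}"
      using pred[of p] by (intro image_eqI[of _ _ "p - 1"]) (auto simp: corner_def)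
  qed (auto simp: corner_def)
  also have "\<dots> = set (filter (\<lambda>p. ?w ! p = North) [0..<length ?w])" by auto
  also have "card \<dots> = count_list ?w North"
    by (subst distinct_card) (simp_all only: distinct_filter distinct_upt length_filter_nth)
  finally have "card (Suc ` {p. corner ?w p}) = count_list ?w North" .
  then show ?thesis using False dyck_path_floor_path[of a1 a2]
    by (simp add: dyck_path_def card_image)
qed

text \<open>Label \<open>r\<close> is position \<open>r - 1\<close> in the concatenation of the
  selected elements and the remaining ones, and this concatenation enumerates \<open>xs\<close>
  without repetition.\<close>

lemma bij_betw_filter_first:
  assumes "distinct xs" and c: "length (filter P xs) = c"
  shows "bij_betw (\<lambda>r. if r \<le> c then filter P xs ! (r - 1) else filter (\<lambda>x. \<not> P x) xs ! (r - c - 1))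
           {1..length xs} (set xs)"
proof -
  let ?ys = "filter P xs @ filter (\<lambda>x. \<not> P x) xs"
  have len: "length ?ys = length xs"
    using sum_length_filter_compl[of P xs] by simp
  have "distinct ?ys" using assms by auto
  then have "bij_betw ((!) ?ys) {..<length ?ys} (set ?ys)"
    by (intro bij_betw_nth) auto
  moreover have "bij_betw (\<lambda>r. r - 1) {1..length xs} {..<length ?ys}"
    by (rule bij_betwI[where g = Suc]) (use len in auto)
  ultimately have "bij_betw ((!) ?ys \<circ> (\<lambda>r. r - 1)) {1..length xs} (set ?ys)"
    by (rule bij_betw_trans[rotated])
  moreover have "set ?ys = set xs" by auto
  moreover have "bij_betw ((!) ?ys \<circ> (\<lambda>r. r - 1)) {1..length xs} (set ?ys) =
    bij_betw (\<lambda>r. if r \<le> c then filter P xs ! (r - 1) else filter (\<lambda>x. \<not> P x) xs ! (r - c - 1))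
      {1..length xs} (set ?ys)"
  proof (rule bij_betw_cong)
    fix r assume "r \<in> {1..length xs}"
    then have "r \<ge> 1" by simp
    then show "((!) ?ys \<circ> (\<lambda>r. r - 1)) r =
      (if r \<le> c then filter P xs ! (r - 1) else filter (\<lambda>x. \<not> P x) xs ! (r - c - 1))"
      unfolding o_def by (subst nth_append) (auto simp: c diff_commute)
  qed
  ultimately show ?thesis by simp
qed

lemma bij_betw_u_edge: "bij_betw (u_edge a1 a2) {1..a1} (H_edges a1 a2)"
proof -
  let ?w = "floor_path a1 a2"
  have "set (filter (corner ?w) (horizontal_edges ?w)) = {p. corner ?w p}"
    by (auto simp: set_horizontal_edges corner_def)
  moreover have d: "distinct (horizontal_edges ?w)"
    by (simp add: horizontal_edges_def)
  ultimately have c: "length (filter (corner ?w) (horizontal_edges ?w)) = min a1 a2"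
    by (metis distinct_card distinct_filter card_corner_floor_path)
  have "length (horizontal_edges ?w) = a1"
    using dyck_path_floor_path[of a1 a2] length_filter_nth[of ?w East]
    by (simp add: dyck_path_def horizontal_edges_def)
  then show ?thesis
    unfolding H_edges_def maximal_dyck_path_eq u_edge_def[abs_def] Let_def
    using bij_betw_filter_first[OF d c] by simp
qed

lemma bij_betw_v_edge: "bij_betw (v_edge a1 a2) {1..a2} (V_edges a1 a2)"
proof -
  let ?w = "floor_path a1 a2"
  let ?P = "\<lambda>p. p > 0 \<and> corner ?w (p - 1)"
  have "set (filter ?P (vertical_edges ?w)) = Suc ` {p. corner ?w p}"
    by (force simp: set_vertical_edges corner_def image_iff)
  moreover have d: "distinct (vertical_edges ?w)"
    by (simp add: vertical_edges_def)
  moreover have "card (Suc ` {p. corner ?w p}) = min a1 a2"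
    by (simp add: card_image card_corner_floor_path)
  ultimately have c: "length (filter ?P (vertical_edges ?w)) = min a1 a2"
    by (metis distinct_card distinct_filter)
  have "length (vertical_edges ?w) = a2"
    using dyck_path_floor_path[of a1 a2] length_filter_nth[of ?w North]
    by (simp add: dyck_path_def vertical_edges_def)
  then show ?thesis
    unfolding V_edges_def maximal_dyck_path_eq v_edge_def[abs_def] Let_def
    using bij_betw_filter_first[OF d c] by simp
qed

section \<open>Positive rational functions\<close>

text \<open>Being nonzero is included: nonnegative coefficients cannot cancel, so the property
  survives sums as well as products, and quotients of such polynomials are closed under sum, product
  and division.\<close>

definition nonneg_poly :: "((nat \<Rightarrow>\<^sub>0 nat) \<Rightarrow>\<^sub>0 rat) \<Rightarrow> bool" where
  "nonneg_poly p \<longleftrightarrow> p \<noteq> 0 \<and> (\<forall>k. Poly_Mapping.lookup p k \<ge> 0)"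

definition positive_ratfun :: "ratfun \<Rightarrow> bool" where
  "positive_ratfun z \<longleftrightarrow> (\<exists>p q. nonneg_poly p \<and> nonneg_poly q \<and> z = Fract p q)"

lemma positive_ratfunI: "nonneg_poly p \<Longrightarrow> nonneg_poly q \<Longrightarrow> positive_ratfun (Fract p q)"
  by (auto simp only: positive_ratfun_def)

lemma nonneg_poly_add: "nonneg_poly p \<Longrightarrow> nonneg_poly q \<Longrightarrow> nonneg_poly (p + q)"
  unfolding nonneg_poly_def
proof (intro conjI allI)
  assume p: "p \<noteq> 0 \<and> (\<forall>k. Poly_Mapping.lookup p k \<ge> 0)" and q: "q \<noteq> 0 \<and> (\<forall>k. Poly_Mapping.lookup q k \<ge> 0)"
  from p obtain k where "Poly_Mapping.lookup p k \<noteq> 0" by (metis poly_mapping_eqI lookup_zero)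
  with p have "Poly_Mapping.lookup p k > 0" by (simp add: less_le)
  moreover have "Poly_Mapping.lookup q k \<ge> 0" using q by simp
  ultimately have "Poly_Mapping.lookup (p + q) k > 0" by (simp add: lookup_add)
  then show "p + q \<noteq> 0" by auto
  fix k show "Poly_Mapping.lookup (p + q) k \<ge> 0" using p q by (simp add: lookup_add)
qed

lemma Sum_any_nonneg: "(\<And>x. f x \<ge> 0) \<Longrightarrow> Sum_any f \<ge> (0 :: rat)"
  unfolding Sum_any.expand_set by (rule sum_nonneg)

lemma nonneg_poly_mult:
  assumes "nonneg_poly p" "nonneg_poly q"
  shows "nonneg_poly (p * q)"
  unfolding nonneg_poly_def
proof (intro conjI allI)
  show "p * q \<noteq> 0" using assms by (simp add: nonneg_poly_def)
  show "Poly_Mapping.lookup (p * q) k \<ge> 0" for k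
    unfolding lookup_mult
  proof (intro Sum_any_nonneg mult_nonneg_nonneg)
    show "Poly_Mapping.lookup p l \<ge> 0" for l using assms by (simp add: nonneg_poly_def)
    show "(Poly_Mapping.lookup q m when k = l + m) \<ge> 0" for l m
      using assms by (simp add: nonneg_poly_def when_def)
  qed
qed

lemma positive_ratfun_add:
  assumes "positive_ratfun y" "positive_ratfun z"
  shows "positive_ratfun (y + z)"
proof -
  obtain p q p' q' where *: "nonneg_poly p" "nonneg_poly q" "y = Fract p q"
      "nonneg_poly p'" "nonneg_poly q'" "z = Fract p' q'"
    using assms by (auto simp: positive_ratfun_def)
  then have "y + z = Fract (p * q' + p' * q) (q * q')"
    by (simp add: nonneg_poly_def)
  then show ?thesis using * by (simp only: positive_ratfunI nonneg_poly_add nonneg_poly_mult)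
qed

lemma positive_ratfun_mult:
  assumes "positive_ratfun y" "positive_ratfun z"
  shows "positive_ratfun (y * z)"
proof -
  obtain p q p' q' where *: "nonneg_poly p" "nonneg_poly q" "y = Fract p q"
      "nonneg_poly p'" "nonneg_poly q'" "z = Fract p' q'"
    using assms by (auto simp: positive_ratfun_def)
  then have "y * z = Fract (p * p') (q * q')" by simp
  then show ?thesis using * by (simp only: positive_ratfunI nonneg_poly_mult)
qed

lemma positive_ratfun_divide:
  assumes "positive_ratfun y" "positive_ratfun z"
  shows "positive_ratfun (y / z)"
proof -
  obtain p q p' q' where *: "nonneg_poly p" "nonneg_poly q" "y = Fract p q"
      "nonneg_poly p'" "nonneg_poly q'" "z = Fract p' q'"
    using assms by (auto simp: positive_ratfun_def)
  then have "y / z = Fract (p * q') (q * p')" by simp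
  then show ?thesis using * by (simp only: positive_ratfunI nonneg_poly_mult)
qed

lemma positive_ratfun_nonzero:
  assumes "positive_ratfun z"
  shows "z \<noteq> 0"
proof -
  obtain p q where *: "p \<noteq> 0" "q \<noteq> 0" "z = Fract p q"
    using assms unfolding positive_ratfun_def nonneg_poly_def by blast
  then have "Fract p q \<noteq> Fract 0 1"
    by (subst eq_fract) simp_all
  then show ?thesis using * by (simp only: Zero_fract_def not_False_eq_True)
qed

lemma positive_ratfun_1: "positive_ratfun 1"
proof -
  have "nonneg_poly 1"
    by (simp add: nonneg_poly_def lookup_one when_def)
  then show ?thesis unfolding positive_ratfun_def One_fract_def by blast
qed

lemma nonneg_poly_single: "c > 0 \<Longrightarrow> nonneg_poly (Poly_Mapping.single k c)"
  unfolding nonneg_poly_def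
proof (intro conjI allI)
  assume c: "c > 0"
  show "Poly_Mapping.single k c \<noteq> 0"
  proof
    assume "Poly_Mapping.single k c = 0"
    then have "Poly_Mapping.lookup (Poly_Mapping.single k c) k = 0" by (simp only: lookup_zero)
    then show False using c by simp
  qed
  show "Poly_Mapping.lookup (Poly_Mapping.single k c) l \<ge> 0" for l
    using c by (simp add: lookup_single when_def)
qed

lemma positive_ratfun_xvar: "positive_ratfun (xvar i)"
proof -
  have "nonneg_poly (Poly_Mapping.single (Poly_Mapping.single i 1) 1)"
    by (rule nonneg_poly_single) simp
  moreover have "nonneg_poly 1"
    by (simp add: nonneg_poly_def lookup_one when_def)
  ultimately show ?thesis unfolding positive_ratfun_def xvar_def by blast
qed

section \<open>Triangles of a triangulation\<close>

text \<open>Strict counterclockwise order; its invariance under rotation removes the special role of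
  the vertex 0.\<close>

definition cyc :: "nat \<Rightarrow> nat \<Rightarrow> nat \<Rightarrow> bool" where
  "cyc a b c \<longleftrightarrow> a < b \<and> b < c \<or> b < c \<and> c < a \<or> c < a \<and> a < b"

lemma cyc_rotate: "cyc a b c \<Longrightarrow> cyc b c a"
  by (auto simp: cyc_def)

lemma crosses_ordered:
  assumes "a < b" "c < d"
  shows "crosses {a, b} {c, d} \<longleftrightarrow> a < c \<and> c < b \<and> b < d \<or> c < a \<and> a < d \<and> d < b"
proof
  assume "crosses {a, b} {c, d}"
  then show "a < c \<and> c < b \<and> b < d \<or> c < a \<and> a < d \<and> d < b"
    using assms unfolding crosses_def doubleton_eq_iff by auto
next
  assume "a < c \<and> c < b \<and> b < d \<or> c < a \<and> a < d \<and> d < b"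
  then show "crosses {a, b} {c, d}"
    unfolding crosses_def by blast
qed

lemma crosses_sym: "crosses D E \<longleftrightarrow> crosses E D"
  unfolding crosses_def by blast

text \<open>The points \<open>c\<close> and \<open>d\<close> lie on the two different open arcs cut
  out by \<open>a\<close> and \<open>b\<close>. No order of the endpoints is presupposed, so
  crossing conditions become plain inequalities between vertices.\<close>

lemma crosses_iff:
  "crosses {a, b} {c, d} \<longleftrightarrow> cyc a c b \<and> cyc b d a \<or> cyc a d b \<and> cyc b c a"
proof -
  have deg: "\<not> crosses {a} E" for a E
    by (auto simp: crosses_def doubleton_eq_iff)
  have *: "crosses {a, b} {c, d} \<longleftrightarrow> cyc a c b \<and> cyc b d a \<or> cyc a d b \<and> cyc b c a"
    if "a < b" "c < d" for a b c d
    unfolding crosses_ordered[OF that] using that unfolding cyc_def by linarith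
  consider "a = b" | "c = d" | "a < b" "c < d" | "a < b" "d < c" | "b < a" "c < d" | "b < a" "d < c"
    by linarith
  then show ?thesis
  proof cases
    case 1 then show ?thesis using deg by (auto simp: cyc_def)
  next
    case 2 then show ?thesis using deg crosses_sym by (auto simp: cyc_def)
  next
    case 3 then show ?thesis by (rule *)
  next
    case 4 then show ?thesis using *[of a b d c] by (auto simp: insert_commute)
  next
    case 5 then show ?thesis using *[of b a c d] by (auto simp: insert_commute)
  next
    case 6 then show ?thesis using *[of b a d c] by (auto simp: insert_commute)
  qed
qed

section \<open>Noncrossing chords over linearly ordered vertices\<close>

definition noncrossing :: "(nat \<times> nat) set \<Rightarrow> bool" where
  "noncrossing P \<longleftrightarrow> (\<forall>a b c d. (a, b) \<in> P \<longrightarrow> (c, d) \<in> P \<longrightarrow> \<not> (a < c \<and> c < b \<and> b < d))"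

definition chords :: "(nat \<times> nat) set \<Rightarrow> nat \<Rightarrow> nat \<Rightarrow> (nat \<times> nat) set" where
  "chords P l r = {(a, b) \<in> P. l \<le> a \<and> a + 2 \<le> b \<and> b \<le> r}"

text \<open>A polygon with vertices \<open>l..r\<close> has at most \<open>r - l - 2\<close>
  noncrossing diagonals, and \<open>chords\<close> may also contain the closing segment
  \<open>(l, r)\<close>. Equality describes a triangulated polygon together with that
  segment.\<close>

definition full :: "(nat \<times> nat) set \<Rightarrow> nat \<Rightarrow> nat \<Rightarrow> bool" where
  "full P l r \<longleftrightarrow> l < r \<and> card (chords P l r) = r - l - 1"

lemma finite_chords [simp]: "finite (chords P l r)"
  by (rule finite_subset[of _ "{l..r} \<times> {l..r}"]) (auto simp: chords_def)

text \<open>\<open>w\<close> is the farthest vertex below \<open>r\<close> joined to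
  \<open>l\<close>. A chord starting at \<open>l\<close> ends at \<open>r\<close> or not beyond
  \<open>w\<close>, and one starting strictly between \<open>l\<close> and \<open>w\<close> cannot
  pass \<open>w\<close> without crossing \<open>(l, w)\<close>.\<close>

lemma chords_split:
  assumes "noncrossing P" "l + 2 \<le> r"
  obtains w where "l < w" "w < r" "chords P l r \<subseteq> insert (l, r) (chords P l w \<union> chords P w r)"
proof -
  define W where "W = {w. l < w \<and> w < r \<and> (w = l + 1 \<or> (l, w) \<in> P)}"
  have fin: "finite W" by (rule finite_subset[of _ "{..r}"]) (auto simp: W_def)
  have "l + 1 \<in> W" using assms by (simp add: W_def)
  then have w: "Max W \<in> W" using fin Max_in by blast
  have max: "w \<le> Max W" if "w \<in> W" for w using fin that by simp
  have "chords P l r \<subseteq> insert (l, r) (chords P l (Max W) \<union> chords P (Max W) r)"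
  proof
    fix x assume x: "x \<in> chords P l r"
    obtain a b where ab: "x = (a, b)" by (cases x)
    have *: "(a, b) \<in> P" "l \<le> a" "a + 2 \<le> b" "b \<le> r" using x ab by (auto simp: chords_def)
    have "a \<noteq> l \<or> b = r \<or> b \<le> Max W" using max[of b] * by (cases "b = r") (auto simp: W_def)
    moreover have "\<not> (l < a \<and> a < Max W \<and> Max W < b)"
      using w * assms(1) unfolding noncrossing_def W_def by fastforce
    ultimately show "x \<in> insert (l, r) (chords P l (Max W) \<union> chords P (Max W) r)"
      using * unfolding ab chords_def by auto
  qed
  with w show thesis by (intro that[of "Max W"]) (auto simp: W_def)
qed

text \<open>The two parts of \<open>chords_split\<close> and the closing chord add up to
  \<open>(w - l - 1) + (r - w - 1) + 1 = r - l - 1\<close>.\<close>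

lemma card_chords_le: "noncrossing P \<Longrightarrow> l < r \<Longrightarrow> card (chords P l r) \<le> r - l - 1"
proof (induction "r - l" arbitrary: l r rule: less_induct)
  case less
  show ?case
  proof (cases "l + 2 \<le> r")
    case True
    obtain w where w: "l < w" "w < r" "chords P l r \<subseteq> insert (l, r) (chords P l w \<union> chords P w r)"
      using chords_split[OF less.prems(1) True] .
    have "card (chords P l r) \<le> card (insert (l, r) (chords P l w \<union> chords P w r))"
      by (rule card_mono) (use w in auto)
    also have "\<dots> \<le> Suc (card (chords P l w \<union> chords P w r))" by (rule card_insert_le_m1) auto
    also have "card (chords P l w \<union> chords P w r) \<le> card (chords P l w) + card (chords P w r)"
      by (rule card_Un_le)
    finally show ?thesis
      using less.hyps[of w l] less.hyps[of r w] less.prems w by fastforce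
  next
    case False
    then have "chords P l r = {}" by (auto simp: chords_def)
    then show ?thesis by simp
  qed
qed

text \<open>Equality in the bound of \<open>card_chords_le\<close> forces equality in each summand:
  the closing chord is present and both parts are full, so \<open>w\<close> is the apex of a
  triangle over \<open>(l, r)\<close>.\<close>

lemma full_split:
  assumes "noncrossing P" "full P l r" "l + 2 \<le> r"
  obtains w where "l < w" "w < r" "(l, r) \<in> P" "full P l w" "full P w r"
    "chords P l r \<subseteq> insert (l, r) (chords P l w \<union> chords P w r)"
proof -
  obtain w where w: "l < w" "w < r" "chords P l r \<subseteq> insert (l, r) (chords P l w \<union> chords P w r)"
    using chords_split[OF assms(1,3)] .
  have c: "card (chords P l r) = r - l - 1" using assms(2) by (simp add: full_def)
  have le: "card (chords P l w) \<le> w - l - 1" "card (chords P w r) \<le> r - w - 1"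
    using card_chords_le[OF assms(1)] w by auto
  have un: "card (chords P l w \<union> chords P w r) \<le> card (chords P l w) + card (chords P w r)"
    by (rule card_Un_le)
  have in_P: "(l, r) \<in> P"
  proof (rule ccontr)
    assume "(l, r) \<notin> P"
    then have "chords P l r \<subseteq> chords P l w \<union> chords P w r" using w(3) by (auto simp: chords_def)
    then have "card (chords P l r) \<le> card (chords P l w \<union> chords P w r)"
      by (intro card_mono) auto
    then show False using c le un w(1,2) by linarith
  qed
  have "card (chords P l r) \<le> card (insert (l, r) (chords P l w \<union> chords P w r))"
    by (rule card_mono) (use w in auto)
  also have "\<dots> \<le> Suc (card (chords P l w \<union> chords P w r))"
    by (metis card_insert_le_m1 card_insert_if finite_Un finite_chords le_SucI le_refl)
  finally have "full P l w" "full P w r" using c le un w(1,2) by (auto simp: full_def)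
  with w in_P show thesis by (intro that)
qed

definition pair_edge :: "(nat \<times> nat) set \<Rightarrow> nat \<Rightarrow> nat \<Rightarrow> bool" where
  "pair_edge P a b \<longleftrightarrow> b = a + 1 \<or> a < b \<and> (a, b) \<in> P"

lemma full_pair_edge: "noncrossing P \<Longrightarrow> full P l r \<Longrightarrow> pair_edge P l r"
proof (cases "l + 2 \<le> r")
  case True
  assume "noncrossing P" "full P l r"
  then have "(l, r) \<in> P" using True by (rule full_split)
  then show ?thesis using True by (simp add: pair_edge_def)
qed (auto simp: full_def pair_edge_def)

lemma pair_edge_cases:
  assumes "chords P l r \<subseteq> insert (l, r) (chords P l w \<union> chords P w r)"
    and "pair_edge P a b" "l \<le> a" "b \<le> r" "(a, b) \<noteq> (l, r)" "l < w" "w < r"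
  shows "b \<le> w \<or> w \<le> a"
proof (cases "b = a + 1")
  case False
  then have "(a, b) \<in> chords P l r" using assms by (auto simp: pair_edge_def chords_def)
  then have "(a, b) \<in> insert (l, r) (chords P l w \<union> chords P w r)" using assms(1) by blast
  then show ?thesis using assms by (auto simp: chords_def)
qed auto

lemma full_sub:
  assumes "noncrossing P"
  shows "full P l r \<Longrightarrow> pair_edge P a b \<Longrightarrow> l \<le> a \<Longrightarrow> b \<le> r \<Longrightarrow> full P a b"
proof (induction "r - l" arbitrary: l r rule: less_induct)
  case less
  show ?case
  proof (cases "(a, b) = (l, r) \<or> b = a + 1")
    case True
    moreover have "chords P a (a + 1) = {}" by (auto simp: chords_def)
    ultimately show ?thesis using less.prems by (auto simp: full_def)
  next
    case False
    then have "l + 2 \<le> r" using less.prems by (auto simp: pair_edge_def)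
    then obtain w where w: "l < w" "w < r" "(l, r) \<in> P" "full P l w" "full P w r"
        "chords P l r \<subseteq> insert (l, r) (chords P l w \<union> chords P w r)"
      using full_split[OF assms less.prems(1)] by metis
    have "b \<le> w \<or> w \<le> a"
      using pair_edge_cases[OF w(6) less.prems(2-4)] False w by auto
    then show ?thesis
      using less.hyps[of w l] less.hyps[of r w] less.prems w by auto
  qed
qed

lemma full_inner_apex:
  assumes "noncrossing P" "full P L R" "pair_edge P a b" "L \<le> a" "b \<le> R" "a + 2 \<le> b"
  obtains w where "a < w" "w < b" "pair_edge P a w" "pair_edge P w b"
proof -
  have "full P a b" by (rule full_sub[OF assms(1-5)])
  then obtain w where "a < w" "w < b" "full P a w" "full P w b"
    using full_split[OF assms(1) _ assms(6)] by metis
  then show thesis using that full_pair_edge[OF assms(1)] by blast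
qed

text \<open>If \<open>(a, b)\<close> is a side of the triangle \<open>L, w, R\<close>, the third
  vertex is the required apex. Otherwise it lies in one of the two parts without being its closing
  edge, and the induction applies there.\<close>

lemma full_outer_apex:
  assumes "noncrossing P"
  shows "full P L R \<Longrightarrow> pair_edge P a b \<Longrightarrow> L \<le> a \<Longrightarrow> b \<le> R \<Longrightarrow> (a, b) \<noteq> (L, R) \<Longrightarrow>
    \<exists>z. L \<le> z \<and> z < a \<and> pair_edge P z a \<and> pair_edge P z b \<or>
        b < z \<and> z \<le> R \<and> pair_edge P a z \<and> pair_edge P b z"
proof (induction "R - L" arbitrary: L R rule: less_induct)
  case less
  have "L + 2 \<le> R" using less.prems by (auto simp: pair_edge_def full_def)
  then obtain w where w: "L < w" "w < R" "(L, R) \<in> P" "full P L w" "full P w R"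
      "chords P L R \<subseteq> insert (L, R) (chords P L w \<union> chords P w R)"
    using full_split[OF assms less.prems(1)] by metis
  have e: "pair_edge P L w" "pair_edge P w R" "pair_edge P L R"
    using full_pair_edge[OF assms] w less.prems by auto
  have "b \<le> w \<or> w \<le> a"
    by (rule pair_edge_cases[OF w(6) less.prems(2-5) w(1,2)])
  then consider "(a, b) = (L, w)" | "(a, b) = (w, R)" | "b \<le> w" "(a, b) \<noteq> (L, w)"
    | "w \<le> a" "(a, b) \<noteq> (w, R)" by blast
  then show ?case
  proof cases
    case 1 then show ?thesis using e w by auto
  next
    case 2 then show ?thesis using e w by auto
  next
    case 3
    then have "\<exists>z. L \<le> z \<and> z < a \<and> pair_edge P z a \<and> pair_edge P z b \<or>
        b < z \<and> z \<le> w \<and> pair_edge P a z \<and> pair_edge P b z"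
      using w less.prems by (intro less.hyps) auto
    then show ?thesis using w by (meson le_trans less_imp_le)
  next
    case 4
    then have "\<exists>z. w \<le> z \<and> z < a \<and> pair_edge P z a \<and> pair_edge P z b \<or>
        b < z \<and> z \<le> R \<and> pair_edge P a z \<and> pair_edge P b z"
      using w less.prems by (intro less.hyps) auto
    then show ?thesis using w by (meson le_trans less_imp_le)
  qed
qed

section \<open>From triangulations to chord sets\<close>

definition edges :: "nat \<Rightarrow> (nat \<Rightarrow> nat set) \<Rightarrow> nat set set" where
  "edges N T = T ` {1..N} \<union> Collect (polygon_side N)"

lemma Suc_mod_polygon: "p < N + 3 \<Longrightarrow> Suc p mod (N + 3) = (if p = N + 2 then 0 else Suc p)"
  by (simp add: mod_Suc)

lemma polygon_side_iff:
  "polygon_side N {a, b} \<longleftrightarrow> a < N + 3 \<and> b < N + 3 \<and>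
     (b = a + 1 \<or> a = b + 1 \<or> a = 0 \<and> b = N + 2 \<or> b = 0 \<and> a = N + 2)"
proof
  assume "polygon_side N {a, b}"
  then obtain p where p: "p < N + 3" "{a, b} = {p, (p + 1) mod (N + 3)}"
    by (auto simp: polygon_side_def)
  then show "a < N + 3 \<and> b < N + 3 \<and>
     (b = a + 1 \<or> a = b + 1 \<or> a = 0 \<and> b = N + 2 \<or> b = 0 \<and> a = N + 2)"
    using p by (auto simp: Suc_mod_polygon doubleton_eq_iff split: if_splits)
next
  assume *: "a < N + 3 \<and> b < N + 3 \<and>
     (b = a + 1 \<or> a = b + 1 \<or> a = 0 \<and> b = N + 2 \<or> b = 0 \<and> a = N + 2)"
  have "polygon_side N {p, p + 1}" if "p + 1 < N + 3" for p
    unfolding polygon_side_def using that by (intro exI[of _ p]) auto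
  moreover have "polygon_side N {N + 2, 0}"
    unfolding polygon_side_def by (intro exI[of _ "N + 2"]) (simp add: Suc_mod_polygon)
  ultimately show "polygon_side N {a, b}" using * by (auto simp: insert_commute)
qed

lemma diagonalE:
  assumes "diagonal N D"
  obtains a b where "D = {a, b}" "a + 2 \<le> b" "b < N + 3" "(a, b) \<noteq> (0, N + 2)"
proof -
  obtain x y where xy: "D = {x, y}" "x \<noteq> y"
    using assms by (auto simp: diagonal_def card_2_iff)
  have "D = {min x y, max x y}" "min x y < max x y"
    using xy by (auto simp: min_def max_def)
  moreover from this have "min x y + 2 \<le> max x y" "max x y < N + 3" "(min x y, max x y) \<noteq> (0, N + 2)"
    using assms polygon_side_iff[of N "min x y" "max x y"] unfolding diagonal_def by auto
  ultimately show thesis using that by blast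
qed

text \<open>The segment from 0 to \<open>N + 2\<close> is the only polygon side that does not join
  consecutive numbers; it is added as the closing chord.\<close>

definition pairs :: "nat \<Rightarrow> (nat \<Rightarrow> nat set) \<Rightarrow> (nat \<times> nat) set" where
  "pairs N T = insert (0, N + 2) {(a, b). a < b \<and> {a, b} \<in> T ` {1..N}}"

lemma triangulation_pair:
  assumes "triangulation N T" "a < b" "{a, b} \<in> T ` {1..N}"
  shows "a + 2 \<le> b" "b < N + 3" "(a, b) \<noteq> (0, N + 2)"
proof -
  obtain i where i: "i \<in> {1..N}" "{a, b} = T i" using assms by blast
  then have "diagonal N {a, b}" using assms by (simp add: triangulation_def)
  then obtain c d where cd: "{a, b} = {c, d}" "c + 2 \<le> d" "d < N + 3" "(c, d) \<noteq> (0, N + 2)"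
    by (rule diagonalE)
  then have "a = c \<and> b = d" using assms by (auto simp: doubleton_eq_iff)
  with cd show "a + 2 \<le> b" "b < N + 3" "(a, b) \<noteq> (0, N + 2)" by auto
qed

lemma noncrossing_pairs:
  assumes "triangulation N T"
  shows "noncrossing (pairs N T)"
  unfolding noncrossing_def
proof (intro allI impI notI)
  fix a b c d
  assume ab: "(a, b) \<in> pairs N T" and cd: "(c, d) \<in> pairs N T" and *: "a < c \<and> c < b \<and> b < d"
  have le: "d \<le> N + 2" using cd triangulation_pair[OF assms, of c d] by (auto simp: pairs_def)
  then have "{a, b} \<in> T ` {1..N}" "{c, d} \<in> T ` {1..N}"
    using ab cd * by (auto simp: pairs_def)
  then have "\<not> crosses {a, b} {c, d}" using assms unfolding triangulation_def by auto
  then show False using crosses_ordered[of a b c d] * by auto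
qed

text \<open>The \<open>N\<close> diagonals and the closing chord are \<open>N + 1\<close> chords,
  the greatest number possible on the vertices \<open>0..N + 2\<close>.\<close>

lemma full_pairs:
  assumes "triangulation N T"
  shows "full (pairs N T) 0 (N + 2)"
proof -
  have "a + 2 \<le> b \<and> b \<le> N + 2" if "(a, b) \<in> pairs N T" for a b
    using that triangulation_pair[OF assms, of a b] by (auto simp: pairs_def)
  then have "chords (pairs N T) 0 (N + 2) = insert (0, N + 2) {(a, b). a < b \<and> {a, b} \<in> T ` {1..N}}"
    by (fastforce simp: chords_def pairs_def)
  moreover have "(0, N + 2) \<notin> {(a, b). a < b \<and> {a, b} \<in> T ` {1..N}}"
    using triangulation_pair(3)[OF assms, of 0 "N + 2"] by auto
  moreover have "card {(a, b). a < b \<and> {a, b} \<in> T ` {1..N}} = N"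
  proof -
    have "bij_betw (\<lambda>(a, b). {a, b}) {(a, b). a < b \<and> {a, b} \<in> T ` {1..N}} (T ` {1..N})"
    proof (rule bij_betw_imageI)
      show "inj_on (\<lambda>(a, b). {a, b}) {(a :: nat, b). a < b \<and> {a, b} \<in> T ` {1..N}}"
        by (auto simp: inj_on_def doubleton_eq_iff)
      have "D \<in> (\<lambda>(a, b). {a, b}) ` {(a, b). a < b \<and> {a, b} \<in> T ` {1..N}}" if D: "D \<in> T ` {1..N}" for D
      proof -
        have "diagonal N D" using D assms by (auto simp: triangulation_def)
        then obtain a b where "D = {a, b}" "a + 2 \<le> b" by (rule diagonalE)
        then show ?thesis using D by (intro image_eqI[of _ _ "(a, b)"]) auto
      qed
      then show "(\<lambda>(a, b). {a, b}) ` {(a, b). a < b \<and> {a, b} \<in> T ` {1..N}} = T ` {1..N}"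
        by auto
    qed
    then have "card {(a, b). a < b \<and> {a, b} \<in> T ` {1..N}} = card (T ` {1..N})"
      by (rule bij_betw_same_card)
    also have "\<dots> = N" using assms by (simp add: triangulation_def card_image)
    finally show ?thesis .
  qed
  moreover have "finite {(a, b). a < b \<and> {a, b} \<in> T ` {1..N}}"
  proof (rule finite_subset)
    show "{(a, b). a < b \<and> {a, b} \<in> T ` {1..N}} \<subseteq> {..N + 2} \<times> {..N + 2}"
    proof (rule subrelI)
      fix a b assume "(a, b) \<in> {(a, b). a < b \<and> {a, b} \<in> T ` {1..N}}"
      then show "(a, b) \<in> {..N + 2} \<times> {..N + 2}"
        using triangulation_pair(2)[OF assms, of a b] by auto
    qed
  qed simp
  ultimately show ?thesis by (simp add: full_def)
qed

lemma pair_edge_iff: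
  assumes "triangulation N T" "a < b" "b < N + 3"
  shows "pair_edge (pairs N T) a b \<longleftrightarrow> {a, b} \<in> edges N T"
  using assms triangulation_pair[OF assms(1,2)]
  unfolding pair_edge_def pairs_def edges_def Un_iff mem_Collect_eq polygon_side_iff by auto

lemma edges_bound:
  assumes "triangulation N T" "{a, b} \<in> edges N T"
  shows "a < N + 3" "b < N + 3" "a \<noteq> b"
proof -
  have "diagonal N {a, b} \<or> polygon_side N {a, b}"
    using assms unfolding edges_def triangulation_def by force
  then have "{a, b} \<subseteq> {..<N + 3} \<and> card {a, b} = 2 \<or> polygon_side N {a, b}"
    unfolding diagonal_def by blast
  then show "a < N + 3" "b < N + 3" "a \<noteq> b" by (auto simp: polygon_side_iff)
qed

lemma edges_not_crosses:
  assumes T: "triangulation N T" and "D \<in> edges N T" "E \<in> edges N T"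
  shows "\<not> crosses D E"
proof -
  have side: "\<not> crosses {a, b} {c, d}" if "polygon_side N {a, b}" "{c, d} \<in> edges N T" for a b c d
    using that edges_bound[OF T that(2)]
    by (auto simp: polygon_side_iff crosses_iff cyc_def)
  have ex: "\<exists>a b. D = {a, b}" if "D \<in> edges N T" for D
  proof -
    have "diagonal N D \<or> polygon_side N D"
      using that T by (auto simp: edges_def triangulation_def)
    then show ?thesis by (metis diagonalE polygon_side_def)
  qed
  consider "D \<in> T ` {1..N}" "E \<in> T ` {1..N}" | "polygon_side N D" | "polygon_side N E"
    using assms unfolding edges_def by blast
  then show ?thesis
  proof cases
    case 1
    then show ?thesis using T by (auto simp: triangulation_def)
  next
    case 2
    then show ?thesis using side ex[of D] ex[of E] assms by metis
  next
    case 3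
    then show ?thesis using side ex[of D] ex[of E] assms crosses_sym by metis
  qed
qed

text \<open>In the linear order, the arc from \<open>a\<close> to \<open>b\<close> is the inside of
  the chord if \<open>a < b\<close> and its outside otherwise; these are the inner and the outer
  apex. The vertex \<open>v\<close> witnesses that the arc is not empty.\<close>

lemma triangle_apex:
  assumes T: "triangulation N T" and e: "{a, b} \<in> edges N T" and v: "cyc a v b" "v < N + 3"
  obtains w where "w < N + 3" "cyc a w b" "{a, w} \<in> edges N T" "{w, b} \<in> edges N T"
proof -
  note nc = noncrossing_pairs[OF T] and fl = full_pairs[OF T] and pe = pair_edge_iff[OF T]
  have ab: "a < N + 3" "b < N + 3" "a \<noteq> b" using edges_bound[OF T e] by auto
  have "\<exists>w<N + 3. cyc a w b \<and> {a, w} \<in> edges N T \<and> {w, b} \<in> edges N T"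
  proof (cases "a < b")
    case True
    then have "pair_edge (pairs N T) a b" "a + 2 \<le> b"
      using pe e ab v by (auto simp: cyc_def)
    then obtain w where "a < w" "w < b" "pair_edge (pairs N T) a w" "pair_edge (pairs N T) w b"
      using full_inner_apex[OF nc fl, of a b] ab by auto
    then show ?thesis using pe ab by (intro exI[of _ w]) (auto simp: cyc_def)
  next
    case False
    then have "pair_edge (pairs N T) b a" "b < a" "(b, a) \<noteq> (0, N + 2)"
      using pe[of b a] e ab v by (auto simp: cyc_def insert_commute)
    then obtain z where "z < b \<and> pair_edge (pairs N T) z b \<and> pair_edge (pairs N T) z a \<or>
        a < z \<and> z \<le> N + 2 \<and> pair_edge (pairs N T) b z \<and> pair_edge (pairs N T) a z"
      using full_outer_apex[OF nc fl, of b a] ab by auto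
    then show ?thesis using pe ab \<open>b < a\<close>
      by (intro exI[of _ z]) (auto simp: cyc_def insert_commute)
  qed
  then show thesis using that by blast
qed

section \<open>A Ptolemy function\<close>

definition ptolemy_function :: "nat \<Rightarrow> (nat \<Rightarrow> nat set) \<Rightarrow> (nat \<Rightarrow> nat \<Rightarrow> ratfun) \<Rightarrow> bool" where
  "ptolemy_function N T f \<longleftrightarrow>
     (\<forall>a b. f a b = f b a) \<and>
     (\<forall>a b c d. cyc a b c \<longrightarrow> cyc a c d \<longrightarrow> f a c * f b d = f a b * f c d + f b c * f a d) \<and>
     (\<forall>a b. polygon_side N {a, b} \<longrightarrow> f a b = 1) \<and>
     (\<forall>i\<in>{1..N}. \<forall>a b. T i = {a, b} \<longrightarrow> f a b = xvar i)"

definition det2 :: "'a :: comm_ring \<times> 'a \<Rightarrow> 'a \<times> 'a \<Rightarrow> 'a" where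
  "det2 v w = fst v * snd w - snd v * fst w"

text \<open>Once the vectors at the ends of the closing edge are chosen, the vector at the apex is
  the solution of two linear equations, one per new side. Every further triangle adds one vertex and
  two sides, so no condition is imposed twice.\<close>

lemma exists_vectors:
  fixes g :: "nat \<Rightarrow> nat \<Rightarrow> 'a :: field"
  assumes "noncrossing P" and g: "\<And>a b. g a b \<noteq> 0"
  shows "full P l r \<Longrightarrow> det2 vl vr = g l r \<Longrightarrow>
    \<exists>v. v l = vl \<and> v r = vr \<and>
      (\<forall>a b. l \<le> a \<longrightarrow> b \<le> r \<longrightarrow> pair_edge P a b \<longrightarrow> det2 (v a) (v b) = g a b)"
proof (induction "r - l" arbitrary: l r vl vr rule: less_induct)
  case less
  show ?case
  proof (cases "l + 2 \<le> r")
    case True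
    obtain w where w: "l < w" "w < r" "full P l w" "full P w r"
        "chords P l r \<subseteq> insert (l, r) (chords P l w \<union> chords P w r)"
      using full_split[OF assms(1) less.prems(1) True] .
    define \<alpha> \<beta> where "\<alpha> = g w r / g l r" and "\<beta> = g l w / g l r"
    define vw where "vw = (\<alpha> * fst vl + \<beta> * fst vr, \<alpha> * snd vl + \<beta> * snd vr)"
    have "det2 vl vw = \<beta> * det2 vl vr" "det2 vw vr = \<alpha> * det2 vl vr"
      by (simp_all add: det2_def vw_def algebra_simps)
    then have d: "det2 vl vw = g l w" "det2 vw vr = g w r"
      using less.prems(2) g by (simp_all add: \<alpha>_def \<beta>_def)
    obtain u where u: "u l = vl" "u w = vw"
        "\<And>a b. l \<le> a \<Longrightarrow> b \<le> w \<Longrightarrow> pair_edge P a b \<Longrightarrow> det2 (u a) (u b) = g a b"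
      using less.hyps[OF _ w(3) d(1)] w(1,2) by (auto simp: diff_less_mono)
    obtain u' where u': "u' w = vw" "u' r = vr"
        "\<And>a b. w \<le> a \<Longrightarrow> b \<le> r \<Longrightarrow> pair_edge P a b \<Longrightarrow> det2 (u' a) (u' b) = g a b"
      using less.hyps[OF _ w(4) d(2)] w(1,2) by (auto simp: diff_less_mono2)
    define v where "v = (\<lambda>a. if a \<le> w then u a else u' a)"
    have v_le: "v a = u a" if "a \<le> w" for a using that by (simp add: v_def)
    have v_ge: "v a = u' a" if "w \<le> a" for a using that u u' by (auto simp: v_def)
    have "det2 (v a) (v b) = g a b" if ab: "l \<le> a" "b \<le> r" "pair_edge P a b" for a b
    proof (cases "(a, b) = (l, r)")
      case True
      then show ?thesis using v_le[of l] v_ge[of r] w u u' less.prems by simp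
    next
      case False
      have "a < b" using ab by (auto simp: pair_edge_def)
      moreover have "b \<le> w \<or> w \<le> a"
        using pair_edge_cases[OF w(5) ab(3,1,2) False w(1,2)] .
      ultimately show ?thesis using v_le[of a] v_le[of b] v_ge[of a] v_ge[of b] u u' ab by auto
    qed
    moreover have "v l = vl" "v r = vr" using v_le[of l] v_ge[of r] w u u' by auto
    ultimately show ?thesis by blast
  next
    case False
    then have r: "r = l + 1" using less.prems by (simp add: full_def)
    define v where "v = (\<lambda>a. if a = l then vl else vr)"
    have "det2 (v a) (v b) = g a b" if "l \<le> a" "b \<le> r" "pair_edge P a b" for a b
    proof -
      have "a = l" "b = r" using that r by (auto simp: pair_edge_def)
      then show ?thesis using less.prems r by (simp add: v_def)
    qed
    moreover have "v l = vl" "v r = vr" using r by (simp_all add: v_def)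
    ultimately show ?thesis by blast
  qed
qed

lemma exists_ptolemy_function:
  assumes T: "triangulation N T"
  obtains f where "ptolemy_function N T f"
proof -
  \<comment> \<open>Segments that are neither sides nor some \<open>T i\<close> also receive the
    value 1; there it only matters that it is nonzero.\<close>
  define g where "g = (\<lambda>a b. if {a, b} \<in> T ` {1..N} then xvar (the_inv_into {1..N} T {a, b}) else 1)"
  have gT: "g a b = xvar i" if "i \<in> {1..N}" "T i = {a, b}" for i a b
    using that T the_inv_into_f_f[of T "{1..N}" i] by (auto simp: g_def triangulation_def)
  have g0: "g a b \<noteq> 0" for a b
    using positive_ratfun_nonzero[OF positive_ratfun_xvar] by (auto simp: g_def)
  have gside: "g a b = 1" if "polygon_side N {a, b}" for a b
    using that T by (auto simp: g_def triangulation_def diagonal_def)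
  have g_sym: "g a b = g b a" for a b by (simp add: g_def insert_commute)
  obtain v :: "nat \<Rightarrow> ratfun \<times> ratfun" where
    v: "\<And>a b. b \<le> N + 2 \<Longrightarrow> pair_edge (pairs N T) a b \<Longrightarrow> det2 (v a) (v b) = g a b"
    using exists_vectors[of "pairs N T" g 0 "N + 2" "(1, 0)" "(0, g 0 (N + 2))"]
      noncrossing_pairs[OF T] g0 full_pairs[OF T] by (auto simp: det2_def)
  \<comment> \<open>A determinant changes sign when its vectors are exchanged; sorting the two
    indices makes \<open>f\<close> symmetric.\<close>
  define f where "f = (\<lambda>a b. if a < b then det2 (v a) (v b) else if b < a then det2 (v b) (v a) else 0)"
  have f_sym: "f a b = f b a" for a b by (auto simp: f_def)
  have f_edge: "f a b = g a b" if e: "{a, b} \<in> edges N T" for a b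
  proof -
    have b: "a < N + 3" "b < N + 3" "a \<noteq> b" using edges_bound[OF T e] by auto
    have *: "f a b = g a b" if "a < b" "{a, b} \<in> edges N T" "b < N + 3" for a b
      using that pair_edge_iff[OF T, of a b] v[of b a] by (simp add: f_def)
    show ?thesis
    proof (cases "a < b")
      case True then show ?thesis using * e b by blast
    next
      case False
      then have "f b a = g b a" using *[of b a] e b by (simp add: insert_commute)
      then show ?thesis using f_sym g_sym by metis
    qed
  qed
  have "f a c * f b d = f a b * f c d + f b c * f a d" if abcd: "cyc a b c" "cyc a c d" for a b c d
  proof -
    \<comment> \<open>The Pluecker relation of four plane vectors. The remaining cyclic positions
      follow by rotating the four points and using symmetry.\<close>
    have ord: "f a c * f b d = f a b * f c d + f b c * f a d"
      if "a < b" "b < c" "c < d" for a b c d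
      using that by (simp add: f_def det2_def algebra_simps)
    consider "a < b" "b < c" "c < d" | "b < c" "c < d" "d < a" | "c < d" "d < a" "a < b"
      | "d < a" "a < b" "b < c"
      using abcd unfolding cyc_def by linarith
    then show ?thesis
    proof cases
      case 1 then show ?thesis by (rule ord)
    next
      case 2 then show ?thesis using ord[of b c d a] f_sym by (simp add: algebra_simps)
    next
      case 3 then show ?thesis using ord[of c d a b] f_sym by (simp add: algebra_simps)
    next
      case 4 then show ?thesis using ord[of d a b c] f_sym by (simp add: algebra_simps)
    qed
  qed
  moreover have "f a b = 1" if "polygon_side N {a, b}" for a b
    using f_edge[of a b] gside[OF that] that by (simp add: edges_def)
  moreover have "f a b = xvar i" if "i \<in> {1..N}" "T i = {a, b}" for i a b
  proof -
    have "{a, b} \<in> edges N T" unfolding edges_def using that by blast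
    then show ?thesis using f_edge gT[OF that] by simp
  qed
  ultimately have "ptolemy_function N T f"
    unfolding ptolemy_function_def using f_sym by blast
  then show thesis by (rule that)
qed

lemma ptolemy_sym: "ptolemy_function N T f \<Longrightarrow> f a b = f b a"
  unfolding ptolemy_function_def by blast

lemma ptolemy_relation:
  "ptolemy_function N T f \<Longrightarrow> cyc a b c \<Longrightarrow> cyc a c d \<Longrightarrow> f a c * f b d = f a b * f c d + f b c * f a d"
  unfolding ptolemy_function_def by blast

lemma ptolemy_side: "ptolemy_function N T f \<Longrightarrow> polygon_side N {a, b} \<Longrightarrow> f a b = 1"
  unfolding ptolemy_function_def by blast

lemma ptolemy_initial: "ptolemy_function N T f \<Longrightarrow> i \<in> {1..N} \<Longrightarrow> T i = {a, b} \<Longrightarrow> f a b = xvar i"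
  unfolding ptolemy_function_def by blast

section \<open>Positivity of the Ptolemy values\<close>

lemma ptolemy_edge_positive:
  assumes f: "ptolemy_function N T f" and e: "{a, b} \<in> edges N T"
  shows "positive_ratfun (f a b)"
proof -
  have "polygon_side N {a, b} \<or> (\<exists>i\<in>{1..N}. T i = {a, b})" using e by (force simp: edges_def)
  then show ?thesis
    using ptolemy_side[OF f] ptolemy_initial[OF f] positive_ratfun_1 positive_ratfun_xvar by metis
qed

lemma cyc_interval_less:
  assumes "cyc a w b" "w < (n :: nat)"
  shows "card {v. v < n \<and> cyc a v w} < card {v. v < n \<and> cyc a v b}"
    "card {v. v < n \<and> cyc w v b} < card {v. v < n \<and> cyc a v b}"
proof -
  have fin: "finite {v. v < n \<and> cyc a v b}" by (rule finite_subset[of _ "{..<n}"]) auto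
  have w: "w \<in> {v. v < n \<and> cyc a v b}" "w \<notin> {v. v < n \<and> cyc a v w}" "w \<notin> {v. v < n \<and> cyc w v b}"
    using assms by (auto simp: cyc_def)
  have "{v. v < n \<and> cyc a v w} \<subseteq> {v. v < n \<and> cyc a v b}" "{v. v < n \<and> cyc w v b} \<subseteq> {v. v < n \<and> cyc a v b}"
    using assms by (auto simp: cyc_def)
  with w fin show "card {v. v < n \<and> cyc a v w} < card {v. v < n \<and> cyc a v b}"
    "card {v. v < n \<and> cyc w v b} < card {v. v < n \<and> cyc a v b}"
    by (metis psubsetI psubset_card_mono)+
qed

text \<open>Let \<open>w\<close> be the apex over \<open>{a, b}\<close>. If \<open>q\<close> lies
  beyond \<open>{a, w}\<close> or \<open>{w, b}\<close>, induction gives two values of the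
  quadrilateral formed with \<open>q\<close>, and the Ptolemy relation yields the remaining one by
  sums, products and one quotient.\<close>

lemma ptolemy_positive_from_edge:
  assumes T: "triangulation N T" and f: "ptolemy_function N T f" and q: "q < N + 3"
  shows "{a, b} \<in> edges N T \<Longrightarrow> cyc a q b \<Longrightarrow> positive_ratfun (f a q) \<and> positive_ratfun (f q b)"
proof (induction "card {v. v < N + 3 \<and> cyc a v b}" arbitrary: a b rule: less_induct)
  case less
  obtain w where w: "w < N + 3" "cyc a w b" "{a, w} \<in> edges N T" "{w, b} \<in> edges N T"
    using triangle_apex[OF T less.prems q] .
  note pos = ptolemy_edge_positive[OF f]
  note pos_intros = positive_ratfun_divide positive_ratfun_add positive_ratfun_mult
  note sym = ptolemy_sym[OF f]
  consider "q = w" | "cyc a q w" | "cyc w q b"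
    using w less.prems unfolding cyc_def by linarith
  then show ?case
  proof cases
    case 1
    then show ?thesis using w pos by auto
  next
    case 2
    have IH: "positive_ratfun (f a q)" "positive_ratfun (f q w)"
      using less.hyps[OF cyc_interval_less(1)[OF w(2,1)] w(3) 2] by auto
    have "f a w * f q b = f a q * f w b + f q w * f a b"
      by (rule ptolemy_relation[OF f 2 w(2)])
    then have "f q b = (f a q * f w b + f q w * f a b) / f a w"
      using positive_ratfun_nonzero[OF pos[OF w(3)]] by (simp add: field_simps)
    then show ?thesis using IH pos_intros pos w less.prems by metis
  next
    case 3
    have IH: "positive_ratfun (f w q)" "positive_ratfun (f q b)"
      using less.hyps[OF cyc_interval_less(2)[OF w(2,1)] w(4) 3] by auto
    have "cyc a w q" "cyc a q b" using 3 less.prems w by (auto simp: cyc_def)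
    then have "f a q * f w b = f a w * f q b + f w q * f a b"
      by (rule ptolemy_relation[OF f])
    then have "f a q = (f a w * f q b + f w q * f a b) / f w b"
      using positive_ratfun_nonzero[OF pos[OF w(4)]] by (simp add: field_simps)
    then show ?thesis using IH pos_intros pos w less.prems by metis
  qed
qed

lemma ptolemy_positive:
  assumes T: "triangulation N T" and f: "ptolemy_function N T f"
    and pq: "p < N + 3" "q < N + 3" "p \<noteq> q"
  shows "positive_ratfun (f p q)"
proof -
  \<comment> \<open>With \<open>r\<close> the vertex following \<open>p\<close>, every vertex other
    than these two lies on the arc from \<open>r\<close> to \<open>p\<close>, so a single edge
    serves all \<open>q\<close>.\<close>
  define r where "r = (if p = N + 2 then 0 else p + 1)"
  have side: "polygon_side N {r, p}" using pq by (auto simp: r_def polygon_side_iff)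
  then have e: "{r, p} \<in> edges N T" by (simp add: edges_def)
  show ?thesis
  proof (cases "q = r")
    case True
    then show ?thesis using e ptolemy_edge_positive[OF f, of r p] ptolemy_sym[OF f, of p r] by simp
  next
    case False
    then have "cyc r q p" using pq by (auto simp: cyc_def r_def)
    then show ?thesis
      using ptolemy_positive_from_edge[OF T f pq(2) e] ptolemy_sym[OF f, of p q] by simp
  qed
qed

lemma ptolemy_nonzero:
  assumes "triangulation N T" "ptolemy_function N T f" "p < N + 3" "q < N + 3" "p \<noteq> q"
  shows "f p q \<noteq> 0"
  by (rule positive_ratfun_nonzero[OF ptolemy_positive[OF assms]])

section \<open>Flips and mutations\<close>

text \<open>Over the reals, case distinctions about positions of vertices are Boolean combinations
  of linear inequalities, which \<open>argo\<close> decides.\<close>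

lemma cyc_real:
  "cyc a b c \<longleftrightarrow> real a < real b \<and> real b < real c \<or> real b < real c \<and> real c < real a \<or>
     real c < real a \<and> real a < real b"
  by (simp add: cyc_def)

lemma eq_real: "(a :: nat) = b \<longleftrightarrow> real a = real b"
  by simp

lemmas cyc_arith = crosses_iff cyc_real eq_real

text \<open>The set \<open>E\<close> of admissible third sides is a parameter: a flip removes one
  third side and adds another, and the arrows can be compared accordingly.\<close>

definition arr :: "nat set set \<Rightarrow> nat set \<Rightarrow> nat set \<Rightarrow> bool" where
  "arr E X Y \<longleftrightarrow> (\<exists>p q r. X = {p, q} \<and> Y = {p, r} \<and> {q, r} \<in> E \<and> cyc p q r)"

lemma arrI: "{q, r} \<in> E \<Longrightarrow> cyc p q r \<Longrightarrow> arr E {p, q} {p, r}"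
  unfolding arr_def by blast

lemma arr_third_side:
  assumes "arr E {p, q} {p, r}" "p \<noteq> q" "p \<noteq> r" "q \<noteq> r"
  shows "{q, r} \<in> E"
proof -
  obtain p' q' r' where *: "{p, q} = {p', q'}" "{p, r} = {p', r'}" "{q', r'} \<in> E"
    using assms(1) unfolding arr_def by metis
  then have "p' = p" using assms by (auto simp: doubleton_eq_iff)
  then have "q' = q" "r' = r" using * assms by (auto simp: doubleton_eq_iff)
  then show ?thesis using * by simp
qed

lemma not_arr_third_side:
  "{q, r} \<notin> E \<Longrightarrow> p \<noteq> q \<Longrightarrow> p \<noteq> r \<Longrightarrow> q \<noteq> r \<Longrightarrow>
     \<not> arr E {p, q} {p, r} \<and> \<not> arr E {p, r} {p, q}"
  by (metis arr_third_side insert_commute)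

section \<open>The quiver of a triangulation in terms of cyclic order\<close>

lemma cyc_iff_mod:
  assumes "p < V" "q < V" "r < V" "p \<noteq> q" "p \<noteq> r" "q \<noteq> r"
  shows "(q + V - p) mod V < (r + V - p) mod V \<longleftrightarrow> cyc p q r"
proof -
  have *: "(x + V - p) mod V = (if p < x then x - p else x + V - p)" if "x < V" "p \<noteq> x" for x
  proof (cases "p < x")
    case True
    then have "x + V - p = x - p + V" by simp
    then have "(x + V - p) mod V = (x - p) mod V" by (simp only: mod_add_self2)
    then show ?thesis using True that by simp
  qed (use that assms in simp)
  show ?thesis using assms by (auto simp: * cyc_def)
qed

lemma quiver_of_triangulation_iff:
  assumes T: "triangulation N T"
  shows "quiver_of_triangulation N T i j =
    (if i \<in> {1..N} \<and> j \<in> {1..N} \<and> arr (edges N T) (T i) (T j) then 1 else 0)"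
proof -
  have "(\<exists>p q r. p < N + 3 \<and> q < N + 3 \<and> r < N + 3 \<and> p \<noteq> q \<and> p \<noteq> r \<and> q \<noteq> r \<and>
           T i = {p, q} \<and> T j = {p, r} \<and>
           (polygon_side N {q, r} \<or> {q, r} \<in> T ` {1..N}) \<and>
           (q + (N + 3) - p) mod (N + 3) < (r + (N + 3) - p) mod (N + 3)) \<longleftrightarrow>
        arr (edges N T) (T i) (T j)" (is "?L \<longleftrightarrow> ?R") if ij: "i \<in> {1..N}" "j \<in> {1..N}"
  proof
    assume ?L
    then obtain p q r where *: "p < N + 3" "q < N + 3" "r < N + 3" "p \<noteq> q" "p \<noteq> r" "q \<noteq> r"
       "T i = {p, q}" "T j = {p, r}" "polygon_side N {q, r} \<or> {q, r} \<in> T ` {1..N}"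
       "(q + (N + 3) - p) mod (N + 3) < (r + (N + 3) - p) mod (N + 3)" by blast
    then have "cyc p q r" using cyc_iff_mod[of p "N + 3" q r] by simp
    moreover have "{q, r} \<in> edges N T" using *(9) by (auto simp: edges_def)
    ultimately show ?R using * unfolding arr_def by blast
  next
    assume ?R
    then obtain p q r where *: "T i = {p, q}" "T j = {p, r}" "{q, r} \<in> edges N T" "cyc p q r"
      unfolding arr_def by blast
    have "{p, q} \<in> edges N T" "{p, r} \<in> edges N T" using ij * by (auto simp: edges_def)
    then have b: "p < N + 3" "q < N + 3" "r < N + 3" "p \<noteq> q" "p \<noteq> r" "q \<noteq> r"
      using edges_bound[OF T] *(3) by blast+
    then have "(q + (N + 3) - p) mod (N + 3) < (r + (N + 3) - p) mod (N + 3)"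
      using cyc_iff_mod[of p "N + 3" q r] * by simp
    moreover have "polygon_side N {q, r} \<or> {q, r} \<in> T ` {1..N}" using *(3) by (auto simp: edges_def)
    ultimately show ?L using b * by blast
  qed
  then show ?thesis unfolding quiver_of_triangulation_def by auto
qed

text \<open>Of two different apexes over the same edge, one comes later along the arc; then a side
  to one crosses a side to the other.\<close>

lemma apex_unique:
  assumes T: "triangulation N T"
    and "cyc a w b" "{a, w} \<in> edges N T" "{w, b} \<in> edges N T"
    and "cyc a w' b" "{a, w'} \<in> edges N T" "{w', b} \<in> edges N T"
  shows "w = w'"
proof (rule ccontr)
  assume "w \<noteq> w'"
  have "\<not> crosses {a, w} {w', b}" "\<not> crosses {a, w'} {w, b}"
    using edges_not_crosses[OF T] assms by blast+
  with \<open>w \<noteq> w'\<close> assms(2,5) show False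
    unfolding cyc_arith by argo
qed

text \<open>The two triangles at the \<open>k\<close>-th diagonal form the quadrilateral in which it
  is flipped, with counterclockwise corners \<open>a, w, b, z\<close>.\<close>

definition quad :: "nat \<Rightarrow> (nat \<Rightarrow> nat set) \<Rightarrow> nat \<Rightarrow> nat \<Rightarrow> nat \<Rightarrow> nat \<Rightarrow> nat \<Rightarrow> bool" where
  "quad N T k a w b z \<longleftrightarrow> k \<in> {1..N} \<and> T k = {a, b} \<and> cyc a w b \<and> cyc b z a \<and>
     {a, w} \<in> edges N T \<and> {w, b} \<in> edges N T \<and> {b, z} \<in> edges N T \<and> {z, a} \<in> edges N T"

lemma quad_distinct: "quad N T k a w b z \<Longrightarrow> distinct [a, w, b, z]"
proof -
  assume "quad N T k a w b z"
  then have "cyc a w b" "cyc b z a" unfolding quad_def by blast+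
  then have "a \<noteq> w \<and> a \<noteq> b \<and> a \<noteq> z \<and> w \<noteq> b \<and> w \<noteq> z \<and> b \<noteq> z"
    unfolding cyc_arith by argo
  then show ?thesis by simp
qed

lemma diagonal_edge: "i \<in> {1..N} \<Longrightarrow> T i \<in> edges N T"
  by (simp add: edges_def)

lemma exists_apex:
  assumes T: "triangulation N T" and i: "i \<in> {1..N}" "T i = {a, b}"
  obtains w where "w < N + 3" "cyc a w b" "{a, w} \<in> edges N T" "{w, b} \<in> edges N T"
proof -
  have e: "{a, b} \<in> edges N T" using diagonal_edge[of i N T] i by simp
  have nside: "\<not> polygon_side N {a, b}"
    using T i by (metis triangulation_def diagonal_def)
  define v where "v = (if a = N + 2 then 0 else a + 1)"
  have "v < N + 3" "cyc a v b"
    using nside edges_bound[OF T e] by (auto simp: v_def cyc_def polygon_side_iff)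
  then show thesis using triangle_apex[OF T e] that by blast
qed

lemma exists_quad:
  assumes T: "triangulation N T" and i: "i \<in> {1..N}" "T i = {a, b}"
  obtains w z where "quad N T i a w b z"
proof -
  obtain w where "cyc a w b" "{a, w} \<in> edges N T" "{w, b} \<in> edges N T"
    using exists_apex[OF assms] .
  moreover obtain z where "cyc b z a" "{b, z} \<in> edges N T" "{z, a} \<in> edges N T"
    using exists_apex[OF T i(1), of b a] i by (metis insert_commute)
  ultimately show thesis using that i by (simp add: quad_def)
qed

text \<open>Rotating \<open>{a, b}\<close> counterclockwise about \<open>a\<close> leads to
  \<open>{a, z}\<close> and about \<open>b\<close> to \<open>{b, w}\<close>; uniqueness of the
  apexes excludes other targets. The other pair of opposite sides carries the incoming
  arrows.\<close>

lemma arr_out_iff: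
  assumes T: "triangulation N T" and q: "quad N T k a w b z"
    and that: "X \<in> edges N T"
  shows "arr (edges N T) {a, b} X \<longleftrightarrow> X = {w, b} \<or> X = {z, a}"
proof
  assume "arr (edges N T) {a, b} X"
  then obtain p s r where *: "{a, b} = {p, s}" "X = {p, r}" "{s, r} \<in> edges N T" "cyc p s r"
    unfolding arr_def by blast
  then consider "p = a" "s = b" | "p = b" "s = a" by (auto simp: doubleton_eq_iff)
  then show "X = {w, b} \<or> X = {z, a}"
  proof cases
    case 1
    then have "r = z" using * q that
      by (intro apex_unique[OF T, of b r a z]) (auto simp: quad_def insert_commute intro: cyc_rotate)
    then show ?thesis using * 1 by auto
  next
    case 2
    then have "r = w" using * q that
      by (intro apex_unique[OF T, of a r b w]) (auto simp: quad_def insert_commute intro: cyc_rotate)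
    then show ?thesis using * 2 by auto
  qed
next
  have "{a, w} \<in> edges N T" "{b, z} \<in> edges N T" "cyc b a w" "cyc a b z"
    using q by (auto simp: quad_def cyc_def)
  then have "arr (edges N T) {b, a} {b, w}" "arr (edges N T) {a, b} {a, z}"
    unfolding arr_def by blast+
  then show "X = {w, b} \<or> X = {z, a} \<Longrightarrow> arr (edges N T) {a, b} X" by (auto simp: insert_commute)
qed

lemma arr_in_iff:
  assumes T: "triangulation N T" and q: "quad N T k a w b z"
    and that: "X \<in> edges N T"
  shows "arr (edges N T) X {a, b} \<longleftrightarrow> X = {a, w} \<or> X = {b, z}"
proof
  assume "arr (edges N T) X {a, b}"
  then obtain p s r where *: "{a, b} = {p, s}" "X = {p, r}" "{r, s} \<in> edges N T" "cyc p r s"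
    unfolding arr_def by blast
  then consider "p = a" "s = b" | "p = b" "s = a" by (auto simp: doubleton_eq_iff)
  then show "X = {a, w} \<or> X = {b, z}"
  proof cases
    case 1
    then have "r = w" using * q that
      by (intro apex_unique[OF T, of a r b w]) (auto simp: quad_def insert_commute)
    then show ?thesis using * 1 by auto
  next
    case 2
    then have "r = z" using * q that
      by (intro apex_unique[OF T, of b r a z]) (auto simp: quad_def insert_commute)
    then show ?thesis using * 2 by auto
  qed
next
  have "{w, b} \<in> edges N T" "{z, a} \<in> edges N T" "cyc a w b" "cyc b z a"
    using q by (auto simp: quad_def)
  then have "arr (edges N T) {a, w} {a, b}" "arr (edges N T) {b, z} {b, a}"
    unfolding arr_def by blast+
  then show "X = {a, w} \<or> X = {b, z} \<Longrightarrow> arr (edges N T) X {a, b}"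
    by (auto simp: insert_commute)
qed

lemma quiver_out:
  assumes T: "triangulation N T" and q: "quad N T k a w b z" and j: "j \<in> {1..N}"
  shows "quiver_of_triangulation N T k j = (if T j = {w, b} \<or> T j = {z, a} then 1 else 0)"
proof -
  have "T k = {a, b}" "k \<in> {1..N}" using q by (simp_all add: quad_def)
  then show ?thesis
    unfolding quiver_of_triangulation_iff[OF T] using arr_out_iff[OF T q diagonal_edge[OF j]] j by simp
qed

lemma quiver_in:
  assumes T: "triangulation N T" and q: "quad N T k a w b z" and j: "j \<in> {1..N}"
  shows "quiver_of_triangulation N T j k = (if T j = {a, w} \<or> T j = {b, z} then 1 else 0)"
proof -
  have "T k = {a, b}" "k \<in> {1..N}" using q by (simp_all add: quad_def)
  then show ?thesis
    unfolding quiver_of_triangulation_iff[OF T] using arr_in_iff[OF T q diagonal_edge[OF j]] j by simp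
qed

text \<open>Exchange products over quiver vertices become products over sides of the quadrilateral,
  since polygon sides have no vertex and the value 1. This serves both the current cluster in a flip
  and the initial variables in \<open>in_weight\<close> and \<open>out_weight\<close>.\<close>

context
  fixes N :: nat and T :: "nat \<Rightarrow> nat set" and g :: "nat \<Rightarrow> 'a :: comm_monoid_mult" and f :: "nat \<Rightarrow> nat \<Rightarrow> 'a"
  assumes T: "triangulation N T"
    and g: "\<And>j c d. j \<in> {1..N} \<Longrightarrow> T j = {c, d} \<Longrightarrow> g j = f c d"
    and f: "\<And>c d. polygon_side N {c, d} \<Longrightarrow> f c d = 1"
begin

lemma prod_edge:
  assumes e: "{c, d} \<in> edges N T"
  shows "(\<Prod>j\<in>{1..N}. if T j = {c, d} then g j else 1) = f c d"
proof (cases "polygon_side N {c, d}")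
  case True
  then have "T j \<noteq> {c, d}" if "j \<in> {1..N}" for j
    using T that by (metis triangulation_def diagonal_def)
  then have "(\<Prod>j\<in>{1..N}. if T j = {c, d} then g j else 1) = 1" by (intro prod.neutral) simp
  then show ?thesis using f True by simp
next
  case False
  then obtain i where i: "i \<in> {1..N}" "T i = {c, d}" using e by (force simp: edges_def)
  have "(\<Prod>j\<in>{1..N}. if T j = {c, d} then g j else 1) = (\<Prod>j\<in>{1..N}. if j = i then g j else 1)"
  proof (rule prod.cong)
    fix j assume "j \<in> {1..N}"
    then have "T j = {c, d} \<longleftrightarrow> j = i" using i T by (metis triangulation_def inj_on_eq_iff)
    then show "(if T j = {c, d} then g j else 1) = (if j = i then g j else 1)" by simp
  qed simp
  also have "\<dots> = f c d" using i g by (simp add: prod.delta)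
  finally show ?thesis .
qed

lemma prod_two_edges:
  assumes e: "{c, d} \<in> edges N T" "{c', d'} \<in> edges N T" "{c, d} \<noteq> {c', d'}"
  shows "(\<Prod>j\<in>{1..N}. g j ^ (if T j = {c, d} \<or> T j = {c', d'} then 1 else 0)) = f c d * f c' d'"
proof -
  have "(\<Prod>j\<in>{1..N}. g j ^ (if T j = {c, d} \<or> T j = {c', d'} then 1 else 0)) =
    (\<Prod>j\<in>{1..N}. (if T j = {c, d} then g j else 1) * (if T j = {c', d'} then g j else 1))"
    using e(3) by (intro prod.cong) auto
  then show ?thesis
    using prod_edge[OF e(1)] prod_edge[OF e(2)] by (simp add: prod.distrib)
qed

lemma prod_quiver_out:
  assumes q: "quad N T k a w b z"
  shows "(\<Prod>j\<in>{1..N}. g j ^ quiver_of_triangulation N T k j) = f w b * f z a"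
proof -
  have "{w, b} \<noteq> {z, a}" using quad_distinct[OF q] by (auto simp: doubleton_eq_iff)
  then have "(\<Prod>j\<in>{1..N}. g j ^ (if T j = {w, b} \<or> T j = {z, a} then 1 else 0)) = f w b * f z a"
    using q by (intro prod_two_edges) (auto simp: quad_def)
  then show ?thesis by (simp add: quiver_out[OF T q])
qed

lemma prod_quiver_in:
  assumes q: "quad N T k a w b z"
  shows "(\<Prod>j\<in>{1..N}. g j ^ quiver_of_triangulation N T j k) = f a w * f b z"
proof -
  have "{a, w} \<noteq> {b, z}" using quad_distinct[OF q] by (auto simp: doubleton_eq_iff)
  then have "(\<Prod>j\<in>{1..N}. g j ^ (if T j = {a, w} \<or> T j = {b, z} then 1 else 0)) = f a w * f b z"
    using q by (intro prod_two_edges) (auto simp: quad_def)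
  then show ?thesis by (simp add: quiver_in[OF T q])
qed

end

text \<open>Arrows carried by triangles that have the diagonal itself as third side: a flip destroys
  these for the old diagonal and creates those for the new one.\<close>

lemma arr_across_diagonal_iff:
  assumes T: "triangulation N T" and q: "quad N T k a w b z"
    and XY: "X \<in> edges N T" "Y \<in> edges N T"
  shows "arr {{a, b}} X Y \<longleftrightarrow> X = {w, b} \<and> Y = {a, w} \<or> X = {z, a} \<and> Y = {b, z}"
proof
  assume "arr {{a, b}} X Y"
  then obtain p s r where *: "X = {p, s}" "Y = {p, r}" "{s, r} = {a, b}" "cyc p s r"
    unfolding arr_def by auto
  then consider "s = a" "r = b" | "s = b" "r = a" by (auto simp: doubleton_eq_iff)
  then show "X = {w, b} \<and> Y = {a, w} \<or> X = {z, a} \<and> Y = {b, z}"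
  proof cases
    case 1
    then have "p = z" using * q XY
      by (intro apex_unique[OF T, of b p a z]) (auto simp: quad_def insert_commute intro: cyc_rotate)
    then show ?thesis using * 1 by auto
  next
    case 2
    then have "p = w" using * q XY
      by (intro apex_unique[OF T, of a p b w]) (auto simp: quad_def insert_commute intro: cyc_rotate)
    then show ?thesis using * 2 by auto
  qed
next
  have "cyc w b a" "cyc z a b" using q by (auto simp: quad_def intro: cyc_rotate)
  then have "arr {{a, b}} {w, b} {w, a}" "arr {{a, b}} {z, a} {z, b}"
    by (auto intro!: arrI)
  then show "X = {w, b} \<and> Y = {a, w} \<or> X = {z, a} \<and> Y = {b, z} \<Longrightarrow> arr {{a, b}} X Y"
    by (auto simp: insert_commute)
qed

text \<open>After the flip, the edge \<open>{w, a}\<close> must have an apex \<open>v\<close> on the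
  arc from \<open>w\<close> to \<open>a\<close>. The other sides of the quadrilateral confine
  \<open>v\<close> to \<open>b\<close> or \<open>z\<close>, and \<open>b\<close> is excluded because
  \<open>{a, b}\<close> is gone. So \<open>{w, z}\<close> is an edge; as it was none before, it is
  the new diagonal.\<close>

lemma quad_rotate_flip:
  assumes T: "triangulation N T" and T': "triangulation N (T(k := D))" and D: "D \<noteq> T k"
    and q: "quad N T k a w b z"
  shows "D = {w, z}" "quad N (T(k := D)) k w b z a" "{w, z} \<notin> edges N T" "{a, b} \<notin> edges N (T(k := D))"
    "edges N (T(k := D)) = insert {w, z} (edges N T - {{a, b}})"
proof -
  let ?T' = "T(k := D)"
  have k: "k \<in> {1..N}" "T k = {a, b}" using q by (auto simp: quad_def)
  have inj: "T j \<noteq> {a, b}" if "j \<in> {1..N}" "j \<noteq> k" for j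
    using that T k by (metis triangulation_def inj_on_eq_iff)
  have nside: "\<not> polygon_side N {a, b}"
    using T k by (metis triangulation_def diagonal_def)
  have E': "edges N ?T' = insert D (edges N T - {{a, b}})"
  proof -
    have "?T' ` {1..N} = insert D (T ` ({1..N} - {k}))" using k by auto
    moreover have "T ` ({1..N} - {k}) = T ` {1..N} - {{a, b}}"
      using inj k by auto
    ultimately show ?thesis using nside by (auto simp: edges_def)
  qed
  show nE': "{a, b} \<notin> edges N ?T'" using E' D k by auto
  have sides: "{a, w} \<in> edges N ?T'" "{w, b} \<in> edges N ?T'" "{b, z} \<in> edges N ?T'" "{z, a} \<in> edges N ?T'"
    using q quad_distinct[OF q] unfolding E' by (auto simp: quad_def doubleton_eq_iff)
  have wz: "crosses {a, b} {w, z}" using q by (auto simp: crosses_iff quad_def)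
  then show nE: "{w, z} \<notin> edges N T"
    using edges_not_crosses[OF T] diagonal_edge[of k N T] k by auto
  have "b < N + 3" using edges_bound(2)[OF T] q by (auto simp: quad_def)
  then obtain v where v: "cyc w v a" "{w, v} \<in> edges N ?T'" "{v, a} \<in> edges N ?T'"
    using triangle_apex[OF T', of w a b] sides(1) q by (auto simp: quad_def insert_commute cyc_def)
  have "\<not> crosses {v, a} {w, b}" "\<not> crosses {v, a} {b, z}" "\<not> crosses {w, v} {z, a}"
    using edges_not_crosses[OF T'] v sides by blast+
  then have "v = b \<or> v = z"
    using v(1) q[unfolded quad_def] unfolding cyc_arith by argo
  then have "{w, z} \<in> edges N ?T'" using v nE' by (auto simp: insert_commute)
  then have "{w, z} = D \<or> {w, z} \<in> edges N T" by (simp only: E' insert_iff Diff_iff) blast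
  then show Dwz: "D = {w, z}" using nE by simp
  show "edges N ?T' = insert {w, z} (edges N T - {{a, b}})" using E' Dwz by simp
  show "quad N ?T' k w b z a"
  proof -
    have "cyc w b z" "cyc z a w" using q[unfolded quad_def] unfolding cyc_arith by argo+
    then show ?thesis using sides Dwz k by (simp add: quad_def)
  qed
qed

lemma arr_antisym: "arr E X Y \<Longrightarrow> \<not> arr E Y X"
proof
  assume "arr E X Y" "arr E Y X"
  then obtain p q r p' q' r' where "X = {p, q}" "Y = {p, r}" "cyc p q r"
      "Y = {p', q'}" "X = {p', r'}" "cyc p' q' r'"
    unfolding arr_def by metis
  then have "{p, q} = {p', r'}" "{p, r} = {p', q'}" "cyc p q r" "cyc p' q' r'" by simp_all
  then show False unfolding doubleton_eq_iff cyc_arith by argo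
qed

text \<open>At \<open>k\<close> the corners advance by one place, which exchanges incoming and
  outgoing sides. Elsewhere a path \<open>i \<rightarrow> k \<rightarrow> j\<close> joins two
  neighbouring sides of the quadrilateral: if they share an old triangle, the added arrow cancels
  the arrow \<open>j \<rightarrow> i\<close> of that triangle; otherwise they share a new triangle,
  which carries the added arrow.\<close>

lemma mutate_quiver_flip:
  assumes T: "triangulation N T" and T': "triangulation N (T(k := D))" and D: "D \<noteq> T k"
    and k: "k \<in> {1..N}"
  shows "mutate_quiver k (quiver_of_triangulation N T) = quiver_of_triangulation N (T(k := D))"
proof (intro ext)
  fix i j
  let ?T' = "T(k := D)" and ?R = "quiver_of_triangulation N T" and ?R' = "quiver_of_triangulation N (T(k := D))"
  have "diagonal N (T k)" using T k by (simp add: triangulation_def)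
  then obtain a b where "T k = {a, b}" by (rule diagonalE)
  then obtain w z where q: "quad N T k a w b z" using exists_quad[OF T k] by blast
  note fl = quad_rotate_flip[OF T T' D q]
  have Tk: "T k = {a, b}" using q by (simp add: quad_def)
  have dist: "distinct [a, w, b, z]" by (rule quad_distinct[OF q])
  show "mutate_quiver k ?R i j = ?R' i j"
  proof (cases "i \<in> {1..N} \<and> j \<in> {1..N}")
    case False
    have "?R x y = 0" "?R' x y = 0" if "x \<notin> {1..N} \<or> y \<notin> {1..N}" for x y
      using that unfolding quiver_of_triangulation_def by auto
    then show ?thesis using False by (auto simp: mutate_quiver_def)
  next
    case True
    then have ij: "i \<in> {1..N}" "j \<in> {1..N}" by auto
    consider "i = k" | "j = k" | "i \<noteq> k" "j \<noteq> k" by blast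
    then show ?thesis
    proof cases
      case 1
      have "mutate_quiver k ?R i j = (if T j = {a, w} \<or> T j = {b, z} then 1 else 0)"
        using 1 quiver_in[OF T q ij(2)] by (simp add: mutate_quiver_def)
      moreover have "?R' i j = (if ?T' j = {b, z} \<or> ?T' j = {a, w} then 1 else 0)"
        using 1 quiver_out[OF T' fl(2) ij(2)] by simp
      ultimately show ?thesis using dist Tk fl(1) by (auto simp: doubleton_eq_iff)
    next
      case 2
      have "mutate_quiver k ?R i j = (if T i = {w, b} \<or> T i = {z, a} then 1 else 0)"
        using 2 quiver_out[OF T q ij(1)] by (simp add: mutate_quiver_def)
      moreover have "?R' i j = (if ?T' i = {w, b} \<or> ?T' i = {z, a} then 1 else 0)"
        using 2 quiver_in[OF T' fl(2) ij(1)] by simp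
      ultimately show ?thesis using dist Tk fl(1) by (auto simp: doubleton_eq_iff)
    next
      case 3
      define X Y where "X = T i" and "Y = T j"
      let ?E0 = "edges N T - {{a, b}}"
      have R: "?R i j = (if arr (edges N T) X Y then 1 else 0)" "?R j i = (if arr (edges N T) Y X then 1 else 0)"
        "?R' i j = (if arr (edges N ?T') X Y then 1 else 0)"
        using ij 3 by (simp_all add: X_def Y_def quiver_of_triangulation_iff[OF T] quiver_of_triangulation_iff[OF T'])
      have Rk: "?R k i = (if X = {w, b} \<or> X = {z, a} then 1 else 0)"
        "?R k j = (if Y = {w, b} \<or> Y = {z, a} then 1 else 0)"
        "?R i k = (if X = {a, w} \<or> X = {b, z} then 1 else 0)"
        "?R j k = (if Y = {a, w} \<or> Y = {b, z} then 1 else 0)"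
        using quiver_out[OF T q] quiver_in[OF T q] ij by (simp_all add: X_def Y_def)
      have "T i \<noteq> T k" "T j \<noteq> T k"
        using ij 3 k T by (metis triangulation_def inj_on_eq_iff)+
      then have XY: "X \<in> edges N T" "Y \<in> edges N T" "X \<noteq> {a, b}" "Y \<noteq> {a, b}"
        using ij diagonal_edge by (simp_all add: X_def Y_def Tk)
      have "X \<in> edges N ?T'" "Y \<in> edges N ?T'" using XY fl(5) by auto
      then have third_wz: "arr {{w, z}} X Y \<longleftrightarrow> X = {b, z} \<and> Y = {w, b} \<or> X = {a, w} \<and> Y = {z, a}"
        by (rule arr_across_diagonal_iff[OF T' fl(2)])
      have arr_insert: "arr (insert e E) X Y \<longleftrightarrow> arr E X Y \<or> arr {e} X Y" for e E X Y
        unfolding arr_def by blast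
      have "edges N T = insert {a, b} ?E0" using q diagonal_edge[of k N T] Tk k by auto
      then have old: "arr (edges N T) X Y \<longleftrightarrow> arr ?E0 X Y \<or> X = {w, b} \<and> Y = {a, w} \<or> X = {z, a} \<and> Y = {b, z}"
          "arr (edges N T) Y X \<longleftrightarrow> arr ?E0 Y X \<or> Y = {w, b} \<and> X = {a, w} \<or> Y = {z, a} \<and> X = {b, z}"
        using arr_insert[of "{a, b}" ?E0 X Y] arr_insert[of "{a, b}" ?E0 Y X]
          arr_across_diagonal_iff[OF T q XY(1,2)] arr_across_diagonal_iff[OF T q XY(2,1)] by simp_all
      have new: "arr (edges N ?T') X Y \<longleftrightarrow> arr ?E0 X Y \<or> X = {b, z} \<and> Y = {w, b} \<or> X = {a, w} \<and> Y = {z, a}"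
        by (simp only: fl(5) arr_insert[of "{w, z}" ?E0 X Y] third_wz)
      \<comment> \<open>The third side for two neighbouring sides of the quadrilateral is
        \<open>{a, b}\<close> or \<open>{w, z}\<close>, and \<open>?E0\<close> contains
        neither.\<close>
      have none: "\<not> arr ?E0 X Y \<and> \<not> arr ?E0 Y X"
        if "X = {a, w} \<or> X = {b, z}" "Y = {w, b} \<or> Y = {z, a}" for X Y
      proof -
        have E0: "{a, b} \<notin> ?E0" "{w, z} \<notin> ?E0" using fl(3) by auto
        have swap: "{w, a} = {a, w}" "{z, b} = {b, z}" "{b, w} = {w, b}" "{a, z} = {z, a}" by auto
        show ?thesis
          using that dist not_arr_third_side[OF E0(1), of w] not_arr_third_side[OF E0(2), of a]
            not_arr_third_side[OF E0(2), of b] not_arr_third_side[OF E0(1), of z]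
          unfolding swap by (elim disjE) simp_all
      qed
      \<comment> \<open>If no path runs through \<open>k\<close>, the truncated difference leaves
        the existing arrows unchanged only because there are no 2-cycles.\<close>
      have anti: "\<not> (arr (edges N T) X Y \<and> arr (edges N T) Y X)"
        using arr_antisym by blast
      have ne: "{a, w} \<noteq> {w, b}" "{a, w} \<noteq> {z, a}" "{b, z} \<noteq> {w, b}" "{b, z} \<noteq> {z, a}" "{a, w} \<noteq> {b, z}" "{w, b} \<noteq> {z, a}"
        using dist by (auto simp: doubleton_eq_iff)
      have m: "mutate_quiver k ?R i j = (?R i j + ?R i k * ?R k j) - (?R j i + ?R j k * ?R k i)"
        using 3 by (simp add: mutate_quiver_def)
      consider "X = {a, w} \<or> X = {b, z}" "Y = {w, b} \<or> Y = {z, a}"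
        | "Y = {a, w} \<or> Y = {b, z}" "X = {w, b} \<or> X = {z, a}"
        | "\<not> ((X = {a, w} \<or> X = {b, z}) \<and> (Y = {w, b} \<or> Y = {z, a}))"
          "\<not> ((Y = {a, w} \<or> Y = {b, z}) \<and> (X = {w, b} \<or> X = {z, a}))" by blast
      then show ?thesis
      proof cases
        case 1
        show ?thesis unfolding m R Rk old new using none[OF 1] 1 ne ne[symmetric] by (elim disjE) simp_all
      next
        case 2
        show ?thesis unfolding m R Rk old new using none[OF 2] 2 ne ne[symmetric] by (elim disjE) simp_all
      next
        case 3
        have z: "?R i k * ?R k j = 0" "?R j k * ?R k i = 0" using 3 unfolding Rk by auto
        have "arr (edges N T) X Y \<longleftrightarrow> arr (edges N ?T') X Y" using 3 unfolding old(1) new by blast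
        then show ?thesis using anti unfolding m z R by simp
      qed
    qed
  qed
qed

text \<open>The exchange relation is the Ptolemy relation of \<open>a, w, b, z\<close>, divided by
  the nonzero value \<open>f a b\<close>: incoming and outgoing sides are the two pairs of opposite
  sides.\<close>

lemma flip_seed_ptolemy:
  assumes "flip_seed N T T' u R'" and T: "triangulation N T" and f: "ptolemy_function N T f"
  shows "triangulation N T' \<and> R' = quiver_of_triangulation N T' \<and>
    (\<forall>j\<in>{1..N}. \<forall>c d. T' j = {c, d} \<longrightarrow> u j = f c d)"
  using assms(1)
proof induction
  case init
  then show ?case using T ptolemy_initial[OF f] by auto
next
  case (step T' u R' k D)
  note T' = step.IH[THEN conjunct1]
  have R': "R' = quiver_of_triangulation N T'" using step.IH by blast
  have u: "u j = f c d" if "j \<in> {1..N}" "T' j = {c, d}" for j c d using step.IH that by blast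
  note side = ptolemy_side[OF f]
  have "diagonal N (T' k)" using T' step.hyps by (simp add: triangulation_def)
  then obtain a b where "T' k = {a, b}" by (rule diagonalE)
  then obtain w z where q: "quad N T' k a w b z" using exists_quad[OF T' step.hyps(2)] by blast
  note fl = quad_rotate_flip[OF T' step.hyps(4,3) q]
  have ab: "T' k = {a, b}" "{a, b} \<in> edges N T'" using q diagonal_edge[of k N T'] by (auto simp: quad_def)
  have "cyc a w b" "cyc a b z" using q by (auto simp: quad_def intro: cyc_rotate)
  then have "f a b * f w z = f a w * f b z + f w b * f a z" by (rule ptolemy_relation[OF f])
  moreover have "f a b \<noteq> 0" using ptolemy_nonzero[OF T f] edges_bound[OF T' ab(2)] by blast
  ultimately have wz: "(f a w * f b z + f w b * f z a) / f a b = f w z"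
    using ptolemy_sym[OF f, of a z] by (simp add: field_simps)
  have new: "mutate_cluster N k R' u = u(k := f w z)"
    unfolding mutate_cluster_def R'
    using prod_quiver_in[OF T' u side q] prod_quiver_out[OF T' u side q] wz u[OF step.hyps(2) ab(1)]
    by simp
  have "mutate_cluster N k R' u j = f c d" if "j \<in> {1..N}" "(T'(k := D)) j = {c, d}" for j c d
  proof (cases "j = k")
    case True
    then have "{c, d} = {w, z}" using that fl(1) by simp
    then show ?thesis using True new ptolemy_sym[OF f] by (auto simp: doubleton_eq_iff)
  next
    case False
    then show ?thesis using that u new by simp
  qed
  then show ?case
    unfolding R' mutate_quiver_flip[OF T' step.hyps(4,3,2)] using step.hyps(4) R' by blast
qed

lemma variable_of_diagonal_ptolemy:
  assumes "variable_of_diagonal N T {p, q} x" "triangulation N T" "ptolemy_function N T f"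
  shows "x = f p q"
  using assms flip_seed_ptolemy unfolding variable_of_diagonal_def by metis

section \<open>Expansion of a single diagonal\<close>

definition upsets :: "(nat \<times> nat) set \<Rightarrow> nat set \<Rightarrow> nat set set" where
  "upsets A Y = {\<theta>. \<theta> \<subseteq> Y \<and> (\<forall>i j. (i, j) \<in> A \<longrightarrow> i \<in> Y \<longrightarrow> j \<in> Y \<longrightarrow> i \<in> \<theta> \<longrightarrow> j \<in> \<theta>)}"

definition upset_weight :: "(nat \<Rightarrow> 'a) \<Rightarrow> (nat \<Rightarrow> 'a) \<Rightarrow> nat set \<Rightarrow> nat set \<Rightarrow> 'a :: comm_semiring_1" where
  "upset_weight g h Y \<theta> = (\<Prod>l\<in>Y. if l \<in> \<theta> then g l else h l)"

text \<open>The factor of the root \<open>i\<close> is left out because the neighbours of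
  \<open>T i\<close> lie on both sides of it: each side is summed separately, the sums are
  multiplied at the root, and its factor is inserted once.\<close>

definition rooted_sum ::
  "(nat \<times> nat) set \<Rightarrow> (nat \<Rightarrow> 'a) \<Rightarrow> (nat \<Rightarrow> 'a) \<Rightarrow> nat set \<Rightarrow> nat \<Rightarrow> bool \<Rightarrow> 'a :: comm_semiring_1" where
  "rooted_sum A g h Y i s = (\<Sum>\<theta>\<in>{\<theta> \<in> upsets A Y. (i \<in> \<theta>) = s}. upset_weight g h (Y - {i}) \<theta>)"

lemma upsetsI:
  "\<theta> \<subseteq> Y \<Longrightarrow> (\<And>i j. (i, j) \<in> A \<Longrightarrow> i \<in> Y \<Longrightarrow> j \<in> Y \<Longrightarrow> i \<in> \<theta> \<Longrightarrow> j \<in> \<theta>) \<Longrightarrow> \<theta> \<in> upsets A Y"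
  unfolding upsets_def by blast

lemma upsets_subset: "\<theta> \<in> upsets A Y \<Longrightarrow> \<theta> \<subseteq> Y"
  unfolding upsets_def by blast

lemma upsetsD: "\<theta> \<in> upsets A Y \<Longrightarrow> (i, j) \<in> A \<Longrightarrow> i \<in> Y \<Longrightarrow> j \<in> Y \<Longrightarrow> i \<in> \<theta> \<Longrightarrow> j \<in> \<theta>"
  unfolding upsets_def by blast

lemma upsets_insert_without:
  assumes "i \<notin> Y" "\<theta> \<subseteq> Y"
  shows "\<theta> \<in> upsets A (insert i Y) \<longleftrightarrow> \<theta> \<in> upsets A Y \<and> (\<forall>l\<in>Y. (l, i) \<in> A \<longrightarrow> l \<notin> \<theta>)"
  unfolding upsets_def using assms by blast

lemma upsets_insert_with:
  assumes "i \<notin> Y" "\<theta> \<subseteq> Y"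
  shows "insert i \<theta> \<in> upsets A (insert i Y) \<longleftrightarrow> \<theta> \<in> upsets A Y \<and> (\<forall>l\<in>Y. (i, l) \<in> A \<longrightarrow> l \<in> \<theta>)"
  unfolding upsets_def using assms by blast

lemma upsets_insert_False:
  assumes "i \<notin> Y"
  shows "{\<theta> \<in> upsets A (insert i Y). (i \<in> \<theta>) = False} =
    {\<theta> \<in> upsets A Y. \<forall>l\<in>Y. (l, i) \<in> A \<longrightarrow> l \<notin> \<theta>}"
proof (intro equalityI subsetI)
  fix \<theta> assume *: "\<theta> \<in> {\<theta> \<in> upsets A (insert i Y). (i \<in> \<theta>) = False}"
  then have "\<theta> \<subseteq> Y" using upsets_subset by blast
  then show "\<theta> \<in> {\<theta> \<in> upsets A Y. \<forall>l\<in>Y. (l, i) \<in> A \<longrightarrow> l \<notin> \<theta>}"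
    using * upsets_insert_without[OF assms] by blast
next
  fix \<theta> assume *: "\<theta> \<in> {\<theta> \<in> upsets A Y. \<forall>l\<in>Y. (l, i) \<in> A \<longrightarrow> l \<notin> \<theta>}"
  then have "\<theta> \<subseteq> Y" using upsets_subset by blast
  then show "\<theta> \<in> {\<theta> \<in> upsets A (insert i Y). (i \<in> \<theta>) = False}"
    using * upsets_insert_without[OF assms] assms by blast
qed

lemma upsets_insert_True:
  assumes "i \<notin> Y"
  shows "{\<theta> \<in> upsets A (insert i Y). (i \<in> \<theta>) = True} =
    insert i ` {\<theta> \<in> upsets A Y. \<forall>l\<in>Y. (i, l) \<in> A \<longrightarrow> l \<in> \<theta>}"
proof (intro equalityI subsetI)
  fix \<theta> assume *: "\<theta> \<in> {\<theta> \<in> upsets A (insert i Y). (i \<in> \<theta>) = True}"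
  then have eq: "\<theta> = insert i (\<theta> - {i})" and sub: "\<theta> - {i} \<subseteq> Y" using upsets_subset by blast+
  have "insert i (\<theta> - {i}) \<in> upsets A (insert i Y)" unfolding eq[symmetric] using * by blast
  then have "\<theta> - {i} \<in> {\<theta> \<in> upsets A Y. \<forall>l\<in>Y. (i, l) \<in> A \<longrightarrow> l \<in> \<theta>}"
    unfolding upsets_insert_with[OF assms sub] by blast
  with eq show "\<theta> \<in> insert i ` {\<theta> \<in> upsets A Y. \<forall>l\<in>Y. (i, l) \<in> A \<longrightarrow> l \<in> \<theta>}"
    by (rule image_eqI)
next
  fix \<theta> assume "\<theta> \<in> insert i ` {\<theta> \<in> upsets A Y. \<forall>l\<in>Y. (i, l) \<in> A \<longrightarrow> l \<in> \<theta>}"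
  then obtain \<theta>' where *: "\<theta> = insert i \<theta>'" "\<theta>' \<in> {\<theta> \<in> upsets A Y. \<forall>l\<in>Y. (i, l) \<in> A \<longrightarrow> l \<in> \<theta>}" by blast
  then have "\<theta>' \<subseteq> Y" using upsets_subset by blast
  then show "\<theta> \<in> {\<theta> \<in> upsets A (insert i Y). (i \<in> \<theta>) = True}"
    using * upsets_insert_with[OF assms] by auto
qed

lemma inj_on_insert_upsets: "i \<notin> Y \<Longrightarrow> inj_on (insert i) (upsets A Y)"
  using upsets_subset by (intro inj_onI) (metis insert_ident subsetD)

lemma finite_upsets: "finite Y \<Longrightarrow> finite (upsets A Y)"
  by (rule finite_subset[of _ "Pow Y"]) (use upsets_subset in auto)

lemma sum_upsets_fixed:
  assumes "finite Y" "i \<in> Y"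
  shows "(\<Sum>\<theta>\<in>{\<theta> \<in> upsets A Y. (i \<in> \<theta>) = s}. upset_weight g h Y \<theta>) =
    (if s then g i else h i) * rooted_sum A g h Y i s"
proof -
  have "upset_weight g h Y \<theta> = (if i \<in> \<theta> then g i else h i) * upset_weight g h (Y - {i}) \<theta>" for \<theta>
    unfolding upset_weight_def by (rule prod.remove[OF assms])
  then show ?thesis unfolding rooted_sum_def sum_distrib_left by (intro sum.cong) auto
qed

lemma sum_upsets:
  assumes "finite Y" "i \<in> Y"
  shows "(\<Sum>\<theta>\<in>upsets A Y. upset_weight g h Y \<theta>) =
    h i * rooted_sum A g h Y i False + g i * rooted_sum A g h Y i True"
proof -
  have "upsets A Y = {\<theta> \<in> upsets A Y. (i \<in> \<theta>) = False} \<union> {\<theta> \<in> upsets A Y. (i \<in> \<theta>) = True}"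
    by blast
  then have "(\<Sum>\<theta>\<in>upsets A Y. upset_weight g h Y \<theta>) =
      (\<Sum>\<theta>\<in>{\<theta> \<in> upsets A Y. (i \<in> \<theta>) = False}. upset_weight g h Y \<theta>) +
      (\<Sum>\<theta>\<in>{\<theta> \<in> upsets A Y. (i \<in> \<theta>) = True}. upset_weight g h Y \<theta>)"
    using finite_upsets[OF assms(1), of A] by (subst sum.union_disjoint[symmetric]) auto
  then show ?thesis unfolding sum_upsets_fixed[OF assms] by simp
qed

lemma rooted_sum_insert_eq:
  assumes i: "i \<notin> Y"
  shows "rooted_sum A g h (insert i Y) i False =
      (\<Sum>\<theta>\<in>{\<theta> \<in> upsets A Y. \<forall>l\<in>Y. (l, i) \<in> A \<longrightarrow> l \<notin> \<theta>}. upset_weight g h Y \<theta>)"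
    "rooted_sum A g h (insert i Y) i True =
      (\<Sum>\<theta>\<in>{\<theta> \<in> upsets A Y. \<forall>l\<in>Y. (i, l) \<in> A \<longrightarrow> l \<in> \<theta>}. upset_weight g h Y \<theta>)"
proof -
  have ins: "insert i Y - {i} = Y" using i by auto
  show "rooted_sum A g h (insert i Y) i False =
      (\<Sum>\<theta>\<in>{\<theta> \<in> upsets A Y. \<forall>l\<in>Y. (l, i) \<in> A \<longrightarrow> l \<notin> \<theta>}. upset_weight g h Y \<theta>)"
    unfolding rooted_sum_def ins upsets_insert_False[OF i] ..
  have "inj_on (insert i) {\<theta> \<in> upsets A Y. \<forall>l\<in>Y. (i, l) \<in> A \<longrightarrow> l \<in> \<theta>}"
    by (rule inj_on_subset[OF inj_on_insert_upsets[OF i]]) auto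
  moreover have "upset_weight g h Y (insert i \<theta>) = upset_weight g h Y \<theta>" for \<theta>
    unfolding upset_weight_def using i by (intro prod.cong) auto
  ultimately show "rooted_sum A g h (insert i Y) i True =
      (\<Sum>\<theta>\<in>{\<theta> \<in> upsets A Y. \<forall>l\<in>Y. (i, l) \<in> A \<longrightarrow> l \<in> \<theta>}. upset_weight g h Y \<theta>)"
    unfolding rooted_sum_def ins upsets_insert_True[OF i] by (simp add: sum.reindex)
qed

text \<open>The new root meets \<open>Y\<close> only in the arrow \<open>j \<rightarrow> i\<close>:
  leaving \<open>i\<close> out forces \<open>j\<close> out, while taking \<open>i\<close> puts no
  condition on \<open>j\<close>. The variant after it treats the opposite arrow.\<close>

lemma rooted_sum_insert:
  assumes Y: "finite Y" "i \<notin> Y" "j \<in> Y"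
    and arrows: "\<And>l. l \<in> Y \<Longrightarrow> (l, i) \<in> A \<longleftrightarrow> l = j" "\<And>l. l \<in> Y \<Longrightarrow> (i, l) \<notin> A"
  shows "rooted_sum A g h (insert i Y) i False = h j * rooted_sum A g h Y j False"
    "rooted_sum A g h (insert i Y) i True = h j * rooted_sum A g h Y j False + g j * rooted_sum A g h Y j True"
proof -
  have "{\<theta> \<in> upsets A Y. \<forall>l\<in>Y. (l, i) \<in> A \<longrightarrow> l \<notin> \<theta>} = {\<theta> \<in> upsets A Y. (j \<in> \<theta>) = False}"
    using Y(3) arrows(1) by auto
  then show "rooted_sum A g h (insert i Y) i False = h j * rooted_sum A g h Y j False"
    using sum_upsets_fixed[OF Y(1,3), where A = A and s = False and g = g and h = h]
    by (simp add: rooted_sum_insert_eq[OF Y(2)])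
  have "{\<theta> \<in> upsets A Y. \<forall>l\<in>Y. (i, l) \<in> A \<longrightarrow> l \<in> \<theta>} = upsets A Y"
    using arrows(2) by auto
  then show "rooted_sum A g h (insert i Y) i True =
      h j * rooted_sum A g h Y j False + g j * rooted_sum A g h Y j True"
    unfolding rooted_sum_insert_eq[OF Y(2)] using sum_upsets[OF Y(1,3)] by simp
qed

lemma rooted_sum_insert':
  assumes Y: "finite Y" "i \<notin> Y" "j \<in> Y"
    and arrows: "\<And>l. l \<in> Y \<Longrightarrow> (i, l) \<in> A \<longleftrightarrow> l = j" "\<And>l. l \<in> Y \<Longrightarrow> (l, i) \<notin> A"
  shows "rooted_sum A g h (insert i Y) i True = g j * rooted_sum A g h Y j True"
    "rooted_sum A g h (insert i Y) i False = h j * rooted_sum A g h Y j False + g j * rooted_sum A g h Y j True"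
proof -
  have "{\<theta> \<in> upsets A Y. \<forall>l\<in>Y. (i, l) \<in> A \<longrightarrow> l \<in> \<theta>} = {\<theta> \<in> upsets A Y. (j \<in> \<theta>) = True}"
    using Y(3) arrows(1) by auto
  then show "rooted_sum A g h (insert i Y) i True = g j * rooted_sum A g h Y j True"
    using sum_upsets_fixed[OF Y(1,3), where A = A and s = True and g = g and h = h]
    by (simp add: rooted_sum_insert_eq[OF Y(2)])
  have "{\<theta> \<in> upsets A Y. \<forall>l\<in>Y. (l, i) \<in> A \<longrightarrow> l \<notin> \<theta>} = upsets A Y"
    using arrows(2) by auto
  then show "rooted_sum A g h (insert i Y) i False =
      h j * rooted_sum A g h Y j False + g j * rooted_sum A g h Y j True"
    unfolding rooted_sum_insert_eq[OF Y(2)] using sum_upsets[OF Y(1,3)] by simp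
qed

text \<open>With the choice at the common root fixed, closed sets on the two parts are independent,
  because no arrow joins the parts away from \<open>i\<close>.\<close>

lemma rooted_sum_union:
  assumes fin: "finite Y1" "finite Y2" and i: "Y1 \<inter> Y2 = {i}"
    and arrows: "\<And>l m. l \<in> Y1 - {i} \<Longrightarrow> m \<in> Y2 - {i} \<Longrightarrow> (l, m) \<notin> A \<and> (m, l) \<notin> A"
  shows "rooted_sum A g h (Y1 \<union> Y2) i s = rooted_sum A g h Y1 i s * rooted_sum A g h Y2 i s"
proof -
  let ?U = "\<lambda>Y. {\<theta> \<in> upsets A Y. (i \<in> \<theta>) = s}"
  have bij: "bij_betw (\<lambda>(\<theta>1, \<theta>2). \<theta>1 \<union> \<theta>2) (?U Y1 \<times> ?U Y2) (?U (Y1 \<union> Y2))"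
  proof (rule bij_betw_byWitness[where f' = "\<lambda>\<theta>. (\<theta> \<inter> Y1, \<theta> \<inter> Y2)"])
    have sub: "\<theta> \<subseteq> Y" if "\<theta> \<in> ?U Y" for \<theta> Y using that upsets_subset by blast
    have restr: "(\<theta>1 \<union> \<theta>2) \<inter> Y1 = \<theta>1 \<and> (\<theta>1 \<union> \<theta>2) \<inter> Y2 = \<theta>2"
      if "\<theta>1 \<in> ?U Y1" "\<theta>2 \<in> ?U Y2" for \<theta>1 \<theta>2
    proof -
      have 1: "\<theta>1 \<subseteq> Y1" "\<theta>2 \<subseteq> Y2" using that sub by blast+
      have 2: "i \<in> \<theta>1 \<longleftrightarrow> i \<in> \<theta>2" using that by auto
      have "x = i" if "x \<in> Y1" "x \<in> Y2" for x using i that by blast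
      with 1 2 show ?thesis by auto
    qed
    show "\<forall>x\<in>?U Y1 \<times> ?U Y2. (\<lambda>\<theta>. (\<theta> \<inter> Y1, \<theta> \<inter> Y2)) ((\<lambda>(\<theta>1, \<theta>2). \<theta>1 \<union> \<theta>2) x) = x"
      using restr by auto
    show "\<forall>\<theta>\<in>?U (Y1 \<union> Y2). (\<lambda>(\<theta>1, \<theta>2). \<theta>1 \<union> \<theta>2) ((\<lambda>\<theta>. (\<theta> \<inter> Y1, \<theta> \<inter> Y2)) \<theta>) = \<theta>"
      using sub[of _ "Y1 \<union> Y2"] by auto
    have "\<theta>1 \<union> \<theta>2 \<in> ?U (Y1 \<union> Y2)" if \<theta>: "\<theta>1 \<in> ?U Y1" "\<theta>2 \<in> ?U Y2" for \<theta>1 \<theta>2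
    proof -
      have u: "\<theta>1 \<in> upsets A Y1" "\<theta>2 \<in> upsets A Y2" using \<theta> by auto
      have "\<theta>1 \<union> \<theta>2 \<in> upsets A (Y1 \<union> Y2)"
      proof (rule upsetsI)
        show "\<theta>1 \<union> \<theta>2 \<subseteq> Y1 \<union> Y2" using u upsets_subset by blast
        fix l m assume lm: "(l, m) \<in> A" "l \<in> Y1 \<union> Y2" "m \<in> Y1 \<union> Y2" "l \<in> \<theta>1 \<union> \<theta>2"
        have "l \<in> Y1 \<and> m \<in> Y1 \<or> l \<in> Y2 \<and> m \<in> Y2"
        proof (cases "l = i \<or> m = i")
          case True
          then show ?thesis using lm i by blast
        next
          case False
          then show ?thesis using lm arrows by blast
        qed
        then show "m \<in> \<theta>1 \<union> \<theta>2"
        proof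
          assume Y: "l \<in> Y1 \<and> m \<in> Y1"
          then have "l \<in> \<theta>1" using lm(4) restr[OF \<theta>] by blast
          then show ?thesis using upsetsD[OF u(1) lm(1)] Y by blast
        next
          assume Y: "l \<in> Y2 \<and> m \<in> Y2"
          then have "l \<in> \<theta>2" using lm(4) restr[OF \<theta>] by blast
          then show ?thesis using upsetsD[OF u(2) lm(1)] Y by blast
        qed
      qed
      moreover have "(i \<in> \<theta>1 \<union> \<theta>2) = s" using \<theta> by auto
      ultimately show ?thesis by blast
    qed
    then show "(\<lambda>(\<theta>1, \<theta>2). \<theta>1 \<union> \<theta>2) ` (?U Y1 \<times> ?U Y2) \<subseteq> ?U (Y1 \<union> Y2)" by auto
    have iY: "i \<in> Y1" "i \<in> Y2" using i by auto
    have "\<theta> \<inter> Y \<in> upsets A Y" if "\<theta> \<in> upsets A (Y1 \<union> Y2)" "Y \<subseteq> Y1 \<union> Y2" for \<theta> Y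
      using that unfolding upsets_def by blast
    then show "(\<lambda>\<theta>. (\<theta> \<inter> Y1, \<theta> \<inter> Y2)) ` ?U (Y1 \<union> Y2) \<subseteq> ?U Y1 \<times> ?U Y2"
      using iY by auto
  qed
  have weight: "upset_weight g h (Y1 \<union> Y2 - {i}) (\<theta>1 \<union> \<theta>2) =
      upset_weight g h (Y1 - {i}) \<theta>1 * upset_weight g h (Y2 - {i}) \<theta>2"
    if "\<theta>1 \<in> ?U Y1" "\<theta>2 \<in> ?U Y2" for \<theta>1 \<theta>2
  proof -
    have sub: "\<theta>1 \<subseteq> Y1" "\<theta>2 \<subseteq> Y2" using that upsets_subset by blast+
    have "upset_weight g h (Y1 \<union> Y2 - {i}) (\<theta>1 \<union> \<theta>2) =
      upset_weight g h (Y1 - {i}) (\<theta>1 \<union> \<theta>2) * upset_weight g h (Y2 - {i}) (\<theta>1 \<union> \<theta>2)"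
      unfolding upset_weight_def Un_Diff using fin i by (intro prod.union_disjoint) auto
    moreover have "upset_weight g h (Y1 - {i}) (\<theta>1 \<union> \<theta>2) = upset_weight g h (Y1 - {i}) \<theta>1"
      unfolding upset_weight_def using i sub by (intro prod.cong) auto
    moreover have "upset_weight g h (Y2 - {i}) (\<theta>1 \<union> \<theta>2) = upset_weight g h (Y2 - {i}) \<theta>2"
      unfolding upset_weight_def using i sub by (intro prod.cong) auto
    ultimately show ?thesis by simp
  qed
  have "rooted_sum A g h (Y1 \<union> Y2) i s =
      (\<Sum>(\<theta>1, \<theta>2)\<in>?U Y1 \<times> ?U Y2. upset_weight g h (Y1 - {i}) \<theta>1 * upset_weight g h (Y2 - {i}) \<theta>2)"
    unfolding rooted_sum_def sum.reindex_bij_betw[OF bij, symmetric]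
    using weight by (intro sum.cong) auto
  also have "\<dots> = rooted_sum A g h Y1 i s * rooted_sum A g h Y2 i s"
    unfolding rooted_sum_def sum_product sum.cartesian_product ..
  finally show ?thesis .
qed

section \<open>Arrows, triangles and weights in a triangulated polygon\<close>

locale triangulated_polygon =
  fixes N :: nat and T :: "nat \<Rightarrow> nat set" and f :: "nat \<Rightarrow> nat \<Rightarrow> ratfun"
  assumes T: "triangulation N T" and f: "ptolemy_function N T f"
begin

abbreviation "Q \<equiv> quiver_of_triangulation N T"

lemma arrows_iff: "(i, j) \<in> arrows Q \<longleftrightarrow> i \<in> {1..N} \<and> j \<in> {1..N} \<and> arr (edges N T) (T i) (T j)"
  by (simp add: arrows_def quiver_of_triangulation_iff[OF T])

lemma arrows_irrefl: "(i, i) \<notin> arrows Q"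
  unfolding arrows_iff using arr_antisym by blast

lemma finite_arrows: "finite (arrows Q)"
  by (rule finite_subset[of _ "{1..N} \<times> {1..N}"]) (auto simp: arrows_iff)

lemma T_inj: "i \<in> {1..N} \<Longrightarrow> j \<in> {1..N} \<Longrightarrow> T i = T j \<longleftrightarrow> i = j"
  using T unfolding triangulation_def by (metis inj_on_eq_iff)

lemma T_edge: "i \<in> {1..N} \<Longrightarrow> T i \<in> edges N T"
  by (rule diagonal_edge)

lemma not_crosses_T: "i \<in> {1..N} \<Longrightarrow> E \<in> edges N T \<Longrightarrow> \<not> crosses (T i) E"
  by (rule edges_not_crosses[OF T T_edge])

lemma arrow_endpoints:
  assumes "(i, j) \<in> arrows Q"
  obtains p q r where "i \<in> {1..N}" "j \<in> {1..N}" "T i = {p, q}" "T j = {p, r}" "{q, r} \<in> edges N T" "cyc p q r"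
  using assms unfolding arrows_iff arr_def by blast

text \<open>Rotation about one endpoint is a linear order on the diagonals there, so three diagonals
  through \<open>p\<close> cannot form a cycle; the third one must close the triangle.\<close>

lemma three_cycles_iff:
  assumes ij: "i \<in> {1..N}" "j \<in> {1..N}" "T i = {p, q}" "T j = {p, r}" "cyc p q r"
  shows "(k, i, j) \<in> three_cycles Q \<longleftrightarrow> k \<in> {1..N} \<and> T k = {q, r}"
proof
  assume "(k, i, j) \<in> three_cycles Q"
  then have ki: "(k, i) \<in> arrows Q" and jk: "(j, k) \<in> arrows Q" by (auto simp: three_cycles_def)
  from ki obtain s t v where 1: "k \<in> {1..N}" "T k = {s, t}" "T i = {s, v}" "cyc s t v"
    by (rule arrow_endpoints)
  from jk obtain s' t' v' where 2: "T j = {s', t'}" "T k = {s', v'}" "cyc s' t' v'"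
    by (rule arrow_endpoints)
  have "{s, v} = {p, q}" "{s', t'} = {p, r}" "{s, t} = {s', v'}" using 1 2 ij by simp_all
  then have "{s, t} = {q, r}"
    using 1(4) 2(3) ij(5) unfolding doubleton_eq_iff cyc_arith by argo
  then show "k \<in> {1..N} \<and> T k = {q, r}" using 1 by simp
next
  assume k: "k \<in> {1..N} \<and> T k = {q, r}"
  have e: "{p, q} \<in> edges N T" "{p, r} \<in> edges N T" "{q, r} \<in> edges N T"
    using T_edge[of i] T_edge[of j] T_edge[of k] ij k by simp_all
  have "arr (edges N T) {q, r} {q, p}" using e(2) ij(5) by (intro arrI) (auto simp: insert_commute intro: cyc_rotate)
  moreover have "arr (edges N T) {r, p} {r, q}" using e(1) ij(5) by (intro arrI) (auto intro: cyc_rotate)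
  moreover have "arr (edges N T) {p, q} {p, r}" using e ij(5) by (intro arrI)
  ultimately show "(k, i, j) \<in> three_cycles Q"
    using ij k by (simp add: three_cycles_def arrows_iff insert_commute)
qed

text \<open>The variable of the third side of the triangle carrying the arrow, or 1 if that side
  belongs to the polygon.\<close>

definition opposite :: "nat \<times> nat \<Rightarrow> ratfun" where
  "opposite = (\<lambda>(i, j). \<Prod>k\<in>{1..N}. if (k, i, j) \<in> three_cycles Q then xvar k else 1)"

lemma opposite_eq:
  assumes ij: "i \<in> {1..N}" "j \<in> {1..N}" "T i = {p, q}" "T j = {p, r}" "cyc p q r" "{q, r} \<in> edges N T"
  shows "opposite (i, j) = f q r"
proof -
  have "opposite (i, j) = (\<Prod>k\<in>{1..N}. if T k = {q, r} then xvar k else 1)"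
    unfolding opposite_def by (auto intro!: prod.cong simp: three_cycles_iff[OF ij(1-5)])
  also have "\<dots> = f q r"
    by (rule prod_edge[OF T _ _ ij(6)]) (use ptolemy_initial[OF f] ptolemy_side[OF f] in auto)
  finally show ?thesis .
qed

definition out_weight :: "nat \<Rightarrow> ratfun" where
  "out_weight l = (\<Prod>j\<in>{1..N}. xvar j ^ Q l j)"

definition in_weight :: "nat \<Rightarrow> ratfun" where
  "in_weight l = (\<Prod>j\<in>{1..N}. xvar j ^ Q j l)"

lemma out_weight_eq: "quad N T k a w b z \<Longrightarrow> out_weight k = f w b * f z a"
  unfolding out_weight_def
  by (rule prod_quiver_out[OF T]) (use ptolemy_initial[OF f] ptolemy_side[OF f] in auto)

lemma in_weight_eq: "quad N T k a w b z \<Longrightarrow> in_weight k = f a w * f b z"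
  unfolding in_weight_def
  by (rule prod_quiver_in[OF T]) (use ptolemy_initial[OF f] ptolemy_side[OF f] in auto)

text \<open>Along the arc from \<open>a\<close> to \<open>b\<close>, the endpoint \<open>c\<close>
  comes before \<open>q\<close> and \<open>d\<close> after it.\<close>

definition sep :: "nat \<Rightarrow> nat \<Rightarrow> nat \<Rightarrow> nat \<Rightarrow> nat \<Rightarrow> bool" where
  "sep a b q c d \<longleftrightarrow> cyc c q d \<and> (c = a \<or> cyc a c q) \<and> (d = b \<or> cyc q d b)"

text \<open>The diagonals that separate \<open>q\<close> from the side \<open>{a, b}\<close>, including \<open>{a, b}\<close> itself.\<close>

definition separating :: "nat \<Rightarrow> nat \<Rightarrow> nat \<Rightarrow> nat set" where
  "separating a b q = {j \<in> {1..N}. \<exists>c d. T j = {c, d} \<and> sep a b q c d}"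

lemma separating_iff:
  assumes "T j = {s, t}"
  shows "j \<in> separating a b q \<longleftrightarrow> j \<in> {1..N} \<and> (sep a b q s t \<or> sep a b q t s)"
  unfolding separating_def using assms by (auto simp: doubleton_eq_iff)

lemma finite_separating: "finite (separating a b q)"
  by (simp add: separating_def)

lemma separatingE:
  assumes "j \<in> separating a b q"
  obtains c d where "j \<in> {1..N}" "T j = {c, d}" "sep a b q c d"
  using assms unfolding separating_def by blast

lemma separating_apex:
  assumes q: "quad N T i a w b z"
  shows "separating a b w = {i}"
proof (intro equalityI subsetI)
  fix l assume "l \<in> separating a b w"
  then obtain c d where l: "l \<in> {1..N}" "T l = {c, d}" "sep a b w c d" by (rule separatingE)
  have "\<not> crosses {c, d} {a, w}" "\<not> crosses {c, d} {w, b}"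
    using not_crosses_T[OF l(1)] l(2) q by (auto simp: quad_def)
  moreover have "cyc a w b" using q by (simp add: quad_def)
  ultimately have "c = a \<and> d = b" using l(3)[unfolded sep_def] unfolding cyc_arith by argo
  then show "l \<in> {i}" using l q T_inj[of l i] by (simp add: quad_def)
next
  fix l assume "l \<in> {i}"
  moreover have "sep a b w a b" using q by (simp add: quad_def sep_def)
  ultimately show "l \<in> separating a b w" using q separating_iff[of i a b] by (auto simp: quad_def)
qed

text \<open>Any separating diagonal other than \<open>T i\<close> cannot cross the sides of the
  triangle over \<open>{a, b}\<close>, so it lies beyond the side that faces \<open>q\<close>. Both
  choices of that side are needed in the induction along the triangles.\<close>

lemma separating_step:
  assumes q: "quad N T i a w b z" and side: "a' = a \<and> b' = w \<or> a' = w \<and> b' = b"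
    and j: "j \<in> {1..N}" "T j = {a', b'}" and c: "cyc a' q b'"
  shows "separating a b q = insert i (separating a' b' q)" "i \<notin> separating a' b' q" "j \<in> separating a' b' q"
proof -
  have i: "i \<in> {1..N}" "T i = {a, b}" and aw: "cyc a w b" using q by (simp_all add: quad_def)
  show "separating a b q = insert i (separating a' b' q)"
  proof (intro equalityI subsetI)
    fix l assume "l \<in> separating a b q"
    then obtain c' d where l: "l \<in> {1..N}" "T l = {c', d}" "sep a b q c' d" by (rule separatingE)
    have "\<not> crosses {c', d} {a, w}" "\<not> crosses {c', d} {w, b}"
      using not_crosses_T[OF l(1)] l(2) q by (auto simp: quad_def)
    then have "c' = a \<and> d = b \<or> sep a' b' q c' d"
      using c aw side l(3) unfolding sep_def cyc_arith by argo
    then show "l \<in> insert i (separating a' b' q)"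
    proof
      assume "c' = a \<and> d = b"
      then show ?thesis using T_inj[OF l(1) i(1)] l i by simp
    next
      assume "sep a' b' q c' d"
      then show ?thesis using l separating_iff by blast
    qed
  next
    fix l assume l: "l \<in> insert i (separating a' b' q)"
    show "l \<in> separating a b q"
    proof (cases "l = i")
      case True
      have "sep a b q a b" using c aw side unfolding sep_def cyc_arith by argo
      then show ?thesis using True separating_iff[OF i(2)] i by blast
    next
      case False
      then have "l \<in> separating a' b' q" using l by blast
      then obtain c' d where l: "l \<in> {1..N}" "T l = {c', d}" "sep a' b' q c' d" by (rule separatingE)
      then have "sep a b q c' d" using c aw side unfolding sep_def cyc_arith by argo
      then show ?thesis using l separating_iff by blast
    qed
  qed
  have "\<not> sep a' b' q a b" "\<not> sep a' b' q b a" using c aw side unfolding sep_def cyc_arith by argo+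
  then show "i \<notin> separating a' b' q" using separating_iff[OF i(2)] by blast
  have "sep a' b' q a' b'" using c by (simp add: sep_def)
  then show "j \<in> separating a' b' q" using separating_iff[OF j(2)] j by blast
qed

text \<open>Diagonals separating \<open>q\<close> from \<open>{a, w}\<close> end neither at
  \<open>b\<close> nor at \<open>z\<close>, so of the four sides around \<open>T i\<close> only
  \<open>{a, w}\<close> can be among them.\<close>

lemma arrows_separating_left:
  assumes q: "quad N T i a w b z" and j: "j \<in> {1..N}" "T j = {a, w}" and c: "cyc a q w"
    and l: "l \<in> separating a w q"
  shows "(l, i) \<in> arrows Q \<longleftrightarrow> l = j" "(i, l) \<notin> arrows Q"
proof -
  have i: "i \<in> {1..N}" "T i = {a, b}" and aw: "cyc a w b" and z: "cyc b z a" using q by (simp_all add: quad_def)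
  from l obtain c' d where l: "l \<in> {1..N}" "T l = {c', d}" "sep a w q c' d" by (rule separatingE)
  have "\<not> (c' = b \<or> d = b)" "\<not> (c' = z \<or> d = z)"
    using l(3) c aw z unfolding sep_def cyc_arith by argo+
  then have n: "T l \<noteq> {b, z}" "T l \<noteq> {w, b}" "T l \<noteq> {z, a}"
    unfolding l(2) doubleton_eq_iff by simp_all
  have "(l, i) \<in> arrows Q \<longleftrightarrow> T l = {a, w}"
    using arr_in_iff[OF T q T_edge[OF l(1)]] n l(1) i by (simp add: arrows_iff)
  then show "(l, i) \<in> arrows Q \<longleftrightarrow> l = j"
    using T_inj[OF l(1) j(1)] j(2) by simp
  show "(i, l) \<notin> arrows Q"
    using arr_out_iff[OF T q T_edge[OF l(1)]] n l(1) i by (simp add: arrows_iff)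
qed

lemma arrows_separating_right:
  assumes q: "quad N T i a w b z" and j: "j \<in> {1..N}" "T j = {w, b}" and c: "cyc w q b"
    and l: "l \<in> separating w b q"
  shows "(i, l) \<in> arrows Q \<longleftrightarrow> l = j" "(l, i) \<notin> arrows Q"
proof -
  have i: "i \<in> {1..N}" "T i = {a, b}" and aw: "cyc a w b" and z: "cyc b z a" using q by (simp_all add: quad_def)
  from l obtain c' d where l: "l \<in> {1..N}" "T l = {c', d}" "sep w b q c' d" by (rule separatingE)
  have "\<not> (c' = a \<or> d = a)" "\<not> (c' = z \<or> d = z)"
    using l(3) c aw z unfolding sep_def cyc_arith by argo+
  then have n: "T l \<noteq> {b, z}" "T l \<noteq> {a, w}" "T l \<noteq> {z, a}"
    unfolding l(2) doubleton_eq_iff by simp_all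
  have "(i, l) \<in> arrows Q \<longleftrightarrow> T l = {w, b}"
    using arr_out_iff[OF T q T_edge[OF l(1)]] n l(1) i by (simp add: arrows_iff)
  then show "(i, l) \<in> arrows Q \<longleftrightarrow> l = j"
    using T_inj[OF l(1) j(1)] j(2) by simp
  show "(l, i) \<notin> arrows Q"
    using arr_in_iff[OF T q T_edge[OF l(1)]] n l(1) i by (simp add: arrows_iff)
qed

definition denom :: "nat set \<Rightarrow> ratfun" where
  "denom Y = (\<Prod>e\<in>arrows Q \<inter> Y \<times> Y. opposite e)"

text \<open>The common factor in \<open>rooted_sum_separating\<close>. The variable of the root is
  omitted, since it must enter only once when two sides are glued.\<close>

definition scale :: "nat set \<Rightarrow> nat \<Rightarrow> ratfun" where
  "scale Y i = (\<Prod>l\<in>Y - {i}. xvar l) * denom Y"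

abbreviation "W \<equiv> upset_weight out_weight in_weight"

abbreviation "G \<equiv> rooted_sum (arrows Q) out_weight in_weight"

lemma denom_insert:
  assumes "i \<notin> Y" "j \<in> Y" "e = (j, i) \<or> e = (i, j)"
    and "\<And>l. l \<in> Y \<Longrightarrow> (l, i) \<in> arrows Q \<longleftrightarrow> (l, i) = e" "\<And>l. l \<in> Y \<Longrightarrow> (i, l) \<in> arrows Q \<longleftrightarrow> (i, l) = e"
  shows "denom (insert i Y) = opposite e * denom Y"
proof -
  have "arrows Q \<inter> insert i Y \<times> insert i Y = insert e (arrows Q \<inter> Y \<times> Y)"
    using assms arrows_irrefl by blast
  moreover have "e \<notin> Y \<times> Y" using assms(1,3) by auto
  ultimately show ?thesis using finite_arrows by (simp add: denom_def)
qed

text \<open>The algebra shared by the two recursive cases of \<open>rooted_sum_separating\<close>;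
  one of them supplies the first two hypotheses in exchanged order.\<close>

lemma ptolemy_step:
  fixes K :: ratfun
  assumes "A * g0 = p * K" "B * g1 = r * K" "u * y = p * v + r * t"
  shows "u * ((A * v) * g0) = p * (u * (v * K))" "v * ((A * v) * g0 + (B * t) * g1) = y * (u * (v * K))"
proof -
  have "u * ((A * v) * g0) = u * v * (A * g0)" by (simp add: algebra_simps)
  then show "u * ((A * v) * g0) = p * (u * (v * K))" unfolding assms(1) by (simp add: algebra_simps)
  have "v * ((A * v) * g0 + (B * t) * g1) = v * (v * (A * g0) + t * (B * g1))" by (simp add: algebra_simps)
  also have "\<dots> = v * K * (u * y)" unfolding assms by (simp add: algebra_simps)
  finally show "v * ((A * v) * g0 + (B * t) * g1) = y * (u * (v * K))" by (simp add: algebra_simps)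
qed

text \<open>\<open>f a w\<close> and \<open>f w b\<close> are the parts of
  \<open>in_weight i\<close> and \<open>out_weight i\<close> on the side of \<open>q\<close>.
  Weighted with them, the sums without and with \<open>i\<close> expand the Ptolemy values of
  \<open>a, q\<close> and \<open>q, b\<close> up to the same factor. Both identities are carried
  together because the Ptolemy relation of the next triangle mixes them.\<close>

lemma rooted_sum_separating:
  assumes q: "q < N + 3"
  shows "quad N T i a w b z \<Longrightarrow> cyc a q b \<Longrightarrow>
    f a w * G (separating a b q) i False =
      f a q * scale (separating a b q) i \<and>
    f w b * G (separating a b q) i True =
      f q b * scale (separating a b q) i"
proof (induction "card {v. v < N + 3 \<and> cyc a v b}" arbitrary: i a b w z rule: less_induct)
  case less
  note qd = less.prems(1)
  have i: "i \<in> {1..N}" "T i = {a, b}" and aw: "cyc a w b" and e: "{a, w} \<in> edges N T" "{w, b} \<in> edges N T"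
    using qd by (simp_all add: quad_def)
  have wN: "w < N + 3" using edges_bound[OF T e(2)] by simp
  note sym = ptolemy_sym[OF f]
  consider "q = w" | "cyc a q w" | "cyc w q b"
    using aw less.prems(2) unfolding cyc_arith by argo
  then show ?case
  proof cases
    case 1
    have Y: "separating a b q = {i}" using separating_apex[OF qd] 1 by simp
    have "{\<theta> \<in> upsets (arrows Q) {i}. (i \<in> \<theta>) = False} = {{}}"
      "{\<theta> \<in> upsets (arrows Q) {i}. (i \<in> \<theta>) = True} = {{i}}"
      by (auto simp: upsets_def)
    moreover have "arrows Q \<inter> {i} \<times> {i} = {}" using arrows_irrefl by blast
    ultimately show ?thesis
      unfolding Y using 1 by (simp add: rooted_sum_def upset_weight_def denom_def scale_def)
  next
    case 2
    have "\<not> polygon_side N {a, w}" using 2 q edges_bound[OF T e(2)] aw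
      unfolding polygon_side_iff by (auto simp: cyc_def)
    then obtain j where j: "j \<in> {1..N}" "T j = {a, w}" using e(1) unfolding edges_def by force
    obtain w2 z2 where qj: "quad N T j a w2 w z2" using exists_quad[OF T j] .
    have "{w, b} \<in> edges N T" "{b, a} \<in> edges N T" "cyc w b a"
      using qd T_edge[OF i(1)] i(2) by (auto simp: quad_def insert_commute intro: cyc_rotate)
    \<comment> \<open>The triangle behind \<open>T j\<close>, seen from \<open>q\<close>, is the one
      over \<open>{a, b}\<close> that was just passed.\<close>
    then have "z2 = b"
      using qj by (intro apex_unique[OF T, of w z2 a b]) (auto simp: quad_def)
    note qj = qj[unfolded this]
    let ?Y = "separating a w q"
    note sp = separating_step[OF qd disjI1[OF conjI[OF HOL.refl HOL.refl]] j 2] arrows_separating_left[OF qd j 2]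
    note fin = finite_separating[of a w q]
    have IH: "f a w2 * G ?Y j False = f a q * scale ?Y j"
      "f w2 w * G ?Y j True = f q w * scale ?Y j"
      using less.hyps[OF cyc_interval_less(1)[OF aw wN] qj 2] by auto
    have h: "in_weight j = f a w2 * f w b" "out_weight j = f w2 w * f b a"
      using in_weight_eq[OF qj] out_weight_eq[OF qj] by simp_all
    have G0: "G (insert i ?Y) i False = in_weight j * G ?Y j False"
      and G1: "G (insert i ?Y) i True = in_weight j * G ?Y j False + out_weight j * G ?Y j True"
      using rooted_sum_insert[OF fin sp(2,3) sp(4,5)] by simp_all
    have "opposite (j, i) = f w b"
      using opposite_eq[OF j(1) i(1) j(2) i(2) aw e(2)] .
    then have d: "denom (insert i ?Y) = f w b * denom ?Y"
      using denom_insert[OF sp(2,3), of "(j, i)"] sp(2,4,5) by auto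
    have "xvar j = f a w" using ptolemy_initial[OF f j] by simp
    then have p: "(\<Prod>l\<in>insert i ?Y - {i}. xvar l) = f a w * (\<Prod>l\<in>?Y - {j}. xvar l)"
      using sp(2,3) prod.remove[OF fin sp(3), of xvar] by simp
    have pt: "f a w * f q b = f a q * f w b + f q w * f a b"
      by (rule ptolemy_relation[OF f 2 aw])
    have K: "scale (insert i ?Y) i = f a w * (f w b * scale ?Y j)"
      unfolding scale_def p d by (simp add: algebra_simps)
    show ?thesis unfolding sp(1) K G0 G1 h sym[of b a] using ptolemy_step[OF IH pt] by blast
  next
    case 3
    have "\<not> polygon_side N {w, b}" using 3 q edges_bound[OF T e(1)] aw
      unfolding polygon_side_iff by (auto simp: cyc_def)
    then obtain j where j: "j \<in> {1..N}" "T j = {w, b}" using e(2) unfolding edges_def by force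
    obtain w2 z2 where qj: "quad N T j w w2 b z2" using exists_quad[OF T j] .
    have "{b, a} \<in> edges N T" "{a, w} \<in> edges N T" "cyc b a w"
      using qd T_edge[OF i(1)] i(2) by (auto simp: quad_def insert_commute intro: cyc_rotate)
    then have "z2 = a"
      using qj by (intro apex_unique[OF T, of b z2 w a]) (auto simp: quad_def)
    note qj = qj[unfolded this]
    let ?Y = "separating w b q"
    note sp = separating_step[OF qd disjI2[OF conjI[OF HOL.refl HOL.refl]] j 3] arrows_separating_right[OF qd j 3]
    note fin = finite_separating[of w b q]
    have IH: "f w w2 * G ?Y j False = f w q * scale ?Y j"
      "f w2 b * G ?Y j True = f q b * scale ?Y j"
      using less.hyps[OF cyc_interval_less(2)[OF aw wN] qj 3] by auto
    have h: "in_weight j = f w w2 * f b a" "out_weight j = f w2 b * f a w"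
      using in_weight_eq[OF qj] out_weight_eq[OF qj] by simp_all
    have G1: "G (insert i ?Y) i True = out_weight j * G ?Y j True"
      and G0: "G (insert i ?Y) i False = in_weight j * G ?Y j False + out_weight j * G ?Y j True"
      using rooted_sum_insert'[OF fin sp(2,3) sp(4,5)] by simp_all
    have "opposite (i, j) = f a w"
      by (rule opposite_eq[OF i(1) j(1), of b]) (use i j e aw in \<open>auto simp: insert_commute intro: cyc_rotate\<close>)
    then have d: "denom (insert i ?Y) = f a w * denom ?Y"
      using denom_insert[OF sp(2,3), of "(i, j)"] sp(2,4,5) by auto
    have "xvar j = f w b" using ptolemy_initial[OF f j] by simp
    then have p: "(\<Prod>l\<in>insert i ?Y - {i}. xvar l) = f w b * (\<Prod>l\<in>?Y - {j}. xvar l)"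
      using sp(2,3) prod.remove[OF fin sp(3), of xvar] by simp
    have "cyc a w q" "cyc a q b" using 3 aw unfolding cyc_arith by argo+
    then have "f a q * f w b = f a w * f q b + f w q * f a b"
      by (rule ptolemy_relation[OF f])
    then have pt: "f w b * f a q = f q b * f a w + f w q * f a b" by (simp add: algebra_simps)
    have K: "scale (insert i ?Y) i = f w b * (f a w * scale ?Y j)"
      unfolding scale_def p d by (simp add: algebra_simps)
    show ?thesis unfolding sp(1) K G0 G1 h sym[of b a] add.commute[of "f w w2 * f a b * G ?Y j False"]
      using ptolemy_step[OF IH(2,1) pt] by blast
  qed
qed

section \<open>Gluing the two sides of a crossed diagonal\<close>

definition crossed :: "nat set \<Rightarrow> nat set" where
  "crossed D = {i \<in> {1..N}. crosses D (T i)}"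

text \<open>No \<open>T l\<close> crosses \<open>{a, b}\<close>, so each crossed one lies on the
  side of \<open>q\<close> or of \<open>p\<close>. An arrow between the sides would come from a
  triangle whose third side crosses \<open>{a, b}\<close>.\<close>

lemma crossed_split:
  assumes i: "i \<in> {1..N}" "T i = {a, b}" and c: "cyc a q b" "cyc b p a"
  shows "crossed {p, q} = separating a b q \<union> separating b a p"
    "separating a b q \<inter> separating b a p = {i}"
    "\<And>l m. l \<in> separating a b q - {i} \<Longrightarrow> m \<in> separating b a p - {i} \<Longrightarrow>
       (l, m) \<notin> arrows Q \<and> (m, l) \<notin> arrows Q"
proof -
  have e: "{a, b} \<in> edges N T" using T_edge[OF i(1)] i(2) by simp
  have split: "crosses {p, q} {s, t} \<longleftrightarrow>
      (sep a b q s t \<or> sep a b q t s) \<or> (sep b a p s t \<or> sep b a p t s)"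
    if "\<not> crosses {s, t} {a, b}" for s t
    using that c unfolding sep_def cyc_arith by argo
  show "crossed {p, q} = separating a b q \<union> separating b a p"
  proof (rule set_eqI)
    fix l
    show "l \<in> crossed {p, q} \<longleftrightarrow> l \<in> separating a b q \<union> separating b a p"
    proof (cases "l \<in> {1..N}")
      case True
      then have "diagonal N (T l)" using T by (simp add: triangulation_def)
      then obtain s t where st: "T l = {s, t}" by (rule diagonalE)
      have "\<not> crosses {s, t} {a, b}" using not_crosses_T[OF True e] st by simp
      then show ?thesis
        unfolding Un_iff separating_iff[OF st] crossed_def using True st split by simp
    next
      case False
      then show ?thesis unfolding crossed_def separating_def by blast
    qed
  qed
  show "separating a b q \<inter> separating b a p = {i}"
  proof (intro equalityI subsetI)
    fix l assume l: "l \<in> separating a b q \<inter> separating b a p"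
    then have "l \<in> separating a b q" by blast
    then obtain s t where st: "l \<in> {1..N}" "T l = {s, t}" "sep a b q s t" by (rule separatingE)
    have "sep b a p s t \<or> sep b a p t s" using l separating_iff[OF st(2)] by blast
    then have "s = a \<and> t = b" using st(3) c unfolding sep_def cyc_arith by argo
    then show "l \<in> {i}" using T_inj[OF st(1) i(1)] st i by simp
  next
    fix l assume "l \<in> {i}"
    then show "l \<in> separating a b q \<inter> separating b a p"
      using i c separating_iff[OF i(2)] by (auto simp: sep_def)
  qed
  fix l m assume l: "l \<in> separating a b q - {i}" and m: "m \<in> separating b a p - {i}"
  have lm: "l \<in> {1..N}" "m \<in> {1..N}" "T l \<noteq> {a, b}" "T m \<noteq> {a, b}"
    using l m T_inj[of l i] T_inj[of m i] i by (auto simp: separating_def)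
  have no: False if "T l = {s, t}" "T m = {s, v}" "{t, v} \<in> edges N T" for s t v
  proof -
    have 1: "sep a b q s t \<or> sep a b q t s" "sep b a p s v \<or> sep b a p v s"
      using l m that separating_iff by blast+
    have 2: "\<not> crosses {t, v} {a, b}" by (rule edges_not_crosses[OF T that(3) e])
    have 3: "\<not> (s = a \<and> t = b)" "\<not> (s = b \<and> t = a)" "\<not> (s = a \<and> v = b)" "\<not> (s = b \<and> v = a)"
      using lm that by (auto simp: insert_commute)
    show False using 1 2 3 c unfolding sep_def cyc_arith by argo
  qed
  show "(l, m) \<notin> arrows Q \<and> (m, l) \<notin> arrows Q"
  proof (intro conjI notI)
    assume "(l, m) \<in> arrows Q"
    then show False by (rule arrow_endpoints) (rule no)
  next
    assume "(m, l) \<in> arrows Q"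
    then obtain s v t where "T m = {s, v}" "T l = {s, t}" "{v, t} \<in> edges N T"
      by (rule arrow_endpoints)
    then show False using no[of s t v] by (simp add: insert_commute)
  qed
qed

text \<open>If nothing were crossed, adding \<open>D\<close> would give one noncrossing chord more
  than \<open>card_chords_le\<close> permits.\<close>

lemma exists_crossed:
  assumes D: "diagonal N D" "D \<notin> T ` {1..N}"
  shows "crossed D \<noteq> {}"
proof
  assume none: "crossed D = {}"
  obtain a b where ab: "D = {a, b}" "a + 2 \<le> b" "b < N + 3" "(a, b) \<noteq> (0, N + 2)"
    using diagonalE[OF D(1)] .
  let ?P = "pairs N T"
  have not_in: "(a, b) \<notin> ?P" using ab D by (auto simp: pairs_def)
  have nc: "\<not> crosses {a, b} {c, d} \<and> \<not> crosses {c, d} {a, b} \<or> (c, d) = (0, N + 2)" if "(c, d) \<in> ?P" for c d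
  proof -
    have "{c, d} \<in> T ` {1..N} \<or> (c, d) = (0, N + 2)" using that by (auto simp: pairs_def)
    then show ?thesis
    proof
      assume "{c, d} \<in> T ` {1..N}"
      then obtain i where i: "i \<in> {1..N}" "{c, d} = T i" by (rule imageE)
      have "i \<notin> crossed D" using none by simp
      then have "\<not> crosses {a, b} {c, d}" using i ab(1) by (simp add: crossed_def)
      then show ?thesis using crosses_sym by simp
    qed simp
  qed
  have lt: "c < d" if "(c, d) \<in> ?P" for c d using that by (auto simp: pairs_def)
  have "noncrossing (insert (a, b) ?P)"
    unfolding noncrossing_def
  proof (intro allI impI notI)
    fix s t c d
    assume st: "(s, t) \<in> insert (a, b) ?P" and cd: "(c, d) \<in> insert (a, b) ?P"
      and o: "s < c \<and> c < t \<and> t < d"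
    show False
    proof (cases "(s, t) \<in> ?P \<and> (c, d) \<in> ?P")
      case True
      then show False using noncrossing_pairs[OF T] o unfolding noncrossing_def by blast
    next
      case False
      then consider "(s, t) = (a, b)" "(c, d) = (a, b)" | "(s, t) = (a, b)" "(c, d) \<in> ?P"
        | "(s, t) \<in> ?P" "(c, d) = (a, b)" using st cd by blast
      then show False
      proof cases
        case 2
        then show False using nc[of c d] lt[of c d] o ab crosses_ordered[of a b c d] by auto
      next
        case 3
        then show False using nc[of s t] lt[of s t] o ab crosses_ordered[of s t a b] by auto
      qed (use o in auto)
    qed
  qed
  then have "card (chords (insert (a, b) ?P) 0 (N + 2)) \<le> N + 1"
    using card_chords_le[of _ 0 "N + 2"] by simp
  moreover have "chords (insert (a, b) ?P) 0 (N + 2) = insert (a, b) (chords ?P 0 (N + 2))"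
    using ab by (auto simp: chords_def)
  moreover have "(a, b) \<notin> chords ?P 0 (N + 2)" using not_in by (auto simp: chords_def)
  ultimately show False using full_pairs[OF T] by (simp add: full_def)
qed

text \<open>Any crossed \<open>T i\<close> can be the root. The sides of its quadrilateral multiply
  to its in- and out-weight, and the Ptolemy relation of \<open>a, q, b, p\<close> combines the two
  halves to \<open>f p q\<close>.\<close>

lemma diagonal_expansion:
  assumes D: "diagonal N {p, q}" "{p, q} \<notin> T ` {1..N}"
  shows "(\<Sum>\<theta>\<in>upsets (arrows Q) (crossed {p, q}). upset_weight out_weight in_weight (crossed {p, q}) \<theta>) =
    f p q * (\<Prod>l\<in>crossed {p, q}. xvar l) * denom (crossed {p, q})"
proof -
  obtain i where i: "i \<in> {1..N}" "crosses {p, q} (T i)"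
    using exists_crossed[OF D] by (auto simp: crossed_def)
  have "diagonal N (T i)" using T i by (simp add: triangulation_def)
  then obtain a' b' where ab': "T i = {a', b'}" by (rule diagonalE)
  have "crosses {p, q} {a', b'}" using i ab' by simp
  then have "cyc a' q b' \<and> cyc b' p a' \<or> cyc b' q a' \<and> cyc a' p b'"
    unfolding cyc_arith by argo
  then obtain a b where ab: "T i = {a, b}" and c: "cyc a q b" "cyc b p a"
    using ab' by (metis insert_commute)
  have pq: "p < N + 3" "q < N + 3" using D(1) by (auto simp: diagonal_def)
  obtain w z where qd: "quad N T i a w b z" using exists_quad[OF T i(1) ab] .
  \<comment> \<open>For the side of \<open>p\<close> the same quadrilateral is read after half a
    turn.\<close>
  then have qd': "quad N T i b z a w" by (auto simp: quad_def insert_commute)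
  define Y1 Y2 where "Y1 = separating a b q" and "Y2 = separating b a p"
  note cs = crossed_split[OF i(1) ab c, folded Y1_def Y2_def]
  have fin: "finite Y1" "finite Y2" by (simp_all add: Y1_def Y2_def finite_separating)
  have iY: "i \<in> Y1" "i \<in> Y2" using cs(2) by auto
  define K1 K2 where "K1 = scale Y1 i" and "K2 = scale Y2 i"
  have 1: "f a w * G Y1 i False = f a q * K1" "f w b * G Y1 i True = f q b * K1"
    using rooted_sum_separating[OF pq(2) qd c(1)] by (simp_all add: Y1_def K1_def)
  have 2: "f b z * G Y2 i False = f b p * K2" "f z a * G Y2 i True = f p a * K2"
    using rooted_sum_separating[OF pq(1) qd' c(2)] by (simp_all add: Y2_def K2_def)
  have "cyc a b p" using c(2) cyc_rotate by blast
  then have pt: "f a b * f q p = f a q * f b p + f q b * f a p"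
    by (rule ptolemy_relation[OF f c(1)])
  have d: "denom (Y1 \<union> Y2) = denom Y1 * denom Y2"
  proof -
    have "arrows Q \<inter> (Y1 \<union> Y2) \<times> (Y1 \<union> Y2) = (arrows Q \<inter> Y1 \<times> Y1) \<union> (arrows Q \<inter> Y2 \<times> Y2)"
      using cs(3) iY by blast
    moreover have "(arrows Q \<inter> Y1 \<times> Y1) \<inter> (arrows Q \<inter> Y2 \<times> Y2) = {}"
    proof (rule equals0I)
      fix e assume e: "e \<in> (arrows Q \<inter> Y1 \<times> Y1) \<inter> (arrows Q \<inter> Y2 \<times> Y2)"
      obtain j k where jk: "e = (j, k)" by (cases e)
      then have "j \<in> Y1 \<inter> Y2" "k \<in> Y1 \<inter> Y2" using e by auto
      then have "j = i" "k = i" unfolding cs(2) by simp_all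
      then show False using e jk arrows_irrefl by simp
    qed
    ultimately show ?thesis unfolding denom_def using finite_arrows
      by (simp add: prod.union_disjoint)
  qed
  have "(\<Prod>l\<in>Y1 \<union> Y2. xvar l) = xvar i * ((\<Prod>l\<in>Y1 - {i}. xvar l) * (\<Prod>l\<in>Y2 - {i}. xvar l))"
  proof -
    have "(\<Prod>l\<in>Y1 \<union> Y2. xvar l) = xvar i * (\<Prod>l\<in>Y1 \<union> Y2 - {i}. xvar l)"
      using fin iY by (intro prod.remove) auto
    also have "Y1 \<union> Y2 - {i} = (Y1 - {i}) \<union> (Y2 - {i})" by blast
    also have "(\<Prod>l\<in>(Y1 - {i}) \<union> (Y2 - {i}). xvar l) = (\<Prod>l\<in>Y1 - {i}. xvar l) * (\<Prod>l\<in>Y2 - {i}. xvar l)"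
      using fin cs(2) by (intro prod.union_disjoint) auto
    finally show ?thesis .
  qed
  moreover have "xvar i = f a b" using ptolemy_initial[OF f i(1) ab] by simp
  ultimately have p: "(\<Prod>l\<in>Y1 \<union> Y2. xvar l) * denom (Y1 \<union> Y2) = f a b * (K1 * K2)"
    unfolding d K1_def K2_def scale_def by (simp add: algebra_simps)
  have un: "G (Y1 \<union> Y2) i s = G Y1 i s * G Y2 i s" for s
    by (rule rooted_sum_union[OF fin cs(2)]) (rule cs(3))
  have "(\<Sum>\<theta>\<in>upsets (arrows Q) (Y1 \<union> Y2). upset_weight out_weight in_weight (Y1 \<union> Y2) \<theta>) =
      in_weight i * G (Y1 \<union> Y2) i False + out_weight i * G (Y1 \<union> Y2) i True"
    using fin iY by (intro sum_upsets) auto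
  also have "\<dots> = (f a w * G Y1 i False) * (f b z * G Y2 i False) + (f w b * G Y1 i True) * (f z a * G Y2 i True)"
    unfolding un in_weight_eq[OF qd] out_weight_eq[OF qd]
    by (simp add: algebra_simps)
  also have "\<dots> = K1 * K2 * (f a q * f b p + f q b * f a p)"
    unfolding 1 2 ptolemy_sym[OF f, of p a] by (simp add: algebra_simps)
  also have "\<dots> = f p q * ((\<Prod>l\<in>Y1 \<union> Y2. xvar l) * denom (Y1 \<union> Y2))"
    unfolding pt[symmetric] p ptolemy_sym[OF f, of q p] by (simp add: algebra_simps)
  finally show ?thesis unfolding cs(1) by (simp add: mult.assoc)
qed

end

section \<open>Ranks and globally compatible collections\<close>

lemma prod_sum_PiE:
  fixes F :: "'a \<Rightarrow> 'b \<Rightarrow> 'c :: comm_semiring_1"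
  assumes "finite M"
  shows "(\<Prod>m\<in>M. \<Sum>x\<in>B m. F m x) = (\<Sum>\<tau>\<in>Pi\<^sub>E M B. \<Prod>m\<in>M. F m (\<tau> m))"
  using assms
proof (induction M)
  case empty
  then show ?case by simp
next
  case (insert m M)
  have bij: "bij_betw (\<lambda>(x, \<tau>). \<tau>(m := x)) (B m \<times> Pi\<^sub>E M B) (Pi\<^sub>E (insert m M) B)"
  proof (rule bij_betw_imageI)
    show "inj_on (\<lambda>(x, \<tau>). \<tau>(m := x)) (B m \<times> Pi\<^sub>E M B)"
      using inj_combinator[OF insert.hyps(2), of B] .
    show "(\<lambda>(x, \<tau>). \<tau>(m := x)) ` (B m \<times> Pi\<^sub>E M B) = Pi\<^sub>E (insert m M) B"
      by (simp add: PiE_insert_eq)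
  qed
  have "(\<Sum>\<tau>\<in>Pi\<^sub>E (insert m M) B. \<Prod>k\<in>insert m M. F k (\<tau> k)) =
    (\<Sum>(x, \<tau>)\<in>B m \<times> Pi\<^sub>E M B. \<Prod>k\<in>insert m M. F k ((\<tau>(m := x)) k))"
    by (subst sum.reindex_bij_betw[OF bij, symmetric]) (auto intro!: sum.cong)
  also have "\<dots> = (\<Sum>(x, \<tau>)\<in>B m \<times> Pi\<^sub>E M B. F m x * (\<Prod>k\<in>M. F k (\<tau> k)))"
  proof (intro sum.cong HOL.refl, clarify)
    fix x \<tau>
    have "(\<Prod>k\<in>M. F k ((\<tau>(m := x)) k)) = (\<Prod>k\<in>M. F k (\<tau> k))"
      using insert.hyps by (intro prod.cong) auto
    then show "(\<Prod>k\<in>insert m M. F k ((\<tau>(m := x)) k)) = F m x * (\<Prod>k\<in>M. F k (\<tau> k))"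
      using insert.hyps by simp
  qed
  also have "\<dots> = (\<Sum>x\<in>B m. F m x) * (\<Sum>\<tau>\<in>Pi\<^sub>E M B. \<Prod>k\<in>M. F k (\<tau> k))"
    unfolding sum_product sum.cartesian_product by simp
  finally show ?case using insert by simp
qed

section \<open>Positions with respect to a numerical key\<close>

definition rank :: "('m \<Rightarrow> nat) \<Rightarrow> 'm set \<Rightarrow> 'm \<Rightarrow> nat" where
  "rank \<kappa> S m = card {x \<in> S. \<kappa> x \<le> \<kappa> m}"

lemma rank_bij_betw:
  assumes "finite S" "inj_on \<kappa> S"
  shows "bij_betw (rank \<kappa> S) S {1..card S}"
proof -
  have less: "rank \<kappa> S x < rank \<kappa> S y" if "x \<in> S" "y \<in> S" "\<kappa> x < \<kappa> y" for x y
    unfolding rank_def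
  proof (rule psubset_card_mono)
    have "y \<in> {z \<in> S. \<kappa> z \<le> \<kappa> y}" "y \<notin> {z \<in> S. \<kappa> z \<le> \<kappa> x}" using that by auto
    moreover have "{z \<in> S. \<kappa> z \<le> \<kappa> x} \<subseteq> {z \<in> S. \<kappa> z \<le> \<kappa> y}" using that by auto
    ultimately show "{z \<in> S. \<kappa> z \<le> \<kappa> x} \<subset> {z \<in> S. \<kappa> z \<le> \<kappa> y}" by blast
  qed (use assms in simp)
  have inj: "inj_on (rank \<kappa> S) S"
  proof (rule inj_onI)
    fix x y assume xy: "x \<in> S" "y \<in> S" "rank \<kappa> S x = rank \<kappa> S y"
    then have "\<kappa> x = \<kappa> y" using less[of x y] less[of y x] by linarith
    then show "x = y" using assms(2) xy by (simp add: inj_on_eq_iff)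
  qed
  have sub: "rank \<kappa> S ` S \<subseteq> {1..card S}"
  proof
    fix r assume "r \<in> rank \<kappa> S ` S"
    then obtain x where x: "x \<in> S" "r = rank \<kappa> S x" by blast
    have "rank \<kappa> S x \<le> card S" unfolding rank_def using assms(1) by (intro card_mono) auto
    moreover have "card {x} \<le> rank \<kappa> S x" unfolding rank_def using assms(1) x by (intro card_mono) auto
    ultimately show "r \<in> {1..card S}" using x by simp
  qed
  moreover have "card (rank \<kappa> S ` S) = card {1..card S}" using card_image[OF inj] by simp
  ultimately have "rank \<kappa> S ` S = {1..card S}" by (intro card_subset_eq) simp_all
  with inj show ?thesis by (simp add: bij_betw_def)
qed

text \<open>A constant sum of keys means opposite orders, so \<open>m\<close> is counted from both
  ends; it counts itself both times, hence the 1.\<close>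

lemma rank_reverse:
  assumes "finite S" "inj_on \<kappa> S" "m \<in> S" "\<And>x. x \<in> S \<Longrightarrow> \<kappa> x + \<kappa>' x = c"
  shows "rank \<kappa> S m + rank \<kappa>' S m = card S + 1"
proof -
  have "{x \<in> S. \<kappa>' x \<le> \<kappa>' m} = {x \<in> S. \<kappa> m \<le> \<kappa> x}"
  proof (intro Collect_cong conj_cong HOL.refl)
    fix x assume "x \<in> S"
    then show "\<kappa>' x \<le> \<kappa>' m \<longleftrightarrow> \<kappa> m \<le> \<kappa> x" using assms(4)[of x] assms(4)[of m] assms(3) by linarith
  qed
  moreover have "card {x \<in> S. \<kappa> x \<le> \<kappa> m} + card {x \<in> S. \<kappa> m \<le> \<kappa> x} =
      card ({x \<in> S. \<kappa> x \<le> \<kappa> m} \<union> {x \<in> S. \<kappa> m \<le> \<kappa> x}) + card ({x \<in> S. \<kappa> x \<le> \<kappa> m} \<inter> {x \<in> S. \<kappa> m \<le> \<kappa> x})"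
    using assms(1) by (intro card_Un_Int) auto
  moreover have "{x \<in> S. \<kappa> x \<le> \<kappa> m} \<union> {x \<in> S. \<kappa> m \<le> \<kappa> x} = S" by auto
  moreover have "{x \<in> S. \<kappa> x \<le> \<kappa> m} \<inter> {x \<in> S. \<kappa> m \<le> \<kappa> x} = {m}"
    using assms(2,3) by (auto simp: inj_on_eq_iff)
  ultimately show ?thesis by (simp add: rank_def)
qed

lemma rank_initial_segment:
  assumes "finite S" "B \<subseteq> S" and seg: "\<And>x y. x \<in> B \<Longrightarrow> y \<in> S - B \<Longrightarrow> \<kappa> x < \<kappa> y" and m: "m \<in> S"
  shows "rank \<kappa> S m \<le> card B \<longleftrightarrow> m \<in> B" "m \<in> B \<Longrightarrow> rank \<kappa> S m = rank \<kappa> B m"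
proof -
  have fB: "finite B" using assms finite_subset by blast
  have eq: "{x \<in> S. \<kappa> x \<le> \<kappa> m} = {x \<in> B. \<kappa> x \<le> \<kappa> m}" if "m \<in> B"
    using seg[OF that] assms(2) by (auto simp: not_le[symmetric])
  then show "m \<in> B \<Longrightarrow> rank \<kappa> S m = rank \<kappa> B m" by (simp add: rank_def)
  show "rank \<kappa> S m \<le> card B \<longleftrightarrow> m \<in> B"
  proof
    assume "m \<in> B"
    then show "rank \<kappa> S m \<le> card B" unfolding rank_def eq[OF \<open>m \<in> B\<close>] using fB by (intro card_mono) auto
  next
    assume le: "rank \<kappa> S m \<le> card B"
    show "m \<in> B"
    proof (rule ccontr)
      assume "m \<notin> B"
      then have "\<kappa> x < \<kappa> m" if "x \<in> B" for x using seg that m by blast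
      then have "insert m B \<subseteq> {x \<in> S. \<kappa> x \<le> \<kappa> m}" using assms(2) m by (auto simp: less_imp_le)
      then have "card (insert m B) \<le> rank \<kappa> S m" unfolding rank_def using assms(1) by (intro card_mono) auto
      then show False using le \<open>m \<notin> B\<close> fB by simp
    qed
  qed
qed

lemma image_Collect_eq:
  assumes "f ` A = B" "T \<subseteq> B" "\<And>m. m \<in> A \<Longrightarrow> P m \<longleftrightarrow> f m \<in> T"
  shows "f ` {m \<in> A. P m} = T"
proof (intro equalityI subsetI)
  fix x assume x: "x \<in> T"
  then obtain m where "m \<in> A" "x = f m" using assms(1,2) by blast
  then show "x \<in> f ` {m \<in> A. P m}" using x assms(3) by blast
qed (use assms(3) in blast)

lemma mem_image_Collect:
  assumes "inj_on f A" "m \<in> A"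
  shows "f m \<in> f ` {x \<in> A. P x} \<longleftrightarrow> P m"
proof
  assume "f m \<in> f ` {x \<in> A. P x}"
  then obtain x where x: "x \<in> A" "P x" "f m = f x" by blast
  then show "P m" using inj_onD[OF assms(1) x(3) assms(2) x(1)] by simp
qed (use assms in blast)

text \<open>
  The crossings \<open>m \<in> A i\<close> of the \<open>i\<close>-th diagonal are numbered by \<open>ru i j\<close> and \<open>rv k i\<close> for the
  arrows \<open>i \<rightarrow> j\<close> and \<open>k \<rightarrow> i\<close>.  A collection amounts to a choice, for each \<open>m\<close>, of the set \<open>\<tau> m\<close>
  of those \<open>i\<close> for which the edge numbered by \<open>m\<close> lies in \<open>S\<^sub>1\<close>.
\<close>

locale crossing_labels =
  fixes R :: quiver and a :: "nat \<Rightarrow> nat" and M :: "'m set" and X :: "'m \<Rightarrow> nat set"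
    and ru rv :: "nat \<Rightarrow> nat \<Rightarrow> 'm \<Rightarrow> nat" and A :: "nat \<Rightarrow> 'm set"
  assumes A_eq: "A i = {m \<in> M. i \<in> X m}"
    and ru_bij: "(i, j) \<in> arrows R \<Longrightarrow> bij_betw (ru i j) (A i) {1..a i}"
    and rv_bij: "(i, j) \<in> arrows R \<Longrightarrow> bij_betw (rv i j) (A j) {1..a j}"
    and turn: "(k, i) \<in> arrows R \<Longrightarrow> (i, j) \<in> arrows R \<Longrightarrow> (j, k) \<in> arrows R \<Longrightarrow> m \<in> A i \<Longrightarrow>
      ru i j m + rv k i m = a i + 1"
    and straight: "(k, i) \<in> arrows R \<Longrightarrow> (i, j) \<in> arrows R \<Longrightarrow> (j, k) \<notin> arrows R \<Longrightarrow> m \<in> A i \<Longrightarrow>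
      ru i j m = rv k i m"
    and sigma_le: "(i, j, k) \<in> three_cycles R \<Longrightarrow> sigma_nat (a i) (a j) (a k) \<le> a i"
    and ru_le_sigma: "(i, j, k) \<in> three_cycles R \<Longrightarrow> m \<in> A i \<Longrightarrow>
      ru i j m \<le> sigma_nat (a i) (a j) (a k) \<longleftrightarrow> m \<in> A j"
    and ru_eq_rv: "(i, j) \<in> arrows R \<Longrightarrow> m \<in> A i \<Longrightarrow> m \<in> A j \<Longrightarrow> ru i j m = rv i j m"
    and in_cycle: "(i, j) \<in> arrows R \<Longrightarrow> \<exists>k. (i, j, k) \<in> three_cycles R"
    and has_out: "m \<in> M \<Longrightarrow> i \<in> X m \<Longrightarrow> \<exists>j. (i, j) \<in> arrows R"
begin

abbreviation "choices \<equiv> \<Pi>\<^sub>E m\<in>M. upsets (arrows R) (X m)"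

abbreviation "collections \<equiv> \<Pi>\<^sub>E (i, j)\<in>arrows R. Pow (H_edges (a i) (a j)) \<times> Pow (V_edges (a i) (a j))"

definition U :: "nat \<Rightarrow> nat \<Rightarrow> 'm \<Rightarrow> nat" where
  "U i j m = u_edge (a i) (a j) (ru i j m)"

definition V :: "nat \<Rightarrow> nat \<Rightarrow> 'm \<Rightarrow> nat" where
  "V i j m = v_edge (a i) (a j) (rv i j m)"

lemma U_bij: "(i, j) \<in> arrows R \<Longrightarrow> bij_betw (U i j) (A i) (H_edges (a i) (a j))"
  using bij_betw_trans[OF ru_bij bij_betw_u_edge, of i j "a j"] by (simp add: U_def[abs_def] o_def)

lemma V_bij: "(i, j) \<in> arrows R \<Longrightarrow> bij_betw (V i j) (A j) (V_edges (a i) (a j))"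
  using bij_betw_trans[OF rv_bij bij_betw_v_edge, of i j "a i"] by (simp add: V_def[abs_def] o_def)

text \<open>Both gluing rules compare two labels of one crossing. In a 3-cycle the labels run in
  opposite directions, which \<open>a i + 1 - r\<close> undoes.\<close>

lemma glue_iff:
  assumes ar: "(k, i) \<in> arrows R" "(i, j) \<in> arrows R"
  shows "(if (j, k) \<in> arrows R
      then \<forall>r\<in>{1..a i}. v_edge (a k) (a i) r \<in> S2 \<longleftrightarrow> u_edge (a i) (a j) (a i + 1 - r) \<notin> S1
      else \<forall>r\<in>{1..a i}. v_edge (a k) (a i) r \<in> S2 \<longleftrightarrow> u_edge (a i) (a j) r \<notin> S1) \<longleftrightarrow>
    (\<forall>m\<in>A i. V k i m \<in> S2 \<longleftrightarrow> U i j m \<notin> S1)"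
proof -
  have surj: "rv k i ` A i = {1..a i}" using bij_betw_imp_surj_on[OF rv_bij[OF ar(1)]] .
  have *: "(\<forall>r\<in>{1..a i}. P r) \<longleftrightarrow> (\<forall>m\<in>A i. P (rv k i m))" for P
    unfolding surj[symmetric] by simp
  show ?thesis
  proof (cases "(j, k) \<in> arrows R")
    case True
    have "a i + 1 - rv k i m = ru i j m" if "m \<in> A i" for m
      using turn[OF ar True that] by linarith
    then show ?thesis unfolding * using True by (simp add: U_def V_def)
  next
    case False
    then show ?thesis unfolding * using straight[OF ar False] by (simp add: U_def V_def)
  qed
qed

text \<open>The labels up to \<open>\<sigma>\<close> belong to the crossings common to
  \<open>i\<close> and \<open>j\<close>, and each of these has the same label on both kinds of
  edges.\<close>

lemma s_compatible_iff:
  assumes c: "(i, j, k) \<in> three_cycles R"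
  shows "s_compatible (a i) (a j) (sigma_nat (a i) (a j) (a k)) S1 S2 \<longleftrightarrow>
    (\<forall>m\<in>A i \<inter> A j. U i j m \<notin> S1 \<or> V i j m \<notin> S2)"
proof -
  have ar: "(i, j) \<in> arrows R" using c by (auto simp: three_cycles_def)
  let ?s = "sigma_nat (a i) (a j) (a k)"
  have img: "ru i j ` (A i \<inter> A j) = {1..?s}"
  proof (intro equalityI subsetI)
    fix r assume "r \<in> ru i j ` (A i \<inter> A j)"
    then obtain m where m: "m \<in> A i" "m \<in> A j" "r = ru i j m" by blast
    then have "r \<in> {1..a i}" using bij_betwE[OF ru_bij[OF ar]] by blast
    then show "r \<in> {1..?s}" using ru_le_sigma[OF c m(1)] m by simp
  next
    fix r assume r: "r \<in> {1..?s}"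
    then have "r \<in> {1..a i}" using sigma_le[OF c] by simp
    then have "r \<in> ru i j ` A i" using bij_betw_imp_surj_on[OF ru_bij[OF ar]] by simp
    then obtain m where m: "m \<in> A i" "r = ru i j m" by blast
    then show "r \<in> ru i j ` (A i \<inter> A j)" using ru_le_sigma[OF c m(1)] r by simp
  qed
  have "s_compatible (a i) (a j) ?s S1 S2 \<longleftrightarrow>
      (\<forall>m\<in>A i \<inter> A j. u_edge (a i) (a j) (ru i j m) \<notin> S1 \<or> v_edge (a i) (a j) (ru i j m) \<notin> S2)"
    unfolding s_compatible_def img[symmetric] by simp
  then show ?thesis using ru_eq_rv[OF ar] by (simp add: U_def V_def)
qed

text \<open>Phrased by crossings, the case distinction disappears: the gluing rules agree, and as
  every arrow lies in a 3-cycle, compatibility becomes a condition at each arrow.\<close>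

lemma GCC_iff:
  "S \<in> GCC R a \<longleftrightarrow>
     S \<in> collections \<and>
     (\<forall>k i j. (k, i) \<in> arrows R \<longrightarrow> (i, j) \<in> arrows R \<longrightarrow>
       (\<forall>m\<in>A i. V k i m \<in> snd (S (k, i)) \<longleftrightarrow> U i j m \<notin> fst (S (i, j)))) \<and>
     (\<forall>i j. (i, j) \<in> arrows R \<longrightarrow>
       (\<forall>m\<in>A i \<inter> A j. U i j m \<notin> fst (S (i, j)) \<or> V i j m \<notin> snd (S (i, j))))"
  (is "_ \<longleftrightarrow> ?P \<and> ?glue \<and> ?compat")
proof -
  have if_conj: "(if b then c \<and> g else h) \<longleftrightarrow> (if b then g else h) \<and> (b \<longrightarrow> c)" for b c g h
    by auto
  have compat: "?compat \<longleftrightarrow> (\<forall>i j k. (k, i) \<in> arrows R \<and> (i, j) \<in> arrows R \<and> (j, k) \<in> arrows R \<longrightarrow>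
      s_compatible (a i) (a j) (sigma_nat (a i) (a j) (a k)) (fst (S (i, j))) (snd (S (i, j))))"
    (is "_ \<longleftrightarrow> ?compat'")
  proof
    assume *: ?compat
    show ?compat'
    proof (intro allI impI)
      fix i j k assume "(k, i) \<in> arrows R \<and> (i, j) \<in> arrows R \<and> (j, k) \<in> arrows R"
      then have k: "(i, j, k) \<in> three_cycles R" and ar: "(i, j) \<in> arrows R" by (simp_all add: three_cycles_def)
      show "s_compatible (a i) (a j) (sigma_nat (a i) (a j) (a k)) (fst (S (i, j))) (snd (S (i, j)))"
        unfolding s_compatible_iff[OF k] using * ar by blast
    qed
  next
    assume *: ?compat'
    show ?compat
    proof (intro allI impI)
      fix i j assume "(i, j) \<in> arrows R"
      then obtain k where k: "(i, j, k) \<in> three_cycles R" using in_cycle by blast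
      then have "s_compatible (a i) (a j) (sigma_nat (a i) (a j) (a k)) (fst (S (i, j))) (snd (S (i, j)))"
        using * by (auto simp: three_cycles_def)
      then show "\<forall>m\<in>A i \<inter> A j. U i j m \<notin> fst (S (i, j)) \<or> V i j m \<notin> snd (S (i, j))"
        unfolding s_compatible_iff[OF k] .
    qed
  qed
  have "S \<in> GCC R a \<longleftrightarrow> ?P \<and> (\<forall>k i j. (k, i) \<in> arrows R \<longrightarrow> (i, j) \<in> arrows R \<longrightarrow>
      (if (j, k) \<in> arrows R
        then \<forall>r\<in>{1..a i}. v_edge (a k) (a i) r \<in> snd (S (k, i)) \<longleftrightarrow> u_edge (a i) (a j) (a i + 1 - r) \<notin> fst (S (i, j))
        else \<forall>r\<in>{1..a i}. v_edge (a k) (a i) r \<in> snd (S (k, i)) \<longleftrightarrow> u_edge (a i) (a j) r \<notin> fst (S (i, j)))) \<and> ?compat'"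
    (is "_ \<longleftrightarrow> ?P \<and> ?glue' \<and> ?compat'")
    unfolding GCC_def mem_Collect_eq if_conj by (rule conj_cong[OF HOL.refl]) blast
  also have "?glue' \<longleftrightarrow> ?glue" using glue_iff by simp
  finally show ?thesis unfolding compat .
qed

section \<open>Collections as choices of closed sets\<close>

definition to_GCC :: "('m \<Rightarrow> nat set) \<Rightarrow> edge_collection" where
  "to_GCC \<tau> = restrict (\<lambda>(i, j). (U i j ` {m \<in> A i. i \<in> \<tau> m}, V i j ` {m \<in> A j. j \<notin> \<tau> m})) (arrows R)"

definition of_GCC :: "edge_collection \<Rightarrow> 'm \<Rightarrow> nat set" where
  "of_GCC S = restrict (\<lambda>m. {i \<in> X m. \<exists>j. (i, j) \<in> arrows R \<and> U i j m \<in> fst (S (i, j))}) M"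

lemma to_GCC_apply:
  "(i, j) \<in> arrows R \<Longrightarrow>
     to_GCC \<tau> (i, j) = (U i j ` {m \<in> A i. i \<in> \<tau> m}, V i j ` {m \<in> A j. j \<notin> \<tau> m})"
  by (simp add: to_GCC_def)

lemma U_mem_to_GCC:
  assumes "(i, j) \<in> arrows R" "m \<in> A i"
  shows "U i j m \<in> fst (to_GCC \<tau> (i, j)) \<longleftrightarrow> i \<in> \<tau> m"
  unfolding to_GCC_apply[OF assms(1)] fst_conv
  by (rule mem_image_Collect[OF bij_betw_imp_inj_on[OF U_bij[OF assms(1)]] assms(2)])

lemma V_mem_to_GCC:
  assumes "(i, j) \<in> arrows R" "m \<in> A j"
  shows "V i j m \<in> snd (to_GCC \<tau> (i, j)) \<longleftrightarrow> j \<notin> \<tau> m"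
  unfolding to_GCC_apply[OF assms(1)] snd_conv
  by (rule mem_image_Collect[OF bij_betw_imp_inj_on[OF V_bij[OF assms(1)]] assms(2)])

lemma card_to_GCC:
  assumes "(i, j) \<in> arrows R"
  shows "card (fst (to_GCC \<tau> (i, j))) = card {m \<in> A i. i \<in> \<tau> m}"
    "card (snd (to_GCC \<tau> (i, j))) = card {m \<in> A j. j \<notin> \<tau> m}"
proof -
  have "inj_on (U i j) {m \<in> A i. i \<in> \<tau> m}"
    by (rule inj_on_subset[OF bij_betw_imp_inj_on[OF U_bij[OF assms]]]) auto
  then show "card (fst (to_GCC \<tau> (i, j))) = card {m \<in> A i. i \<in> \<tau> m}"
    unfolding to_GCC_apply[OF assms] fst_conv by (rule card_image)
  have "inj_on (V i j) {m \<in> A j. j \<notin> \<tau> m}"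
    by (rule inj_on_subset[OF bij_betw_imp_inj_on[OF V_bij[OF assms]]]) auto
  then show "card (snd (to_GCC \<tau> (i, j))) = card {m \<in> A j. j \<notin> \<tau> m}"
    unfolding to_GCC_apply[OF assms] snd_conv by (rule card_image)
qed

text \<open>Gluing holds because \<open>U\<close> records membership and \<open>V\<close> its
  negation. Compatibility at \<open>i \<rightarrow> j\<close> excludes
  \<open>i \<in> \<tau> m\<close> with \<open>j \<notin> \<tau> m\<close>, which is the closedness
  of \<open>\<tau> m\<close>.\<close>

lemma to_GCC_in_GCC:
  assumes "\<tau> \<in> choices"
  shows "to_GCC \<tau> \<in> GCC R a"
  unfolding GCC_iff
proof (intro conjI allI impI ballI)
  show "to_GCC \<tau> \<in> collections"
    unfolding to_GCC_def
  proof (rule restrict_PiE_iff[THEN iffD2], rule ballI, clarsimp)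
    fix i j assume ar: "(i, j) \<in> arrows R"
    show "U i j ` {m \<in> A i. i \<in> \<tau> m} \<subseteq> H_edges (a i) (a j) \<and> V i j ` {m \<in> A j. j \<notin> \<tau> m} \<subseteq> V_edges (a i) (a j)"
      using bij_betw_imp_surj_on[OF U_bij[OF ar]] bij_betw_imp_surj_on[OF V_bij[OF ar]] by blast
  qed
  fix k i j m
  assume "(k, i) \<in> arrows R" "(i, j) \<in> arrows R" "m \<in> A i"
  then show "V k i m \<in> snd (to_GCC \<tau> (k, i)) \<longleftrightarrow> U i j m \<notin> fst (to_GCC \<tau> (i, j))"
    by (simp add: U_mem_to_GCC V_mem_to_GCC)
next
  fix i j m assume ar: "(i, j) \<in> arrows R" and m: "m \<in> A i \<inter> A j"
  then have "m \<in> M" "i \<in> X m" "j \<in> X m" by (auto simp: A_eq)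
  moreover from this have "\<tau> m \<in> upsets (arrows R) (X m)" using assms by blast
  ultimately have "i \<in> \<tau> m \<longrightarrow> j \<in> \<tau> m" using upsetsD ar by blast
  then show "U i j m \<notin> fst (to_GCC \<tau> (i, j)) \<or> V i j m \<notin> snd (to_GCC \<tau> (i, j))"
    using U_mem_to_GCC[OF ar] V_mem_to_GCC[OF ar] m by auto
qed

text \<open>The choice of the outgoing arrow is immaterial: all of them are glued to the same
  incoming arrow \<open>k \<rightarrow> i\<close>, so they agree on \<open>m\<close>.\<close>

lemma of_GCC_mem:
  assumes S: "S \<in> GCC R a" and m: "m \<in> A i" and ar: "(i, j) \<in> arrows R"
  shows "i \<in> of_GCC S m \<longleftrightarrow> U i j m \<in> fst (S (i, j))"
proof -
  have M: "m \<in> M" "i \<in> X m" using m by (auto simp: A_eq)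
  obtain k where "(i, j, k) \<in> three_cycles R" using in_cycle[OF ar] by blast
  then have ki: "(k, i) \<in> arrows R" by (auto simp: three_cycles_def)
  have "U i j' m \<in> fst (S (i, j')) \<longleftrightarrow> V k i m \<notin> snd (S (k, i))" if "(i, j') \<in> arrows R" for j'
    using S that ki m unfolding GCC_iff by blast
  then have "U i j' m \<in> fst (S (i, j')) \<longleftrightarrow> U i j m \<in> fst (S (i, j))" if "(i, j') \<in> arrows R" for j'
    using that ar by blast
  moreover have "i \<in> of_GCC S m \<longleftrightarrow> (\<exists>j. (i, j) \<in> arrows R \<and> U i j m \<in> fst (S (i, j)))"
    using M by (simp add: of_GCC_def)
  ultimately show ?thesis using ar by blast
qed

lemma of_GCC_not_mem:
  assumes S: "S \<in> GCC R a" and m: "m \<in> A j" and ar: "(i, j) \<in> arrows R"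
  shows "j \<notin> of_GCC S m \<longleftrightarrow> V i j m \<in> snd (S (i, j))"
proof -
  obtain l where "(i, j, l) \<in> three_cycles R" using in_cycle[OF ar] by blast
  then have jl: "(j, l) \<in> arrows R" by (auto simp: three_cycles_def)
  have "V i j m \<in> snd (S (i, j)) \<longleftrightarrow> U j l m \<notin> fst (S (j, l))"
    using S ar jl m unfolding GCC_iff by blast
  then show ?thesis using of_GCC_mem[OF S m jl] by simp
qed

lemma of_GCC_in_PiE:
  assumes S: "S \<in> GCC R a"
  shows "of_GCC S \<in> choices"
proof (rule PiE_I)
  fix m assume m: "m \<in> M"
  show "of_GCC S m \<in> upsets (arrows R) (X m)"
  proof (rule upsetsI)
    show "of_GCC S m \<subseteq> X m" using m by (auto simp: of_GCC_def)
    fix i j assume ij: "(i, j) \<in> arrows R" "i \<in> X m" "j \<in> X m" "i \<in> of_GCC S m"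
    then have A: "m \<in> A i" "m \<in> A j" using m by (auto simp: A_eq)
    then have "U i j m \<in> fst (S (i, j))" using of_GCC_mem[OF S A(1) ij(1)] ij(4) by simp
    then have "V i j m \<notin> snd (S (i, j))" using S A ij(1) unfolding GCC_iff by blast
    then show "j \<in> of_GCC S m" using of_GCC_not_mem[OF S A(2) ij(1)] by simp
  qed
qed (simp add: of_GCC_def)

lemma bij_betw_to_GCC: "bij_betw to_GCC choices (GCC R a)"
proof (rule bij_betw_byWitness[where f' = of_GCC])
  show "to_GCC ` choices \<subseteq> GCC R a" using to_GCC_in_GCC by blast
  show "of_GCC ` GCC R a \<subseteq> choices" using of_GCC_in_PiE by blast
  show "\<forall>\<tau>\<in>choices. of_GCC (to_GCC \<tau>) = \<tau>"
  proof
    fix \<tau> assume \<tau>: "\<tau> \<in> choices"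
    show "of_GCC (to_GCC \<tau>) = \<tau>"
    proof (rule PiE_ext[OF of_GCC_in_PiE[OF to_GCC_in_GCC[OF \<tau>]] \<tau>])
      fix m assume m: "m \<in> M"
      have "\<tau> m \<in> upsets (arrows R) (X m)" using PiE_mem[OF \<tau> m] .
      then have sub: "\<tau> m \<subseteq> X m" "of_GCC (to_GCC \<tau>) m \<subseteq> X m"
        using m upsets_subset by (simp_all add: of_GCC_def)
      have "i \<in> of_GCC (to_GCC \<tau>) m \<longleftrightarrow> i \<in> \<tau> m" if i: "i \<in> X m" for i
      proof -
        obtain j where ar: "(i, j) \<in> arrows R" using has_out[OF m i] by blast
        have "m \<in> A i" using m i by (simp add: A_eq)
        then show ?thesis using of_GCC_mem[OF to_GCC_in_GCC[OF \<tau>] _ ar] U_mem_to_GCC[OF ar] by simp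
      qed
      then show "of_GCC (to_GCC \<tau>) m = \<tau> m" using sub by blast
    qed
  qed
  show "\<forall>S\<in>GCC R a. to_GCC (of_GCC S) = S"
  proof
    fix S assume S: "S \<in> GCC R a"
    then have SP: "S \<in> collections"
      by (rule GCC_iff[THEN iffD1, THEN conjunct1])
    have "to_GCC (of_GCC S) \<in> GCC R a" by (rule to_GCC_in_GCC[OF of_GCC_in_PiE[OF S]])
    then have TP: "to_GCC (of_GCC S) \<in> collections"
      by (rule GCC_iff[THEN iffD1, THEN conjunct1])
    show "to_GCC (of_GCC S) = S"
    proof (rule PiE_ext[OF TP SP])
      fix e assume e: "e \<in> arrows R"
      obtain i j where ij: "e = (i, j)" by (cases e)
      then have ar: "(i, j) \<in> arrows R" using e by simp
      have "S e \<in> Pow (H_edges (a i) (a j)) \<times> Pow (V_edges (a i) (a j))"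
        using PiE_mem[OF SP e] ij by simp
      then have sub: "fst (S (i, j)) \<subseteq> H_edges (a i) (a j)" "snd (S (i, j)) \<subseteq> V_edges (a i) (a j)"
        using ij by auto
      have "U i j ` {m \<in> A i. i \<in> of_GCC S m} = fst (S (i, j))"
        using image_Collect_eq[OF bij_betw_imp_surj_on[OF U_bij[OF ar]] sub(1) of_GCC_mem[OF S _ ar]] .
      moreover have "V i j ` {m \<in> A j. j \<notin> of_GCC S m} = snd (S (i, j))"
        using image_Collect_eq[OF bij_betw_imp_surj_on[OF V_bij[OF ar]] sub(2) of_GCC_not_mem[OF S _ ar]] .
      ultimately show "to_GCC (of_GCC S) e = S e"
        unfolding ij to_GCC_apply[OF ar] by simp
    qed
  qed
qed

end

text \<open>\<open>n1\<close>, \<open>n2\<close>, \<open>n3\<close> stand for arcs cutting off the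
  corners of a triangle, and \<open>e1\<close>, \<open>e2\<close>, \<open>e3\<close> for arcs
  crossing one side and ending at the opposite corner, which block the arcs around that corner and
  into the others. The three positive parts are then \<open>2 * n1 + e1 + e2\<close>,
  \<open>e1\<close> and \<open>e2\<close>.\<close>

lemma sigma_nat_eq:
  assumes "x = n1 + n3 + e1" "y = n1 + n2 + e2" "z = n2 + n3 + (e3 :: nat)"
    and "e1 > 0 \<longrightarrow> n2 = 0 \<and> e2 = 0 \<and> e3 = 0" "e2 > 0 \<longrightarrow> n3 = 0 \<and> e1 = 0 \<and> e3 = 0"
    and "e3 > 0 \<longrightarrow> n1 = 0 \<and> e1 = 0 \<and> e2 = 0"
  shows "sigma_nat x y z = n1"
proof -
  have eq: "int x + int y - int z = 2 * int n1 + int e1 + int e2 - int e3"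
    "int x - int y - int z = int e1 - int e2 - int e3 - 2 * int n2"
    "int y - int x - int z = int e2 - int e1 - int e3 - 2 * int n3"
    unfolding assms(1-3) by simp_all
  have "pos_part (int x + int y - int z) = 2 * int n1 + int e1 + int e2"
  proof (cases "e3 = 0")
    case False
    then have "n1 = 0" "e1 = 0" "e2 = 0" using assms(6) by blast+
    then show ?thesis unfolding eq by (simp add: pos_part_def)
  qed (simp add: eq pos_part_def)
  moreover have "pos_part (int x - int y - int z) = int e1"
  proof (cases "e1 = 0")
    case False
    then have "n2 = 0" "e2 = 0" "e3 = 0" using assms(4) by blast+
    then show ?thesis unfolding eq by (simp add: pos_part_def)
  qed (simp add: eq pos_part_def)
  moreover have "pos_part (int y - int x - int z) = int e2"
  proof (cases "e2 = 0")
    case False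
    then have "n3 = 0" "e1 = 0" "e3 = 0" using assms(5) by blast+
    then show ?thesis unfolding eq by (simp add: pos_part_def)
  qed (simp add: eq pos_part_def)
  ultimately have "sigma (int x) (int y) (int z) = of_int (int n1)" by (simp add: sigma_def)
  then show ?thesis by (simp only: sigma_nat_def floor_of_int nat_int)
qed

section \<open>The cluster expansion\<close>

abbreviation "gcc_weight R S \<equiv>
  \<Prod>(i, j)\<in>arrows R. xvar i ^ card (snd (S (i, j))) * xvar j ^ card (fst (S (i, j)))"

lemma prod_if_power:
  fixes x :: "'a :: comm_monoid_mult"
  assumes "finite M"
  shows "(\<Prod>m\<in>M. if P m then x else 1) = x ^ card {m \<in> M. P m}"
proof -
  have "(\<Prod>m\<in>M. if P m then x else 1) = (\<Prod>m\<in>{m \<in> M. P m}. x)"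
    by (rule prod.inter_filter[OF assms, symmetric])
  then show ?thesis by simp
qed

context triangulated_polygon
begin

text \<open>Without outgoing arrows there are no incoming ones either, because each would lie in a
  3-cycle. Then all four sides of the quadrilateral around \<open>T i\<close> are polygon sides, the
  polygon has four vertices and \<open>N = 1\<close>.\<close>

lemma has_outgoing_arrow:
  assumes N: "N > 1" and cyc3: "\<forall>(i, j)\<in>arrows Q. \<exists>k. (i, j, k) \<in> three_cycles Q"
    and i: "i \<in> {1..N}"
  shows "\<exists>j. (i, j) \<in> arrows Q"
proof (rule ccontr)
  assume no: "\<nexists>j. (i, j) \<in> arrows Q"
  have no': "(j, i) \<notin> arrows Q" for j
  proof
    assume "(j, i) \<in> arrows Q"
    then obtain k where "(j, i, k) \<in> three_cycles Q" using cyc3 by blast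
    then show False using no by (auto simp: three_cycles_def)
  qed
  have "diagonal N (T i)" using T i by (simp add: triangulation_def)
  then obtain a b where ab: "T i = {a, b}" by (rule diagonalE)
  obtain w z where q: "quad N T i a w b z" using exists_quad[OF T i ab] .
  have nT: "{w, b} \<notin> T ` {1..N}" "{z, a} \<notin> T ` {1..N}"
    using quiver_out[OF T q] no unfolding arrows_def by fastforce+
  have nT': "{a, w} \<notin> T ` {1..N}" "{b, z} \<notin> T ` {1..N}"
    using quiver_in[OF T q] no' unfolding arrows_def by fastforce+
  have sides: "polygon_side N {w, b}" "polygon_side N {z, a}" "polygon_side N {a, w}" "polygon_side N {b, z}"
    using nT nT' q by (auto simp: quad_def edges_def)
  have c: "cyc a w b" "cyc b z a" using q by (auto simp: quad_def)
  have next_vertex: "x = N + 2 \<and> y = 0 \<or> y = x + 1" if "polygon_side N {x, y}" "cyc x y v" "v < N + 3" for x y v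
    using that unfolding polygon_side_iff cyc_def by auto
  have bound: "a < N + 3" "w < N + 3" "b < N + 3" "z < N + 3" using sides by (auto simp: polygon_side_iff)
  have "cyc a w b" "cyc w b z" "cyc b z a" "cyc z a w" using c unfolding cyc_arith by argo+
  then have "a = N + 2 \<and> w = 0 \<or> w = a + 1" "w = N + 2 \<and> b = 0 \<or> b = w + 1"
    "b = N + 2 \<and> z = 0 \<or> z = b + 1" "z = N + 2 \<and> a = 0 \<or> a = z + 1"
    using next_vertex sides bound by blast+
  then show False using N by linarith
qed

section \<open>The order of arcs along a diagonal\<close>

definition span :: "nat \<Rightarrow> nat set \<Rightarrow> nat" where
  "span p D = (if Min D < p \<and> p < Max D then Max D - Min D else N + 3 - (Max D - Min D))"

text \<open>
  Along a diagonal with endpoint \<open>p\<close>, the arcs crossing it appear in the order of increasing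
  \<open>span p\<close>, the number of polygon sides that an arc cuts off together with \<open>p\<close>.  Parallel copies
  \<open>c < L\<close> of one arc are ordered by \<open>c\<close> seen from one side and by \<open>L - 1 - c\<close> seen from the other.
\<close>

definition key :: "nat \<Rightarrow> nat \<Rightarrow> nat set \<times> nat \<Rightarrow> nat" where
  "key L p = (\<lambda>(D, c). L * span p D + (if Min D < p \<and> p < Max D then c else L - 1 - c))"

lemma span_real:
  assumes "b + 2 \<le> e" "e < N + 3"
  shows "(real b < real p \<and> real p < real e \<longrightarrow> real (span p {b, e}) = real e - real b) \<and>
    (\<not> (real b < real p \<and> real p < real e) \<longrightarrow> real (span p {b, e}) = real N + 3 - (real e - real b)) \<and>
    0 \<le> real b \<and> real b < real e \<and> real e < real N + 3"
  using assms by (auto simp: span_def)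

text \<open>\<open>D\<close> separates \<open>p\<close> from \<open>q\<close>, so the sides cut off
  with \<open>p\<close> and those cut off with \<open>q\<close> are together all
  \<open>N + 3\<close> sides.\<close>

lemma span_reverse:
  assumes D: "diagonal N D" and c: "crosses D {p, q}"
  shows "span p D + span q D = N + 3" "Min D < p \<and> p < Max D \<longleftrightarrow> \<not> (Min D < q \<and> q < Max D)"
proof -
  obtain b e where be: "D = {b, e}" "b + 2 \<le> e" "e < N + 3" using D by (rule diagonalE)
  have *: "real b < real p \<and> real p < real e \<longleftrightarrow> \<not> (real b < real q \<and> real q < real e)"
    using c[unfolded be(1)] span_real[OF be(2,3), of p] unfolding cyc_arith by argo
  then have "real (span p D) + real (span q D) = real N + 3"
    using span_real[OF be(2,3), of p] span_real[OF be(2,3), of q] unfolding be(1) by argo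
  then show "span p D + span q D = N + 3" by linarith
  show "Min D < p \<and> p < Max D \<longleftrightarrow> \<not> (Min D < q \<and> q < Max D)"
    using * be by simp
qed

text \<open>Noncrossing arcs that both separate \<open>p\<close> from \<open>q\<close> are nested
  around \<open>p\<close>; nested arcs cutting off equally many sides coincide.\<close>

lemma span_inj:
  assumes D: "diagonal N D" "diagonal N D'" and c: "crosses D {p, q}" "crosses D' {p, q}"
    and nc: "\<not> crosses D D'" and eq: "span p D = span p D'"
  shows "D = D'"
proof -
  obtain b e where be: "D = {b, e}" "b + 2 \<le> e" "e < N + 3" using D(1) by (rule diagonalE)
  obtain b' e' where be': "D' = {b', e'}" "b' + 2 \<le> e'" "e' < N + 3" using D(2) by (rule diagonalE)
  have "b = b' \<and> e = e'"
    using c[unfolded be(1) be'(1)] nc[unfolded be(1) be'(1)] eq[unfolded be(1) be'(1)]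
      span_real[OF be(2,3), of p] span_real[OF be'(2,3), of p]
    unfolding cyc_arith by argo
  then show ?thesis using be be' by simp
qed

text \<open>The arcs are nested around \<open>p\<close>, and \<open>D\<close> is the inner one
  because it also separates \<open>p\<close> from \<open>r\<close>.\<close>

lemma span_less:
  assumes D: "diagonal N D" "diagonal N D'" and c: "crosses D {p, q}" "crosses D {p, r}" "crosses D' {p, q}"
    and nc: "\<not> crosses D' {p, r}" "\<not> crosses D D'"
  shows "span p D < span p D'"
proof -
  obtain b e where be: "D = {b, e}" "b + 2 \<le> e" "e < N + 3" using D(1) by (rule diagonalE)
  obtain b' e' where be': "D' = {b', e'}" "b' + 2 \<le> e'" "e' < N + 3" using D(2) by (rule diagonalE)
  have "real (span p D) < real (span p D')"
    using c[unfolded be(1) be'(1)] nc[unfolded be(1) be'(1)]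
      span_real[OF be(2,3), of p] span_real[OF be'(2,3), of p]
    unfolding cyc_arith be(1) be'(1) by argo
  then show ?thesis by simp
qed

lemma key_less:
  assumes "c < L" "span p D < span p D'"
  shows "key L p (D, c) < key L p (D', c')"
proof -
  have "key L p (D, c) < L * span p D + L" using assms by (auto simp: key_def)
  also have "\<dots> = L * Suc (span p D)" by simp
  also have "\<dots> \<le> L * span p D'" using assms by (intro mult_le_mono2) simp
  also have "\<dots> \<le> key L p (D', c')" by (simp add: key_def)
  finally show ?thesis .
qed

text \<open>The spans add up to \<open>N + 3\<close>. Exactly one of \<open>p\<close>,
  \<open>q\<close> lies between the endpoints of \<open>D\<close>, so the copy offsets are
  \<open>c\<close> and \<open>L - 1 - c\<close>.\<close>

lemma key_reverse:
  assumes "diagonal N D" "crosses D {p, q}" "c < L"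
  shows "key L p (D, c) + key L q (D, c) = L * (N + 3) + (L - 1)"
proof -
  have "L * span p D + L * span q D = L * (N + 3)"
    using span_reverse(1)[OF assms(1,2)] by (metis add_mult_distrib2)
  then show ?thesis using span_reverse(2)[OF assms(1,2)] assms(3) by (auto simp: key_def)
qed

lemma key_inj:
  assumes D: "diagonal N D" "diagonal N D'" and c: "crosses D {p, q}" "crosses D' {p, q}"
    and nc: "\<not> crosses D D'" and L: "c < L" "c' < L" and eq: "key L p (D, c) = key L p (D', c')"
  shows "D = D' \<and> c = c'"
proof -
  have "\<not> span p D < span p D'" "\<not> span p D' < span p D"
    using key_less[OF L(1), of p D D' c'] key_less[OF L(2), of p D' D c] eq by linarith+
  then have "D = D'" using span_inj[OF D c nc] by simp
  then show ?thesis using eq L by (auto simp: key_def split: if_splits)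
qed

section \<open>Weights as products over arrows\<close>

lemma prod_arrows:
  fixes g :: "nat \<Rightarrow> nat \<Rightarrow> ratfun"
  shows "(\<Prod>(i, j)\<in>arrows Q. g i j) = (\<Prod>i\<in>{1..N}. \<Prod>j\<in>{1..N}. if (i, j) \<in> arrows Q then g i j else 1)"
proof -
  have sub: "arrows Q \<subseteq> {1..N} \<times> {1..N}" by (auto simp: arrows_iff)
  have "(\<Prod>(i, j)\<in>{1..N} \<times> {1..N}. if (i, j) \<in> arrows Q then g i j else 1) =
      (\<Prod>(i, j)\<in>arrows Q. if (i, j) \<in> arrows Q then g i j else 1)"
    by (rule prod.mono_neutral_right) (use sub in auto)
  also have "\<dots> = (\<Prod>(i, j)\<in>arrows Q. g i j)" by (rule prod.cong) auto
  finally show ?thesis by (simp add: prod.cartesian_product)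
qed

lemma out_weight_arrows: "l \<in> {1..N} \<Longrightarrow> out_weight l = (\<Prod>j\<in>{1..N}. if (l, j) \<in> arrows Q then xvar j else 1)"
  unfolding out_weight_def by (rule prod.cong) (simp_all add: arrows_iff quiver_of_triangulation_iff[OF T])

lemma in_weight_arrows: "l \<in> {1..N} \<Longrightarrow> in_weight l = (\<Prod>i\<in>{1..N}. if (i, l) \<in> arrows Q then xvar i else 1)"
  unfolding in_weight_def by (rule prod.cong) (simp_all add: arrows_iff quiver_of_triangulation_iff[OF T])

text \<open>An arrow \<open>i \<rightarrow> j\<close> contributes to \<open>out_weight i\<close> and
  to \<open>in_weight j\<close>; grouping by arrows gives the shape of the weight of a globally
  compatible collection.\<close>

lemma upset_weight_arrows:
  assumes "Y \<subseteq> {1..N}"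
  shows "W Y \<theta> =
    (\<Prod>(i, j)\<in>arrows Q. (if j \<in> Y \<and> j \<notin> \<theta> then xvar i else 1) * (if i \<in> Y \<and> i \<in> \<theta> then xvar j else 1))"
proof -
  have if_prod: "(if P then \<Prod>j\<in>B. g j else (1 :: ratfun)) = (\<Prod>j\<in>B. if P then g j else 1)" for P B and g :: "nat \<Rightarrow> ratfun"
    by simp
  have "W Y \<theta> =
      (\<Prod>l\<in>{1..N}. if l \<in> Y then (if l \<in> \<theta> then out_weight l else in_weight l) else 1)"
    unfolding upset_weight_def using assms
    by (intro prod.mono_neutral_cong_left) auto
  also have "\<dots> = (\<Prod>l\<in>{1..N}. (if l \<in> Y \<and> l \<in> \<theta> then out_weight l else 1) *
      (if l \<in> Y \<and> l \<notin> \<theta> then in_weight l else 1))"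
    by (rule prod.cong) auto
  also have "\<dots> = (\<Prod>l\<in>{1..N}. if l \<in> Y \<and> l \<in> \<theta> then out_weight l else 1) *
      (\<Prod>l\<in>{1..N}. if l \<in> Y \<and> l \<notin> \<theta> then in_weight l else 1)"
    by (rule prod.distrib)
  also have "(\<Prod>l\<in>{1..N}. if l \<in> Y \<and> l \<in> \<theta> then out_weight l else 1) =
      (\<Prod>(i, j)\<in>arrows Q. if i \<in> Y \<and> i \<in> \<theta> then xvar j else 1)"
  proof -
    have "(\<Prod>l\<in>{1..N}. if l \<in> Y \<and> l \<in> \<theta> then out_weight l else 1) =
       (\<Prod>l\<in>{1..N}. \<Prod>j\<in>{1..N}. if l \<in> Y \<and> l \<in> \<theta> then (if (l, j) \<in> arrows Q then xvar j else 1) else 1)"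
      by (rule prod.cong) (simp_all only: out_weight_arrows if_prod)
    also have "\<dots> = (\<Prod>l\<in>{1..N}. \<Prod>j\<in>{1..N}. if (l, j) \<in> arrows Q then (if l \<in> Y \<and> l \<in> \<theta> then xvar j else 1) else 1)"
      by (intro prod.cong HOL.refl) auto
    finally show ?thesis unfolding prod_arrows .
  qed
  also have "(\<Prod>l\<in>{1..N}. if l \<in> Y \<and> l \<notin> \<theta> then in_weight l else 1) =
      (\<Prod>(i, j)\<in>arrows Q. if j \<in> Y \<and> j \<notin> \<theta> then xvar i else 1)"
  proof -
    have "(\<Prod>l\<in>{1..N}. if l \<in> Y \<and> l \<notin> \<theta> then in_weight l else 1) =
       (\<Prod>l\<in>{1..N}. \<Prod>i\<in>{1..N}. if l \<in> Y \<and> l \<notin> \<theta> then (if (i, l) \<in> arrows Q then xvar i else 1) else 1)"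
      by (rule prod.cong) (simp_all only: in_weight_arrows if_prod)
    also have "\<dots> = (\<Prod>l\<in>{1..N}. \<Prod>i\<in>{1..N}. if (i, l) \<in> arrows Q then (if l \<in> Y \<and> l \<notin> \<theta> then xvar i else 1) else 1)"
      by (intro prod.cong HOL.refl) auto
    also have "\<dots> = (\<Prod>i\<in>{1..N}. \<Prod>l\<in>{1..N}. if (i, l) \<in> arrows Q then (if l \<in> Y \<and> l \<notin> \<theta> then xvar i else 1) else 1)"
      by (rule prod.swap)
    finally show ?thesis unfolding prod_arrows .
  qed
  finally show ?thesis
    by (simp only: prod.distrib[symmetric] case_prod_unfold mult.commute)
qed

end

section \<open>Noncrossing arcs with multiplicities\<close>

locale arc_collection = triangulated_polygon +
  fixes C :: "nat set set" and d :: "nat set \<Rightarrow> nat" and a :: "nat \<Rightarrow> nat"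
  assumes N: "N > 1" and cyc3: "\<forall>(i, j)\<in>arrows Q. \<exists>k. (i, j, k) \<in> three_cycles Q"
    and C: "finite C" "\<And>D. D \<in> C \<Longrightarrow> diagonal N D" "\<And>D. D \<in> C \<Longrightarrow> d D > 0"
      "\<And>D E. D \<in> C \<Longrightarrow> E \<in> C \<Longrightarrow> \<not> crosses D E"
    and a: "\<And>i. i \<in> {1..N} \<Longrightarrow> int (a i) = (\<Sum>D\<in>C. int (d D) * crossing_number D (T i))"
begin

definition M :: "(nat set \<times> nat) set" where
  "M = Sigma C (\<lambda>D. {..<d D})"

definition A :: "nat \<Rightarrow> (nat set \<times> nat) set" where
  "A i = {m \<in> M. i \<in> crossed (fst m)}"

text \<open>A single bound above all copy indices, so that the keys of different arcs are
  comparable.\<close>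

definition L :: nat where
  "L = Suc (sum d C)"

lemma finite_M: "finite M"
  using C(1) by (simp add: M_def)

lemma finite_A: "finite (A i)"
  using finite_M by (simp add: A_def)

lemma M_D: "m \<in> M \<Longrightarrow> fst m \<in> C" "m \<in> M \<Longrightarrow> snd m < L"
proof -
  show "m \<in> M \<Longrightarrow> fst m \<in> C" by (auto simp: M_def)
  assume "m \<in> M"
  then have "fst m \<in> C" "snd m < d (fst m)" by (auto simp: M_def)
  then show "snd m < L" unfolding L_def using member_le_sum[of "fst m" C d] C(1) by simp
qed

lemma A_D:
  assumes "m \<in> A i"
  shows "m \<in> M" "fst m \<in> C" "diagonal N (fst m)" "snd m < L" "i \<in> {1..N}" "crosses (fst m) (T i)"
  using assms M_D C(2) by (auto simp: A_def crossed_def)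

lemma not_crosses_A: "m \<in> A i \<Longrightarrow> m' \<in> A j \<Longrightarrow> \<not> crosses (fst m) (fst m')"
  using A_D(2) C(4) by blast

lemma A_not_mem: "m \<in> M \<Longrightarrow> j \<in> {1..N} \<Longrightarrow> m \<notin> A j \<Longrightarrow> \<not> crosses (fst m) (T j)"
  by (auto simp: A_def crossed_def)

text \<open>An initial diagonal in the collection is crossed by no member, so its entry of the
  d-vector would be minus its multiplicity, whereas \<open>a\<close> has natural values.\<close>

lemma not_initial:
  assumes "D \<in> C"
  shows "D \<notin> T ` {1..N}"
proof
  assume "D \<in> T ` {1..N}"
  then obtain i where i: "i \<in> {1..N}" "D = T i" by blast
  have "crossing_number E (T i) = (if E = D then -1 else 0)" if "E \<in> C" for E
    using C(4)[OF that assms] i by (simp add: crossing_number_def)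
  then have "int (a i) = (\<Sum>E\<in>C. if E = D then - int (d D) else 0)"
    unfolding a[OF i(1)] by (intro sum.cong) auto
  then have "int (a i) = - int (d D)" using C(1) assms by simp
  then show False using C(3)[OF assms] by simp
qed

lemma card_A: "i \<in> {1..N} \<Longrightarrow> card (A i) = a i"
proof -
  assume i: "i \<in> {1..N}"
  have "A i = Sigma {D \<in> C. crosses D (T i)} (\<lambda>D. {..<d D})"
    using i by (auto simp: A_def M_def crossed_def)
  then have "card (A i) = (\<Sum>D\<in>{D \<in> C. crosses D (T i)}. d D)"
    using C(1) by simp
  also have "\<dots> = (\<Sum>D\<in>C. if crosses D (T i) then d D else 0)"
    by (rule sum.inter_filter[OF C(1)])
  finally have "int (card (A i)) = (\<Sum>D\<in>C. int (if crosses D (T i) then d D else 0))" by simp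
  also have "\<dots> = int (a i)"
    unfolding a[OF i]
  proof (rule sum.cong)
    fix D assume "D \<in> C"
    then have "D \<noteq> T i" using not_initial i by blast
    then show "int (if crosses D (T i) then d D else 0) = int (d D) * crossing_number D (T i)"
      by (simp add: crossing_number_def)
  qed simp
  finally show ?thesis by simp
qed

lemma inj_on_key:
  assumes "i \<in> {1..N}" "T i = {p, q}"
  shows "inj_on (key L p) (A i)"
proof (rule inj_onI)
  fix m m' assume m: "m \<in> A i" "m' \<in> A i" and eq: "key L p m = key L p m'"
  have "fst m = fst m' \<and> snd m = snd m'"
    using key_inj[of "fst m" "fst m'" p q "snd m" L "snd m'"] A_D[OF m(1)] A_D[OF m(2)]
      not_crosses_A[OF m] assms eq by simp
  then show "m = m'" by (simp add: prod_eq_iff)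
qed

text \<open>The endpoint about which the arrow rotates; crossings with either end of the arrow are
  counted from there.\<close>

definition tip :: "nat \<Rightarrow> nat \<Rightarrow> nat" where
  "tip i j = the_elem (T i \<inter> T j)"

lemma tip_eq:
  assumes "T i = {p, q}" "T j = {p, r}" "cyc p q r"
  shows "tip i j = p"
proof -
  have "T i \<inter> T j = {p}" using assms by (auto simp: cyc_def)
  then show ?thesis by (simp add: tip_def)
qed

definition ru :: "nat \<Rightarrow> nat \<Rightarrow> nat set \<times> nat \<Rightarrow> nat" where
  "ru i j = rank (key L (tip i j)) (A i)"

definition rv :: "nat \<Rightarrow> nat \<Rightarrow> nat set \<times> nat \<Rightarrow> nat" where
  "rv i j = rank (key L (tip i j)) (A j)"

text \<open>Arcs crossing both \<open>T i\<close> and \<open>T j\<close> cut off the corner at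
  \<open>p\<close>, so seen from \<open>p\<close> they meet \<open>T i\<close> before all others.
  This is why the labels up to \<open>\<sigma>\<close> are theirs.\<close>

lemma key_initial_segment:
  assumes ij: "i \<in> {1..N}" "j \<in> {1..N}" "T i = {p, q}" "T j = {p, r}"
    and x: "x \<in> A i \<inter> A j" and y: "y \<in> A i - A j"
  shows "key L p x < key L p y"
proof -
  have xi: "x \<in> A i" and xj: "x \<in> A j" and yi: "y \<in> A i" and yj: "y \<notin> A j" using x y by auto
  have "span p (fst x) < span p (fst y)"
    using A_D[OF xi] A_D[OF xj] A_D[OF yi] A_not_mem[OF A_D(1)[OF yi] ij(2) yj] not_crosses_A[OF xi yi]
    unfolding ij(3,4) by (intro span_less[of "fst x" "fst y" p q r]) auto
  then have "key L p (fst x, snd x) < key L p (fst y, snd y)"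
    by (rule key_less[OF A_D(4)[OF xi]])
  then show ?thesis by simp
qed

lemma triangle_triple:
  assumes "i \<in> {1..N}" "j \<in> {1..N}" "k \<in> {1..N}" "T i = {p, q}" "T j = {p, r}" "T k = {q, r}"
  shows "A i \<inter> A j \<inter> A k = {}"
proof (rule equals0I)
  fix m assume m: "m \<in> A i \<inter> A j \<inter> A k"
  then have "diagonal N (fst m)" using A_D(3) by blast
  then obtain x y where xy: "fst m = {x, y}" by (rule diagonalE)
  have "crosses {x, y} {p, q}" "crosses {x, y} {p, r}" "crosses {x, y} {q, r}"
    using m A_D(6) xy assms by (metis IntD1 IntD2)+
  then show False unfolding cyc_arith by argo
qed

text \<open>An arc crossing only \<open>T i\<close> ends at the opposite corner \<open>r\<close>.
  Another arc that crosses \<open>T j\<close> or \<open>T k\<close> but not \<open>T i\<close> would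
  have to cross it.\<close>

lemma triangle_exclusive:
  assumes ijk: "i \<in> {1..N}" "j \<in> {1..N}" "k \<in> {1..N}" "T i = {p, q}" "T j = {p, r}" "T k = {q, r}"
    and neq: "p \<noteq> q" "p \<noteq> r" "q \<noteq> r" and m: "m \<in> A i - A j - A k"
  shows "A j \<inter> A k = {} \<and> A j - A i - A k = {} \<and> A k - A i - A j = {}"
proof -
  have mi: "m \<in> A i" "m \<notin> A j" "m \<notin> A k" using m by auto
  obtain x y where xy: "fst m = {x, y}" using A_D(3)[OF mi(1)] by (rule diagonalE)
  have c: "crosses {x, y} {p, q}" "\<not> crosses {x, y} {p, r}" "\<not> crosses {x, y} {q, r}"
    using A_D(6)[OF mi(1)] A_not_mem[OF A_D(1)[OF mi(1)] ijk(2) mi(2)]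
      A_not_mem[OF A_D(1)[OF mi(1)] ijk(3) mi(3)] ijk xy by simp_all
  have no: "m' \<in> A i" if "m' \<in> A j \<union> A k" for m'
  proof (rule ccontr)
    assume ni: "m' \<notin> A i"
    have D: "diagonal N (fst m')" "m' \<in> M" using that A_D by blast+
    obtain x' y' where xy': "fst m' = {x', y'}" using D(1) by (rule diagonalE)
    have "\<not> crosses {x', y'} {p, q}" using A_not_mem[OF D(2) ijk(1) ni] ijk xy' by simp
    moreover have "crosses {x', y'} {p, r} \<or> crosses {x', y'} {q, r}"
      using that A_D(6) xy' ijk by (metis UnE)
    moreover have "\<not> crosses {x, y} {x', y'}" using that not_crosses_A[OF mi(1)] xy xy' by (metis UnE)
    ultimately show False using c neq unfolding cyc_arith by argo
  qed
  have "A i \<inter> A j \<inter> A k = {}" by (rule triangle_triple[OF ijk])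
  then show ?thesis using no by blast
qed

lemma card_split:
  assumes "\<And>i. finite (B i)" "B i \<inter> B j \<inter> B k = {}"
  shows "card (B i) = card (B i \<inter> B j) + card (B i \<inter> B k) + card (B i - B j - B k)"
proof -
  have "B i = (B i \<inter> B j \<union> B i \<inter> B k) \<union> (B i - B j - B k)" by blast
  then have "card (B i) = card ((B i \<inter> B j \<union> B i \<inter> B k) \<union> (B i - B j - B k))" by (rule arg_cong)
  also have "\<dots> = card (B i \<inter> B j \<union> B i \<inter> B k) + card (B i - B j - B k)"
    using assms(1) by (intro card_Un_disjoint) auto
  also have "card (B i \<inter> B j \<union> B i \<inter> B k) = card (B i \<inter> B j) + card (B i \<inter> B k)"
    using assms by (intro card_Un_disjoint) auto
  finally show ?thesis .
qed

text \<open>The crossings of each side are split into those shared with either other side and those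
  of arcs ending at the opposite corner; \<open>triangle_exclusive\<close> provides the conditions
  of \<open>sigma_nat_eq\<close>.\<close>

lemma sigma_nat_A:
  assumes "(i, j, k) \<in> three_cycles Q"
  shows "sigma_nat (a i) (a j) (a k) = card (A i \<inter> A j)"
proof -
  have ij: "(i, j) \<in> arrows Q" and kij: "(k, i, j) \<in> three_cycles Q"
    using assms by (auto simp: three_cycles_def)
  obtain p q r where *: "i \<in> {1..N}" "j \<in> {1..N}" "T i = {p, q}" "T j = {p, r}" "cyc p q r"
    using ij by (rule arrow_endpoints)
  have k: "k \<in> {1..N}" "T k = {q, r}" using three_cycles_iff[OF *] kij by auto
  have neq: "p \<noteq> q" "p \<noteq> r" "q \<noteq> r" using *(5) by (auto simp: cyc_def)
  have triple: "A i \<inter> A j \<inter> A k = {}" using * k by (intro triangle_triple)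
  define e1 e2 e3 where "e1 = card (A i - A j - A k)" and "e2 = card (A j - A i - A k)"
    and "e3 = card (A k - A i - A j)"
  have e: "e1 > 0 \<longleftrightarrow> A i - A j - A k \<noteq> {}" "e2 > 0 \<longleftrightarrow> A j - A i - A k \<noteq> {}"
      "e3 > 0 \<longleftrightarrow> A k - A i - A j \<noteq> {}"
    using finite_A by (simp_all add: e1_def e2_def e3_def card_gt_0_iff)
  have swap: "T j = {r, p}" "T k = {r, q}" "T i = {q, p}" "T i = {p, q}" "T j = {p, r}" "T k = {q, r}"
    using * k by auto
  show ?thesis
  proof (rule sigma_nat_eq)
    show "a i = card (A i \<inter> A j) + card (A i \<inter> A k) + e1"
      unfolding card_A[OF *(1), symmetric] e1_def by (rule card_split[OF finite_A triple])
    have "A j \<inter> A i \<inter> A k = {}" "A k \<inter> A i \<inter> A j = {}" using triple by auto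
    note tr = card_split[OF finite_A this(1)] card_split[OF finite_A this(2)]
    show "a j = card (A i \<inter> A j) + card (A j \<inter> A k) + e2"
      unfolding card_A[OF *(2), symmetric] e2_def using tr(1) by (simp add: Int_commute)
    show "a k = card (A j \<inter> A k) + card (A i \<inter> A k) + e3"
      unfolding card_A[OF k(1), symmetric] e3_def using tr(2) by (simp add: Int_commute)
    show "e1 > 0 \<longrightarrow> card (A j \<inter> A k) = 0 \<and> e2 = 0 \<and> e3 = 0"
    proof
      assume "e1 > 0"
      then obtain m where "m \<in> A i - A j - A k" using e(1) by blast
      from triangle_exclusive[OF *(1,2) k(1) swap(4,5,6) neq this]
      show "card (A j \<inter> A k) = 0 \<and> e2 = 0 \<and> e3 = 0" using e(2,3) by simp
    qed
    show "e2 > 0 \<longrightarrow> card (A i \<inter> A k) = 0 \<and> e1 = 0 \<and> e3 = 0"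
    proof
      assume "e2 > 0"
      then obtain m where "m \<in> A j - A i - A k" using e(2) by blast
      then have "A i \<inter> A k = {} \<and> A i - A j - A k = {} \<and> A k - A j - A i = {}"
        by (rule triangle_exclusive[OF *(2,1) k(1) swap(5,4,2) neq(2,1) neq(3)[symmetric]])
      moreover have "A k - A j - A i = A k - A i - A j" by blast
      ultimately show "card (A i \<inter> A k) = 0 \<and> e1 = 0 \<and> e3 = 0" using e(1,3) by simp
    qed
    show "e3 > 0 \<longrightarrow> card (A i \<inter> A j) = 0 \<and> e1 = 0 \<and> e2 = 0"
    proof
      assume "e3 > 0"
      then obtain m where "m \<in> A k - A i - A j" using e(3) by blast
      then have "A i \<inter> A j = {} \<and> A i - A k - A j = {} \<and> A j - A k - A i = {}"
        by (rule triangle_exclusive[OF k(1) *(1,2) swap(6,3,1) neq(3) neq(1)[symmetric] neq(2)[symmetric]])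
      moreover have "A i - A k - A j = A i - A j - A k" "A j - A k - A i = A j - A i - A k" by blast+
      ultimately show "card (A i \<inter> A j) = 0 \<and> e1 = 0 \<and> e2 = 0" using e(1,2) by simp
    qed
  qed
qed

text \<open>The two arrows of a 3-cycle at \<open>i\<close> rotate about different endpoints of
  \<open>T i\<close>, so the labels are counted from opposite ends.\<close>

lemma turn_rank:
  assumes ar: "(k, i) \<in> arrows Q" "(i, j) \<in> arrows Q" "(j, k) \<in> arrows Q" and m: "m \<in> A i"
  shows "ru i j m + rv k i m = a i + 1"
proof -
  obtain p q r where *: "i \<in> {1..N}" "j \<in> {1..N}" "T i = {p, q}" "T j = {p, r}" "cyc p q r"
    using ar(2) by (rule arrow_endpoints)
  have "(k, i, j) \<in> three_cycles Q" using ar by (simp add: three_cycles_def)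
  then have k: "T k = {q, r}" using three_cycles_iff[OF *] by simp
  have t: "tip i j = p" by (rule tip_eq[OF *(3-5)])
  have "T i = {q, p}" "cyc q r p" using * by (auto intro: cyc_rotate)
  then have t': "tip k i = q" using k by (intro tip_eq)
  have rev: "key L p x + key L q x = L * (N + 3) + (L - 1)" if "x \<in> A i" for x
    using key_reverse[of "fst x" p q "snd x" L] A_D[OF that] *(3) by simp
  show ?thesis
    unfolding ru_def rv_def t t' card_A[OF *(1), symmetric]
    by (rule rank_reverse[OF finite_A inj_on_key[OF *(1,3)] m rev])
qed

text \<open>If the arrows rotated about different endpoints of \<open>T i\<close>, their orientation
  would put both triangles on the same side; the apex there is unique, so the arrows would close to
  a 3-cycle. Hence both labels are counted from the same end.\<close>

lemma straight_rank:
  assumes ar: "(k, i) \<in> arrows Q" "(i, j) \<in> arrows Q" "(j, k) \<notin> arrows Q"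
  shows "ru i j m = rv k i m"
proof -
  obtain p q r where *: "i \<in> {1..N}" "j \<in> {1..N}" "T i = {p, q}" "T j = {p, r}" "{q, r} \<in> edges N T" "cyc p q r"
    using ar(2) by (rule arrow_endpoints)
  obtain s t v where k: "k \<in> {1..N}" "T k = {s, t}" "T i = {s, v}" "{t, v} \<in> edges N T" "cyc s t v"
    using ar(1) by (rule arrow_endpoints)
  have ti: "tip i j = p" "tip k i = s" by (rule tip_eq[OF *(3,4,6)], rule tip_eq[OF k(2,3,5)])
  have "s = p"
  proof (rule ccontr)
    assume "s \<noteq> p"
    then have sv: "s = q" "v = p" using *(3) k(3) by (auto simp: doubleton_eq_iff)
    have e: "{q, t} \<in> edges N T" "{t, p} \<in> edges N T" "{r, p} \<in> edges N T"
      using T_edge[OF k(1)] T_edge[OF *(2)] k *(4) sv by (simp_all add: insert_commute)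
    have "t = r"
      by (rule apex_unique[OF T _ e(1,2) _ *(5) e(3)]) (use k(5) sv *(6) cyc_rotate in auto)
    then have "(k, i, j) \<in> three_cycles Q"
      using three_cycles_iff[OF *(1-4,6)] k(1,2) sv by simp
    then show False using ar(3) by (simp add: three_cycles_def)
  qed
  then show ?thesis by (simp add: ru_def rv_def ti)
qed

lemma sigma_rank:
  assumes c: "(i, j, k) \<in> three_cycles Q" and m: "m \<in> A i"
  shows "ru i j m \<le> sigma_nat (a i) (a j) (a k) \<longleftrightarrow> m \<in> A j"
proof -
  have "(i, j) \<in> arrows Q" using c by (simp add: three_cycles_def)
  then obtain p q r where *: "i \<in> {1..N}" "j \<in> {1..N}" "T i = {p, q}" "T j = {p, r}" "cyc p q r"
    by (rule arrow_endpoints)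
  have "rank (key L p) (A i) m \<le> card (A i \<inter> A j) \<longleftrightarrow> m \<in> A i \<inter> A j"
    by (rule rank_initial_segment(1)[OF finite_A _ _ m]) (use key_initial_segment[OF *(1-4)] in auto)
  then show ?thesis unfolding sigma_nat_A[OF c] ru_def tip_eq[OF *(3-5)] using m by simp
qed

lemma common_rank:
  assumes "(i, j) \<in> arrows Q" and m: "m \<in> A i" "m \<in> A j"
  shows "ru i j m = rv i j m"
proof -
  obtain p q r where *: "i \<in> {1..N}" "j \<in> {1..N}" "T i = {p, q}" "T j = {p, r}" "cyc p q r"
    using assms(1) by (rule arrow_endpoints)
  have "rank (key L p) (A i) m = rank (key L p) (A i \<inter> A j) m"
    by (rule rank_initial_segment(2)[OF finite_A _ _ m(1)]) (use key_initial_segment[OF *(1-4)] m in auto)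
  moreover have "rank (key L p) (A j) m = rank (key L p) (A i \<inter> A j) m"
    by (rule rank_initial_segment(2)[OF finite_A _ _ m(2)]) (use key_initial_segment[OF *(2,1,4,3)] m in auto)
  ultimately show ?thesis unfolding ru_def rv_def tip_eq[OF *(3-5)] by simp
qed

sublocale crossing_labels Q a M "\<lambda>m. crossed (fst m)" ru rv A
proof
  show "A i = {m \<in> M. i \<in> crossed (fst m)}" for i by (rule A_def)
  show "bij_betw (ru i j) (A i) {1..a i}" if ar: "(i, j) \<in> arrows Q" for i j
  proof -
    obtain p q r where *: "i \<in> {1..N}" "j \<in> {1..N}" "T i = {p, q}" "T j = {p, r}" "cyc p q r"
      using ar by (rule arrow_endpoints)
    show ?thesis unfolding ru_def tip_eq[OF *(3-5)] card_A[OF *(1), symmetric]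
      by (rule rank_bij_betw[OF finite_A inj_on_key[OF *(1,3)]])
  qed
  show "bij_betw (rv i j) (A j) {1..a j}" if ar: "(i, j) \<in> arrows Q" for i j
  proof -
    obtain p q r where *: "i \<in> {1..N}" "j \<in> {1..N}" "T i = {p, q}" "T j = {p, r}" "cyc p q r"
      using ar by (rule arrow_endpoints)
    show ?thesis unfolding rv_def tip_eq[OF *(3-5)] card_A[OF *(2), symmetric]
      by (rule rank_bij_betw[OF finite_A inj_on_key[OF *(2,4)]])
  qed
  show "sigma_nat (a i) (a j) (a k) \<le> a i" if "(i, j, k) \<in> three_cycles Q" for i j k
  proof -
    have "i \<in> {1..N}" using that by (auto simp: three_cycles_def arrows_iff)
    moreover have "card (A i \<inter> A j) \<le> card (A i)" by (intro card_mono finite_A) auto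
    ultimately show ?thesis unfolding sigma_nat_A[OF that] by (simp add: card_A)
  qed
  show "\<exists>k. (i, j, k) \<in> three_cycles Q" if "(i, j) \<in> arrows Q" for i j using cyc3 that by blast
  show "\<exists>j. (i, j) \<in> arrows Q" if "m \<in> M" "i \<in> crossed (fst m)" for m i
    using has_outgoing_arrow[OF N cyc3, of i] that by (auto simp: crossed_def)
qed (rule turn_rank straight_rank sigma_rank common_rank; assumption)+

section \<open>Products over all arcs\<close>

lemma prod_crossed: "(\<Prod>m\<in>M. \<Prod>l\<in>crossed (fst m). xvar l) = (\<Prod>l\<in>{1..N}. xvar l ^ a l)"
proof -
  have "(\<Prod>m\<in>M. \<Prod>l\<in>crossed (fst m). xvar l) = (\<Prod>m\<in>M. \<Prod>l\<in>{1..N}. if l \<in> crossed (fst m) then xvar l else 1)"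
    by (intro prod.cong HOL.refl prod.mono_neutral_cong_left) (auto simp: crossed_def)
  also have "\<dots> = (\<Prod>l\<in>{1..N}. \<Prod>m\<in>M. if l \<in> crossed (fst m) then xvar l else 1)"
    by (rule prod.swap)
  also have "\<dots> = (\<Prod>l\<in>{1..N}. xvar l ^ a l)"
    by (rule prod.cong) (simp_all add: prod_if_power[OF finite_M] A_def[symmetric] card_A)
  finally show ?thesis .
qed

text \<open>An arrow contributes the variable of its third side once for each arc crossing both of
  its ends, and \<open>sigma_nat_A\<close> counts these arcs. Each arrow lies in exactly one
  3-cycle, so the product can run over the rotations of 3-cycles.\<close>

lemma prod_denom:
  "(\<Prod>m\<in>M. denom (crossed (fst m))) = (\<Prod>(i, j, k)\<in>three_cycles Q. xvar i ^ sigma_nat (a j) (a k) (a i))"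
proof -
  let ?g = "\<lambda>e. opposite e ^ card (A (fst e) \<inter> A (snd e))"
  have "(\<Prod>m\<in>M. denom (crossed (fst m))) =
      (\<Prod>m\<in>M. \<Prod>e\<in>arrows Q. if fst e \<in> crossed (fst m) \<and> snd e \<in> crossed (fst m) then opposite e else 1)"
    unfolding denom_def using finite_arrows
    by (intro prod.cong HOL.refl prod.mono_neutral_cong_left) auto
  also have "\<dots> = (\<Prod>e\<in>arrows Q. \<Prod>m\<in>M. if fst e \<in> crossed (fst m) \<and> snd e \<in> crossed (fst m) then opposite e else 1)"
    by (rule prod.swap)
  also have "\<dots> = (\<Prod>e\<in>arrows Q. ?g e)"
  proof (rule prod.cong[OF HOL.refl])
    fix e
    have "{m \<in> M. fst e \<in> crossed (fst m) \<and> snd e \<in> crossed (fst m)} = A (fst e) \<inter> A (snd e)"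
      by (auto simp: A_def)
    then show "(\<Prod>m\<in>M. if fst e \<in> crossed (fst m) \<and> snd e \<in> crossed (fst m) then opposite e else 1) = ?g e"
      by (simp add: prod_if_power[OF finite_M])
  qed
  also have "\<dots> = (\<Prod>t\<in>three_cycles Q. ?g (snd t))"
  proof (rule prod.reindex_bij_betw[symmetric])
    show "bij_betw snd (three_cycles Q) (arrows Q)"
    proof (rule bij_betw_imageI)
      show "inj_on snd (three_cycles Q)"
      proof (rule inj_onI)
        fix t t' assume t: "t \<in> three_cycles Q" "t' \<in> three_cycles Q" "snd t = snd t'"
        obtain i j k i' where eq: "t = (i, j, k)" "t' = (i', j, k)" using t(3) by (cases t; cases t') auto
        have "(j, k) \<in> arrows Q" using t(1) eq by (simp add: three_cycles_def)
        then obtain p q r where *: "j \<in> {1..N}" "k \<in> {1..N}" "T j = {p, q}" "T k = {p, r}" "cyc p q r"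
          by (rule arrow_endpoints)
        have "T i = T i'" "i \<in> {1..N}" "i' \<in> {1..N}" using three_cycles_iff[OF *] t eq by auto
        then show "t = t'" using T_inj eq by simp
      qed
      show "snd ` three_cycles Q = arrows Q"
      proof (intro equalityI subsetI)
        fix e assume "e \<in> arrows Q"
        moreover obtain j k where e: "e = (j, k)" by (cases e)
        ultimately obtain i where "(j, k, i) \<in> three_cycles Q" using cyc3 by blast
        then have "(i, j, k) \<in> three_cycles Q" by (auto simp: three_cycles_def)
        then show "e \<in> snd ` three_cycles Q" unfolding e by force
      qed (auto simp: three_cycles_def)
    qed
  qed
  also have "\<dots> = (\<Prod>(i, j, k)\<in>three_cycles Q. xvar i ^ sigma_nat (a j) (a k) (a i))"
  proof (rule prod.cong[OF HOL.refl], clarify)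
    fix i j k assume t: "(i, j, k) \<in> three_cycles Q"
    then have jki: "(j, k, i) \<in> three_cycles Q" and "(j, k) \<in> arrows Q" by (auto simp: three_cycles_def)
    from this(2) obtain p q r where *: "j \<in> {1..N}" "k \<in> {1..N}" "T j = {p, q}" "T k = {p, r}"
        "{q, r} \<in> edges N T" "cyc p q r"
      by (rule arrow_endpoints)
    have i: "i \<in> {1..N}" "T i = {q, r}" using three_cycles_iff[OF *(1-4,6)] t by auto
    have "opposite (j, k) = xvar i"
      using opposite_eq[OF *(1-4,6,5)] ptolemy_initial[OF f i] by simp
    then show "?g (snd (i, j, k)) = xvar i ^ sigma_nat (a j) (a k) (a i)"
      using sigma_nat_A[OF jki] by simp
  qed
  finally show ?thesis .
qed

text \<open>The weight of a collection factors over the arcs, each factor depending only on the set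
  chosen for that arc; distributivity turns the sum over choices into a product of sums.\<close>

lemma sum_GCC:
  "(\<Sum>S\<in>GCC Q a. gcc_weight Q S) =
    (\<Prod>m\<in>M. \<Sum>\<theta>\<in>upsets (arrows Q) (crossed (fst m)).
       W (crossed (fst m)) \<theta>)"
proof -
  have weight: "gcc_weight Q (to_GCC \<tau>) =
      (\<Prod>m\<in>M. W (crossed (fst m)) (\<tau> m))" for \<tau>
  proof -
    have "(\<Prod>m\<in>M. W (crossed (fst m)) (\<tau> m)) =
      (\<Prod>m\<in>M. \<Prod>(i, j)\<in>arrows Q. (if j \<in> crossed (fst m) \<and> j \<notin> \<tau> m then xvar i else 1) *
         (if i \<in> crossed (fst m) \<and> i \<in> \<tau> m then xvar j else 1))"
      by (intro prod.cong HOL.refl upset_weight_arrows) (auto simp: crossed_def)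
    also have "\<dots> = (\<Prod>e\<in>arrows Q. \<Prod>m\<in>M. case e of (i, j) \<Rightarrow> (if j \<in> crossed (fst m) \<and> j \<notin> \<tau> m then xvar i else 1) *
         (if i \<in> crossed (fst m) \<and> i \<in> \<tau> m then xvar j else 1))"
      by (rule prod.swap)
    also have "\<dots> = gcc_weight Q (to_GCC \<tau>)"
    proof (rule prod.cong[OF HOL.refl], clarify)
      fix i j assume ar: "(i, j) \<in> arrows Q"
      have "{m \<in> M. j \<in> crossed (fst m) \<and> j \<notin> \<tau> m} = {m \<in> A j. j \<notin> \<tau> m}"
        "{m \<in> M. i \<in> crossed (fst m) \<and> i \<in> \<tau> m} = {m \<in> A i. i \<in> \<tau> m}"
        by (auto simp: A_def)
      then show "(\<Prod>m\<in>M. (if j \<in> crossed (fst m) \<and> j \<notin> \<tau> m then xvar i else 1) *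
         (if i \<in> crossed (fst m) \<and> i \<in> \<tau> m then xvar j else 1)) =
         xvar i ^ card (snd (to_GCC \<tau> (i, j))) * xvar j ^ card (fst (to_GCC \<tau> (i, j)))"
        unfolding card_to_GCC[OF ar] prod.distrib prod_if_power[OF finite_M] by simp
    qed
    finally show ?thesis by (rule sym)
  qed
  have "(\<Sum>S\<in>GCC Q a. gcc_weight Q S) =
    (\<Sum>\<tau>\<in>choices.
      gcc_weight Q (to_GCC \<tau>))"
    by (rule sum.reindex_bij_betw[OF bij_betw_to_GCC, symmetric])
  also have "\<dots> = (\<Prod>m\<in>M. \<Sum>\<theta>\<in>upsets (arrows Q) (crossed (fst m)).
       W (crossed (fst m)) \<theta>)"
    unfolding weight by (rule prod_sum_PiE[OF finite_M, symmetric])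
  finally show ?thesis .
qed

lemma expansion:
  "(\<Sum>S\<in>GCC Q a. gcc_weight Q S) =
    (\<Prod>D\<in>C. f (Min D) (Max D) ^ d D) * (\<Prod>l\<in>{1..N}. xvar l ^ a l) *
    (\<Prod>(i, j, k)\<in>three_cycles Q. xvar i ^ sigma_nat (a j) (a k) (a i))"
proof -
  have "(\<Sum>\<theta>\<in>upsets (arrows Q) (crossed (fst m)). W (crossed (fst m)) \<theta>) =
      f (Min (fst m)) (Max (fst m)) * (\<Prod>l\<in>crossed (fst m). xvar l) * denom (crossed (fst m))" if m: "m \<in> M" for m
  proof -
    have D: "diagonal N (fst m)" "fst m \<notin> T ` {1..N}" using M_D(1)[OF m] C(2) not_initial by auto
    obtain b e where be: "fst m = {b, e}" "b + 2 \<le> e" using D(1) by (rule diagonalE)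
    then have "Min (fst m) = b" "Max (fst m) = e" by auto
    then show ?thesis using diagonal_expansion[of b e] D unfolding be(1) by simp
  qed
  then have "(\<Prod>m\<in>M. \<Sum>\<theta>\<in>upsets (arrows Q) (crossed (fst m)). W (crossed (fst m)) \<theta>) =
      (\<Prod>m\<in>M. f (Min (fst m)) (Max (fst m))) * (\<Prod>m\<in>M. \<Prod>l\<in>crossed (fst m). xvar l) * (\<Prod>m\<in>M. denom (crossed (fst m)))"
    by (simp add: prod.distrib)
  moreover have "(\<Prod>m\<in>M. f (Min (fst m)) (Max (fst m))) = (\<Prod>D\<in>C. f (Min D) (Max D) ^ d D)"
    using prod.Sigma[of C "\<lambda>D. {..<d D}" "\<lambda>D c. f (Min D) (Max D)"] C(1)
    by (simp add: M_def case_prod_unfold)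
  ultimately show ?thesis unfolding sum_GCC prod_crossed prod_denom by simp
qed

end

theorem theorem4p5:
  fixes n :: nat and Q :: quiver and T :: "nat \<Rightarrow> nat set"
    and a :: "nat \<Rightarrow> nat" and X :: ratfun
  assumes "n > 1"
    and "type_A_quiver n Q"
    and "\<forall>(i, j)\<in>arrows Q. \<exists>k. (i, j, k) \<in> three_cycles Q"
    and "triangulation n T" and "quiver_of_triangulation n T = Q"
    and "cluster_monomial n Q X"
    and "has_d_vector n T X (\<lambda>i. int (a i))"
  shows "X =
    (\<Prod>l\<in>{1..n}. xvar l powi (- int (a l))) *
    (\<Sum>S\<in>GCC Q a. \<Prod>(i, j)\<in>arrows Q. xvar i ^ card (snd (S (i, j))) * xvar j ^ card (fst (S (i, j)))) *
    (\<Prod>(i, j, k)\<in>three_cycles Q. xvar i powi (- int (sigma_nat (a j) (a k) (a i))))"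
proof -
  obtain C d where mon: "monomial_of_collection n T C d X"
    and a: "\<And>i. i \<in> {1..n} \<Longrightarrow> int (a i) = (\<Sum>D\<in>C. int (d D) * crossing_number D (T i))"
    using assms(7) unfolding has_d_vector_def by blast
  obtain z where C: "finite C" "\<And>D. D \<in> C \<Longrightarrow> diagonal n D" "\<And>D. D \<in> C \<Longrightarrow> d D > 0"
      "\<And>D E. D \<in> C \<Longrightarrow> E \<in> C \<Longrightarrow> \<not> crosses D E"
    and z: "\<And>D. D \<in> C \<Longrightarrow> variable_of_diagonal n T D (z D)" and X: "X = (\<Prod>D\<in>C. z D ^ d D)"
    using mon unfolding monomial_of_collection_def by blast
  obtain f where f: "ptolemy_function n T f" using exists_ptolemy_function[OF assms(4)] .
  interpret arc_collection n T f C d a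
    using assms(1,3,4) f C a unfolding assms(5)[symmetric] by unfold_locales
  \<comment> \<open>A priori different flip sequences could give \<open>D\<close> different
    variables; the Ptolemy value determines \<open>z D\<close> independently of them.\<close>
  have zf: "z D = f (Min D) (Max D)" if D: "D \<in> C" for D
  proof -
    obtain b e where be: "D = {b, e}" "b + 2 \<le> e" using C(2)[OF D] by (rule diagonalE)
    then have "Min D = b" "Max D = e" by auto
    then show ?thesis using variable_of_diagonal_ptolemy[OF _ assms(4) f, of b e "z D"] z[OF D] be(1) by simp
  qed
  have X': "X = (\<Prod>D\<in>C. f (Min D) (Max D) ^ d D)" unfolding X using zf by (intro prod.cong) auto
  note nz = positive_ratfun_nonzero[OF positive_ratfun_xvar]
  have inv: "xvar l powi (- int k) = inverse (xvar l ^ k)" for l k by (simp add: power_int_minus)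
  define P1 where "P1 = (\<Prod>l\<in>{1..n}. xvar l ^ a l)"
  define P2 where "P2 = (\<Prod>(i, j, k)\<in>three_cycles Q. xvar i ^ sigma_nat (a j) (a k) (a i))"
  have "finite (three_cycles Q)"
    by (rule finite_subset[of _ "{1..n} \<times> {1..n} \<times> {1..n}"])
      (auto simp: three_cycles_def arrows_iff assms(5)[symmetric])
  \<comment> \<open>The cleared form in \<open>expansion\<close> carries both monomials as factors,
    so they must be nonzero to be cancelled.\<close>
  then have P: "P1 \<noteq> 0" "P2 \<noteq> 0" using nz by (auto simp: P1_def P2_def)
  have "(\<Prod>l\<in>{1..n}. xvar l powi (- int (a l))) = inverse P1"
    unfolding inv P1_def by (simp add: prod_inversef[symmetric] o_def)
  moreover have "(\<Prod>(i, j, k)\<in>three_cycles Q. xvar i powi (- int (sigma_nat (a j) (a k) (a i)))) = inverse P2"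
    unfolding inv P2_def by (simp add: prod_inversef[symmetric] o_def case_prod_unfold)
  ultimately show ?thesis
    using expansion P unfolding assms(5) P1_def[symmetric] P2_def[symmetric] X' by simp
qed

end
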